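(* Let $Q$ be a quiver, $v\in Q_0$, and let $\underline{d},\underline f\in\mathbb{Z}_{\ge 0}^{Q_0}$ with $\underline d-\delta_v\in\mathbb{Z}_{\ge0}^{Q_0}$. Let $N_Q(\underline d,\underline d-\delta_v;\underline f)$ be the Nakajima correspondence between $\mathcal{M}_Q(\underline d;\underline f)$ and $\mathcal{M}_Q(\underline d-\delta_v;\underline f)$. Then $$N_Q(\underline d,\underline d-\delta_v;\underline f)\simeq\mathcal{M}_Q(\underline d,\underline d-\delta_v;\underline f)\times\mathbb{C}^{2|Q_1(v,v)|},$$ where $\mathcal{M}_Q(\underline d,\underline d-\delta_v;\underline f)$ is the split parabolic quiver variety.
   Context: Everything is over $\mathbb{C}$. $Q=(Q_0,Q_1,\mathrm{out},\mathrm{in})$ is a quiver (loops and multiple arrows allowed); an arrow $e\in Q_1$ goes from $\mathrm{out}(e)$ to $\mathrm{in}(e)$; $Q_1(v,w)$ is the set of arrows from $v$ to $w$; $\delta_v\in\mathbb{Z}^{Q_0}$ has $1$ in position $v$ and zeros elsewhere. Given $\underline{d},\underline{f}\in\mathbb{Z}_{\ge0}^{Q_0}$, fix vector spaces $D_v,F_v$ with $\dim D_v=d_v$, $\dim F_v=f_v$. A representation of the double framed quiver with dimension vector $\underline d$ and framing vector $\underline f$ is a tuple $(A_e,B_e,i_v,j_v)$ with $A_e:D_{\mathrm{out}(e)}\to D_{\mathrm{in}(e)}$, $B_e:D_{\mathrm{in}(e)}\to D_{\mathrm{out}(e)}$, $i_v:F_v\to D_v$, $j_v:D_v\to F_v$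 linear. Moment map equations: for all $v$, $\sum_{\mathrm{in}(e)=v}A_eB_e-\sum_{\mathrm{out}(e)=v}B_eA_e+i_vj_v=0$. Stability: the only collection of subspaces $D'_v\subseteq D_v$ with $i_v(F_v)\subseteq D'_v$ for all $v$ and preserved by all $A_e,B_e$ is $D'_v=D_v$. The group $G_{\underline d}=\prod_v\mathrm{GL}(D_v)$ acts by $g\cdot(A,B,i,j)=(g_{\mathrm{in}(e)}A_eg_{\mathrm{out}(e)}^{-1},g_{\mathrm{out}(e)}B_eg_{\mathrm{in}(e)}^{-1},g_vi_v,j_vg_v^{-1})$. The Nakajima quiver variety $\mathcal{M}_Q(\underline d;\underline f)$ is the quotient by $G_{\underline d}$ of the set of stable tuples satisfying the moment map equations. For two such representations $D,\widehat D$ with the same framing spaces, a map $\pi:D\to\widehat D$ means linear maps $\pi_w:D_w\to\widehat D_w$ such that $\pi$ intertwines the $A_e$ and $B_e$, $\pi_w i_w=\widehat i_w$ and $\widehat j_w\pi_w=j_w$ (i.e. a morphism of representations that is the identity on framing spaces). The Nakajima correspondence $N_Q(\underline d,\underline d-\delta_v;\underline f)\subseteq\mathcal{M}_Q(\underline d;\underline f)\times\mathcal{M}_Q(\underline d-\delta_v;\underline f)$ consists of the pairs $(D,\widehat D)$ for which there exists a surjective map $\pi:D\twoheadrightarrow\widehat D$. The split parabolic quiver variety $\mathcal{M}_Q(\underline d^{(0)},\underline d^{(1)};\underline f)$ parametrizes triples $(D^{(0)},D^{(1)},\pi)$ where $D^{(0)},D^{(1)}$ are stable representations satisfying the moment map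 equations, of dimension vectors $\underline d^{(0)},\underline d^{(1)}$ and with common framing spaces $F_v$, and $\pi:D^{(0)}\to D^{(1)}$ is a collection of linear maps $\pi_w:D^{(0)}_w\to D^{(1)}_w$ which intertwines $A_e^{(0)},B_e^{(0)}$ with $A_e^{(1)},B_e^{(1)}$ and satisfies $\pi_wi_w^{(0)}=i_w^{(1)}$ and $j_w^{(1)}\pi_w=j_w^{(0)}$ for all $w\in Q_0$ (automatically surjective) such that all $A_e^{(0)},B_e^{(0)},j_w^{(0)}$ vanish on $\ker\pi$; precisely, it is the quotient of the variety of such triples by the free action of $G_{\underline d^{(0)}}\times G_{\underline d^{(1)}}$. *)

theory Defs
  imports
    "HOL-Analysis.Analysis"
    "HOL-Algebra.Group_Action"
    "HOL-Algebra.Product_Groups"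
    "Graph_Theory.Digraph"
    "Jordan_Normal_Form.Matrix_Kernel"
begin

section \<open>Complex varieties as spaces with functions\<close>

text \<open>
  Varieties are treated in the classical (reduced) language: a variety is a topological space
  together with the sheaf of its regular complex-valued functions.
  \<open>reg X U f\<close> means that \<open>f\<close>, restricted to the open set \<open>U\<close>, is a section of the sheaf over \<open>U\<close>;
  the values of \<open>f\<close> outside \<open>U\<close> play no role.
\<close>

record 'a fspace =
  fs_top :: "'a topology"
  reg :: "'a set \<Rightarrow> ('a \<Rightarrow> complex) \<Rightarrow> bool"

abbreviation fs_points :: "'a fspace \<Rightarrow> 'a set" where
  "fs_points X \<equiv> topspace (fs_top X)"

definition fs_morphism :: "'a fspace \<Rightarrow> 'b fspace \<Rightarrow> ('a \<Rightarrow> 'b) \<Rightarrow> bool" where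
  "fs_morphism X Y \<phi> \<longleftrightarrow>
     continuous_map (fs_top X) (fs_top Y) \<phi> \<and>
     (\<forall>V h. openin (fs_top Y) V \<longrightarrow> reg Y V h \<longrightarrow>
        reg X {x \<in> fs_points X. \<phi> x \<in> V} (h \<circ> \<phi>))"

definition fs_isomorphic :: "'a fspace \<Rightarrow> 'b fspace \<Rightarrow> bool" where
  "fs_isomorphic X Y \<longleftrightarrow>
     (\<exists>\<phi> \<psi>. fs_morphism X Y \<phi> \<and> fs_morphism Y X \<psi> \<and>
        (\<forall>x\<in>fs_points X. \<psi> (\<phi> x) = x) \<and> (\<forall>y\<in>fs_points Y. \<phi> (\<psi> y) = y))"

text \<open>
  The polynomial functions in a given set \<open>C\<close> of coordinate functions, and the resulting
  structure on a set \<open>S\<close> of points: the Zariski topology, with the functions that are locally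
  quotients of polynomials.  If \<open>C\<close> consists of finitely many coordinates identifying \<open>S\<close> with
  a locally closed subset of an affine space, this is the usual quasi-affine variety.
\<close>

inductive_set polyfun :: "('a \<Rightarrow> complex) set \<Rightarrow> ('a \<Rightarrow> complex) set"
  for C :: "('a \<Rightarrow> complex) set" where
  const: "(\<lambda>_. c) \<in> polyfun C"
| coord: "p \<in> C \<Longrightarrow> p \<in> polyfun C"
| add: "p \<in> polyfun C \<Longrightarrow> q \<in> polyfun C \<Longrightarrow> (\<lambda>x. p x + q x) \<in> polyfun C"
| mult: "p \<in> polyfun C \<Longrightarrow> q \<in> polyfun C \<Longrightarrow> (\<lambda>x. p x * q x) \<in> polyfun C"

definition quasi_affine :: "('a \<Rightarrow> complex) set \<Rightarrow> 'a set \<Rightarrow> 'a fspace" where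
  "quasi_affine C S =
    (let T = topology_generated_by {{x \<in> S. p x \<noteq> 0} |p. p \<in> polyfun C} in
     \<lparr> fs_top = T,
       reg = (\<lambda>U f. openin T U \<and>
         (\<forall>x\<in>U. \<exists>p\<in>polyfun C. \<exists>q\<in>polyfun C.
            q x \<noteq> 0 \<and> (\<forall>y\<in>U. q y \<noteq> 0 \<longrightarrow> f y = p y / q y))) \<rparr>)"

definition affine_space :: "nat \<Rightarrow> (nat \<Rightarrow> complex) fspace" where
  "affine_space n = quasi_affine {\<lambda>x. x i |i. i < n} ({..<n} \<rightarrow>\<^sub>E UNIV)"

text \<open>The reduced induced structure on a subset.\<close>

definition fs_sub :: "'a fspace \<Rightarrow> 'a set \<Rightarrow> 'a fspace" where
  "fs_sub X S =
    (let T = subtopology (fs_top X) S in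
     \<lparr> fs_top = T,
       reg = (\<lambda>U f. openin T U \<and>
         (\<forall>x\<in>U. \<exists>V g. openin (fs_top X) V \<and> x \<in> V \<and> reg X V g \<and>
            (\<forall>y \<in> U \<inter> V. f y = g y))) \<rparr>)"

text \<open>
  The product: the topology is generated not by the open boxes but by the non-vanishing loci
  on open boxes \<open>U \<times> V\<close> of functions \<open>\<Sum>i. f\<^sub>i(x) g\<^sub>i(y)\<close>, and the regular functions
  are locally quotients of two such functions.
\<close>

definition tensor_fun ::
    "'a fspace \<Rightarrow> 'b fspace \<Rightarrow> 'a set \<Rightarrow> 'b set \<Rightarrow> ('a \<times> 'b \<Rightarrow> complex) set" where
  "tensor_fun X Y U V =
     {(\<lambda>(x, y). \<Sum>i<n. f i x * g i y) |(n::nat) f g. \<forall>i<n. reg X U (f i) \<and> reg Y V (g i)}"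

definition fs_prod :: "'a fspace \<Rightarrow> 'b fspace \<Rightarrow> ('a \<times> 'b) fspace" where
  "fs_prod X Y =
    (let T = topology_generated_by
               {{z \<in> U \<times> V. s z \<noteq> 0} |U V s.
                 openin (fs_top X) U \<and> openin (fs_top Y) V \<and> s \<in> tensor_fun X Y U V} in
     \<lparr> fs_top = T,
       reg = (\<lambda>W h. openin T W \<and>
         (\<forall>z\<in>W. \<exists>U V s t. openin (fs_top X) U \<and> openin (fs_top Y) V \<and>
            s \<in> tensor_fun X Y U V \<and> t \<in> tensor_fun X Y U V \<and>
            z \<in> U \<times> V \<and> s z \<noteq> 0 \<and>
            (\<forall>w \<in> W \<inter> (U \<times> V). s w \<noteq> 0 \<longrightarrow> h w = t w / s w))) \<rparr>)"

text \<open>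
  The geometric quotient: the orbit space with the quotient topology, whose regular functions
  are the invariant regular functions upstairs.
\<close>

definition quotient_top ::
    "'b topology \<Rightarrow> ('g, 'm) monoid_scheme \<Rightarrow> ('g \<Rightarrow> 'b \<Rightarrow> 'b) \<Rightarrow> 'b set topology" where
  "quotient_top T G \<phi> = topology (\<lambda>U. U \<subseteq> orbits G (topspace T) \<phi> \<and>
      openin T {x \<in> topspace T. Group_Action.orbit G \<phi> x \<in> U})"

lemma openin_quotient_top:
  "openin (quotient_top T G \<phi>) U \<longleftrightarrow>
     U \<subseteq> orbits G (topspace T) \<phi> \<and>
     openin T {x \<in> topspace T. Group_Action.orbit G \<phi> x \<in> U}"
proof -
  let ?pre = "\<lambda>U. {x \<in> topspace T. Group_Action.orbit G \<phi> x \<in> U}"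
  have "istopology (\<lambda>U. U \<subseteq> orbits G (topspace T) \<phi> \<and> openin T (?pre U))"
    unfolding istopology_def
  proof (intro conjI allI impI; (elim conjE)?)
    fix S S' assume "openin T (?pre S)" "openin T (?pre S')"
    then have "openin T (?pre S \<inter> ?pre S')" by (rule openin_Int)
    moreover have "?pre S \<inter> ?pre S' = ?pre (S \<inter> S')" by auto
    ultimately show "openin T (?pre (S \<inter> S'))" by simp
  next
    fix \<K> assume *: "\<forall>K\<in>\<K>. K \<subseteq> orbits G (topspace T) \<phi> \<and> openin T (?pre K)"
    then have "openin T (\<Union>K\<in>\<K>. ?pre K)" by blast
    moreover have "(\<Union>K\<in>\<K>. ?pre K) = ?pre (\<Union>\<K>)" by auto
    ultimately show "openin T (?pre (\<Union>\<K>))" by simp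
    from * show "\<Union>\<K> \<subseteq> orbits G (topspace T) \<phi>" by blast
  qed auto
  then show ?thesis
    unfolding quotient_top_def by (simp add: topology_inverse')
qed

definition fs_quotient ::
    "'b fspace \<Rightarrow> ('g, 'm) monoid_scheme \<Rightarrow> ('g \<Rightarrow> 'b \<Rightarrow> 'b) \<Rightarrow> 'b set fspace" where
  "fs_quotient X G \<phi> =
    (let T = quotient_top (fs_top X) G \<phi> in
     \<lparr> fs_top = T,
       reg = (\<lambda>U h. openin T U \<and>
         reg X {x \<in> fs_points X. Group_Action.orbit G \<phi> x \<in> U}
               (\<lambda>x. h (Group_Action.orbit G \<phi> x))) \<rparr>)"


section \<open>Representations of the double framed quiver\<close>

text \<open>
  A quiver is a finite directed multigraph of \<open>Graph_Theory\<close> with \<open>out = tail\<close> and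
  \<open>in = head\<close>.  The fixed vector spaces are the coordinate spaces \<open>D\<^sub>v = \<complex>\<^bsup>d v\<^esup>\<close> and
  \<open>F\<^sub>v = \<complex>\<^bsup>f v\<^esup>\<close>, so that linear maps are matrices.  Tuples are extensional functions on
  \<open>verts Q\<close> and \<open>arcs Q\<close>, so that equality of records is equality of tuples.
\<close>

record ('v, 'e) qrep =
  rA :: "'e \<Rightarrow> complex mat"
  rB :: "'e \<Rightarrow> complex mat"
  ri :: "'v \<Rightarrow> complex mat"
  rj :: "'v \<Rightarrow> complex mat"

definition delta :: "'v \<Rightarrow> 'v \<Rightarrow> nat" where
  "delta v = (\<lambda>w. if w = v then 1 else 0)"

definition arcs_between :: "('v, 'e) pre_digraph \<Rightarrow> 'v \<Rightarrow> 'v \<Rightarrow> 'e set" where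
  "arcs_between Q v w = {e \<in> arcs Q. tail Q e = v \<and> head Q e = w}"

definition qreps ::
    "('v, 'e) pre_digraph \<Rightarrow> ('v \<Rightarrow> nat) \<Rightarrow> ('v \<Rightarrow> nat) \<Rightarrow> ('v, 'e) qrep set" where
  "qreps Q d f = {D.
     rA D \<in> (\<Pi>\<^sub>E e\<in>arcs Q. carrier_mat (d (head Q e)) (d (tail Q e))) \<and>
     rB D \<in> (\<Pi>\<^sub>E e\<in>arcs Q. carrier_mat (d (tail Q e)) (d (head Q e))) \<and>
     ri D \<in> (\<Pi>\<^sub>E w\<in>verts Q. carrier_mat (d w) (f w)) \<and>
     rj D \<in> (\<Pi>\<^sub>E w\<in>verts Q. carrier_mat (f w) (d w))}"

text \<open>The moment map equations, entry by entry since matrices do not form an additive monoid type.\<close>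

definition moment_eq :: "('v, 'e) pre_digraph \<Rightarrow> ('v \<Rightarrow> nat) \<Rightarrow> ('v, 'e) qrep \<Rightarrow> bool" where
  "moment_eq Q d D \<longleftrightarrow> (\<forall>w\<in>verts Q. \<forall>a<d w. \<forall>b<d w.
     (\<Sum>e\<in>in_arcs Q w. (rA D e * rB D e) $$ (a, b))
     - (\<Sum>e\<in>out_arcs Q w. (rB D e * rA D e) $$ (a, b))
     + (ri D w * rj D w) $$ (a, b) = 0)"

definition stable ::
    "('v, 'e) pre_digraph \<Rightarrow> ('v \<Rightarrow> nat) \<Rightarrow> ('v \<Rightarrow> nat) \<Rightarrow> ('v, 'e) qrep \<Rightarrow> bool" where
  "stable Q d f D \<longleftrightarrow> (\<forall>D' :: 'v \<Rightarrow> complex vec set.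
     (\<forall>w\<in>verts Q. VectorSpace.subspace class_ring (D' w) (module_vec TYPE(complex) (d w))) \<and>
     (\<forall>w\<in>verts Q. \<forall>x\<in>carrier_vec (f w). ri D w *\<^sub>v x \<in> D' w) \<and>
     (\<forall>e\<in>arcs Q. \<forall>x\<in>D' (tail Q e). rA D e *\<^sub>v x \<in> D' (head Q e)) \<and>
     (\<forall>e\<in>arcs Q. \<forall>x\<in>D' (head Q e). rB D e *\<^sub>v x \<in> D' (tail Q e))
     \<longrightarrow> (\<forall>w\<in>verts Q. D' w = carrier_vec (d w)))"

definition nak_reps ::
    "('v, 'e) pre_digraph \<Rightarrow> ('v \<Rightarrow> nat) \<Rightarrow> ('v \<Rightarrow> nat) \<Rightarrow> ('v, 'e) qrep set" where
  "nak_reps Q d f = {D \<in> qreps Q d f. moment_eq Q d D \<and> stable Q d f D}"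

definition qrep_coords ::
    "('v, 'e) pre_digraph \<Rightarrow> ('v \<Rightarrow> nat) \<Rightarrow> ('v \<Rightarrow> nat) \<Rightarrow> (('v, 'e) qrep \<Rightarrow> complex) set" where
  "qrep_coords Q d f =
     {\<lambda>D. rA D e $$ (a, b) |e a b. e \<in> arcs Q \<and> a < d (head Q e) \<and> b < d (tail Q e)} \<union>
     {\<lambda>D. rB D e $$ (a, b) |e a b. e \<in> arcs Q \<and> a < d (tail Q e) \<and> b < d (head Q e)} \<union>
     {\<lambda>D. ri D w $$ (a, b) |w a b. w \<in> verts Q \<and> a < d w \<and> b < f w} \<union>
     {\<lambda>D. rj D w $$ (a, b) |w a b. w \<in> verts Q \<and> a < f w \<and> b < d w}"

abbreviation GL :: "nat \<Rightarrow> complex mat monoid" where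
  "GL n \<equiv> units_of (ring_mat TYPE(complex) n ())"

definition gauge_group ::
    "('v, 'e) pre_digraph \<Rightarrow> ('v \<Rightarrow> nat) \<Rightarrow> ('v \<Rightarrow> complex mat) monoid" where
  "gauge_group Q d = product_group (verts Q) (\<lambda>w. GL (d w))"

definition gauge_act ::
    "('v, 'e) pre_digraph \<Rightarrow> ('v \<Rightarrow> nat) \<Rightarrow> ('v \<Rightarrow> complex mat) \<Rightarrow> ('v, 'e) qrep \<Rightarrow> ('v, 'e) qrep" where
  "gauge_act Q d g D = \<lparr>
     rA = (\<lambda>e\<in>arcs Q. g (head Q e) * rA D e * inv\<^bsub>GL (d (tail Q e))\<^esub> (g (tail Q e))),
     rB = (\<lambda>e\<in>arcs Q. g (tail Q e) * rB D e * inv\<^bsub>GL (d (head Q e))\<^esub> (g (head Q e))),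
     ri = (\<lambda>w\<in>verts Q. g w * ri D w),
     rj = (\<lambda>w\<in>verts Q. rj D w * inv\<^bsub>GL (d w)\<^esub> (g w)) \<rparr>"

definition nakajima_variety ::
    "('v, 'e) pre_digraph \<Rightarrow> ('v \<Rightarrow> nat) \<Rightarrow> ('v \<Rightarrow> nat) \<Rightarrow> ('v, 'e) qrep set fspace" where
  "nakajima_variety Q d f =
     fs_quotient (quasi_affine (qrep_coords Q d f) (nak_reps Q d f))
       (gauge_group Q d) (gauge_act Q d)"

definition qrep_maps ::
    "('v, 'e) pre_digraph \<Rightarrow> ('v \<Rightarrow> nat) \<Rightarrow> ('v \<Rightarrow> nat)
      \<Rightarrow> ('v, 'e) qrep \<Rightarrow> ('v, 'e) qrep \<Rightarrow> ('v \<Rightarrow> complex mat) set" where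
  "qrep_maps Q d d' D D' = {\<pi> \<in> (\<Pi>\<^sub>E w\<in>verts Q. carrier_mat (d' w) (d w)).
     (\<forall>e\<in>arcs Q. \<pi> (head Q e) * rA D e = rA D' e * \<pi> (tail Q e)) \<and>
     (\<forall>e\<in>arcs Q. \<pi> (tail Q e) * rB D e = rB D' e * \<pi> (head Q e)) \<and>
     (\<forall>w\<in>verts Q. \<pi> w * ri D w = ri D' w) \<and>
     (\<forall>w\<in>verts Q. rj D' w * \<pi> w = rj D w)}"

definition surjective_map ::
    "('v, 'e) pre_digraph \<Rightarrow> ('v \<Rightarrow> nat) \<Rightarrow> ('v \<Rightarrow> nat) \<Rightarrow> ('v \<Rightarrow> complex mat) \<Rightarrow> bool" where
  "surjective_map Q d d' \<pi> \<longleftrightarrow>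
     (\<forall>w\<in>verts Q. (\<lambda>x. \<pi> w *\<^sub>v x) ` carrier_vec (d w) = carrier_vec (d' w))"

text \<open>
  The correspondence, for arbitrary dimension vectors \<open>d\<close>, \<open>d'\<close>, as a reduced subvariety of
  the product of the two quiver varieties.
\<close>

definition nakajima_correspondence ::
    "('v, 'e) pre_digraph \<Rightarrow> ('v \<Rightarrow> nat) \<Rightarrow> ('v \<Rightarrow> nat) \<Rightarrow> ('v \<Rightarrow> nat)
      \<Rightarrow> (('v, 'e) qrep set \<times> ('v, 'e) qrep set) fspace" where
  "nakajima_correspondence Q d d' f =
     fs_sub (fs_prod (nakajima_variety Q d f) (nakajima_variety Q d' f))
       {(Group_Action.orbit (gauge_group Q d) (gauge_act Q d) D,
         Group_Action.orbit (gauge_group Q d') (gauge_act Q d') D') |D D'.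
          D \<in> nak_reps Q d f \<and> D' \<in> nak_reps Q d' f \<and>
          (\<exists>\<pi>\<in>qrep_maps Q d d' D D'. surjective_map Q d d' \<pi>)}"


section \<open>Split parabolic quiver varieties\<close>

definition vanishes_on_kernel ::
    "('v, 'e) pre_digraph \<Rightarrow> ('v \<Rightarrow> nat) \<Rightarrow> ('v \<Rightarrow> nat) \<Rightarrow> ('v, 'e) qrep \<Rightarrow> ('v \<Rightarrow> complex mat) \<Rightarrow> bool" where
  "vanishes_on_kernel Q d f D \<pi> \<longleftrightarrow>
     (\<forall>e\<in>arcs Q. \<forall>x\<in>mat_kernel (\<pi> (tail Q e)). rA D e *\<^sub>v x = 0\<^sub>v (d (head Q e))) \<and>
     (\<forall>e\<in>arcs Q. \<forall>x\<in>mat_kernel (\<pi> (head Q e)). rB D e *\<^sub>v x = 0\<^sub>v (d (tail Q e))) \<and>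
     (\<forall>w\<in>verts Q. \<forall>x\<in>mat_kernel (\<pi> w). rj D w *\<^sub>v x = 0\<^sub>v (f w))"

type_synonym ('v, 'e) qtriple = "('v, 'e) qrep \<times> ('v, 'e) qrep \<times> ('v \<Rightarrow> complex mat)"

definition split_triples ::
    "('v, 'e) pre_digraph \<Rightarrow> ('v \<Rightarrow> nat) \<Rightarrow> ('v \<Rightarrow> nat) \<Rightarrow> ('v \<Rightarrow> nat) \<Rightarrow> ('v, 'e) qtriple set" where
  "split_triples Q d0 d1 f = {(D0, D1, \<pi>).
     D0 \<in> nak_reps Q d0 f \<and> D1 \<in> nak_reps Q d1 f \<and>
     \<pi> \<in> qrep_maps Q d0 d1 D0 D1 \<and> vanishes_on_kernel Q d0 f D0 \<pi>}"

definition split_coords ::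
    "('v, 'e) pre_digraph \<Rightarrow> ('v \<Rightarrow> nat) \<Rightarrow> ('v \<Rightarrow> nat) \<Rightarrow> ('v \<Rightarrow> nat)
      \<Rightarrow> (('v, 'e) qtriple \<Rightarrow> complex) set" where
  "split_coords Q d0 d1 f =
     {\<lambda>(D0, D1, \<pi>). c D0 |c. c \<in> qrep_coords Q d0 f} \<union>
     {\<lambda>(D0, D1, \<pi>). c D1 |c. c \<in> qrep_coords Q d1 f} \<union>
     {\<lambda>(D0, D1, \<pi>). \<pi> w $$ (a, b) |w a b. w \<in> verts Q \<and> a < d1 w \<and> b < d0 w}"

definition split_act ::
    "('v, 'e) pre_digraph \<Rightarrow> ('v \<Rightarrow> nat) \<Rightarrow> ('v \<Rightarrow> nat)
      \<Rightarrow> ('v \<Rightarrow> complex mat) \<times> ('v \<Rightarrow> complex mat) \<Rightarrow> ('v, 'e) qtriple \<Rightarrow> ('v, 'e) qtriple" where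
  "split_act Q d0 d1 = (\<lambda>(g, h) (D0, D1, \<pi>).
     (gauge_act Q d0 g D0, gauge_act Q d1 h D1,
      \<lambda>w\<in>verts Q. h w * \<pi> w * inv\<^bsub>GL (d0 w)\<^esub> (g w)))"

definition split_parabolic_variety ::
    "('v, 'e) pre_digraph \<Rightarrow> ('v \<Rightarrow> nat) \<Rightarrow> ('v \<Rightarrow> nat) \<Rightarrow> ('v \<Rightarrow> nat)
      \<Rightarrow> ('v, 'e) qtriple set fspace" where
  "split_parabolic_variety Q d0 d1 f =
     fs_quotient (quasi_affine (split_coords Q d0 d1 f) (split_triples Q d0 d1 f))
       (gauge_group Q d0 \<times>\<times> gauge_group Q d1) (split_act Q d0 d1)"

end

theory Submission
  imports Defs "Jordan_Normal_Form.Determinant"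
begin

text \<open>
  Let \<open>\<pi> : D \<rightarrow> D'\<close> be a map between stable representations of dimension vectors \<open>d\<close> and
  \<open>d - \<delta>\<^sub>v\<close>.  It is surjective, so its kernel is a line \<open>K\<close> at the vertex \<open>v\<close>.  On \<open>K\<close> the maps
  \<open>j\<close> vanish, and so do all arrows except the loops at \<open>v\<close>; a loop \<open>e\<close> acts on \<open>K\<close> by two scalars
  \<open>a e\<close> and \<open>b e\<close>.  Subtracting \<open>a e\<close> from \<open>A e\<close> and \<open>b e\<close> from \<open>B e\<close>, on \<open>D\<close> and on \<open>D'\<close>
  simultaneously, turns \<open>(D, D', \<pi>)\<close> into a split triple.  This destroys nothing: scalar matrices
  commute with everything, so the commutators in the moment map equation are unchanged; the
  subspaces preserved by the arrows are unchanged, hence stability; and \<open>\<pi>\<close> still intertwines.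
  The isomorphism sends \<open>(D, D')\<close> to the orbit of the split triple together with the scalars
  \<open>a\<close>, \<open>b\<close>, and its inverse adds the scalars back.

  What remains is that both directions are regular.  The scalars are differences of traces,
  \<open>a e = tr (A e) - tr (A' e)\<close>, because the trace is additive along \<open>K \<rightarrow> D \<rightarrow> D'\<close>
  (\<open>kernel_eigenvalue\<close>); these are invariant polynomials.  The map \<open>\<pi>\<close> is controlled by the vectors
  obtained from the framing by following words in the arrows, called covariants below.  Every map
  carries the covariants of \<open>D\<close> to those of \<open>D'\<close>, and stability says that they span
  (\<open>stable_frame\<close>).  Hence \<open>\<pi>\<close> is determined by \<open>D\<close> and \<open>D'\<close> (\<open>map_unique\<close>).  Moreover, a choice of
  covariants forming a basis at each vertex singles out, in every nearby orbit, the unique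
  representative for which this basis is the standard one.  These representatives form a local
  section of the quotient by the gauge group (\<open>local_section\<close>), and for a normalized \<open>D\<close> the
  matrix of \<open>\<pi>\<close> simply consists of the covariants of \<open>D'\<close>.

  With local sections at hand, a morphism out of a quotient can be given by formulas on
  representations.  The gluing is formal: all spaces in the statement are spaces with functions,
  and in that category products, subspaces and quotients have the usual universal properties.
\<close>

section \<open>Spaces with functions\<close>

definition locally_reg :: "'a fspace \<Rightarrow> 'a set \<Rightarrow> ('a \<Rightarrow> complex) \<Rightarrow> 'a \<Rightarrow> bool" where
  "locally_reg X U f x \<longleftrightarrow>
     (\<exists>V g. openin (fs_top X) V \<and> x \<in> V \<and> reg X V g \<and> (\<forall>y\<in>U \<inter> V. f y = g y))"

lemma locally_regI:
  "openin (fs_top X) V \<Longrightarrow> x \<in> V \<Longrightarrow> reg X V g \<Longrightarrow> (\<And>y. y \<in> U \<Longrightarrow> y \<in> V \<Longrightarrow> f y = g y) \<Longrightarrow>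
   locally_reg X U f x"
  unfolding locally_reg_def by (intro exI[of _ V] exI[of _ g]) simp

lemma locally_regE:
  assumes "locally_reg X U f x"
  obtains V g where "openin (fs_top X) V" "x \<in> V" "reg X V g" "\<forall>y\<in>U \<inter> V. f y = g y"
  using assms unfolding locally_reg_def by (elim exE conjE) (rule that)

text \<open>
  A sheaf of rings of functions, in which the locus where a function does not vanish is open and
  carries the reciprocal of the function.  These axioms hold for every space in the statement, and
  they suffice for all the universal properties below.
\<close>

locale function_space =
  fixes X :: "'a fspace"
  assumes reg_openin: "reg X U f \<Longrightarrow> openin (fs_top X) U"
    and reg_local: "openin (fs_top X) U \<Longrightarrow> (\<And>x. x \<in> U \<Longrightarrow> locally_reg X U f x) \<Longrightarrow> reg X U f"
    and reg_subset: "reg X U f \<Longrightarrow> openin (fs_top X) V \<Longrightarrow> V \<subseteq> U \<Longrightarrow> reg X V f"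
    and reg_const: "openin (fs_top X) U \<Longrightarrow> reg X U (\<lambda>_. c)"
    and reg_add: "reg X U f \<Longrightarrow> reg X U g \<Longrightarrow> reg X U (\<lambda>x. f x + g x)"
    and reg_mult: "reg X U f \<Longrightarrow> reg X U g \<Longrightarrow> reg X U (\<lambda>x. f x * g x)"
    and reg_inverse: "reg X U f \<Longrightarrow> (\<And>x. x \<in> U \<Longrightarrow> f x \<noteq> 0) \<Longrightarrow> reg X U (\<lambda>x. inverse (f x))"
    and openin_nonzero: "reg X U f \<Longrightarrow> openin (fs_top X) {x \<in> U. f x \<noteq> 0}"
begin

lemma reg_cong:
  assumes "reg X U f" "\<And>x. x \<in> U \<Longrightarrow> f x = g x"
  shows "reg X U g"
proof (rule reg_local)
  show "openin (fs_top X) U" by (rule reg_openin[OF assms(1)])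
  then show "locally_reg X U g x" if "x \<in> U" for x
    by (rule locally_regI[OF _ that assms(1)]) (simp add: assms(2))
qed

lemma reg_uminus: "reg X U f \<Longrightarrow> reg X U (\<lambda>x. - f x)"
  using reg_mult[OF reg_const[OF reg_openin], of U f f "-1"] by simp

lemma reg_diff: "reg X U f \<Longrightarrow> reg X U g \<Longrightarrow> reg X U (\<lambda>x. f x - g x)"
  using reg_add[OF _ reg_uminus, of U f g] by simp

lemma reg_sum:
  "openin (fs_top X) U \<Longrightarrow> (\<And>i. i \<in> I \<Longrightarrow> reg X U (f i)) \<Longrightarrow> reg X U (\<lambda>x. \<Sum>i\<in>I. f i x)"
  by (induction I rule: infinite_finite_induct) (auto intro: reg_const reg_add)

lemma reg_prod:
  "openin (fs_top X) U \<Longrightarrow> (\<And>i. i \<in> I \<Longrightarrow> reg X U (f i)) \<Longrightarrow> reg X U (\<lambda>x. \<Prod>i\<in>I. f i x)"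
  by (induction I rule: infinite_finite_induct) (auto intro: reg_const reg_mult)

lemma reg_divide:
  assumes "reg X U f" "reg X U g" "\<And>x. x \<in> U \<Longrightarrow> g x \<noteq> 0"
  shows "reg X U (\<lambda>x. f x / g x)"
  using reg_mult[OF assms(1) reg_inverse[OF assms(2,3)]] by (simp add: field_class.field_divide_inverse)

end

text \<open>
  Quasi-affine varieties and products are built in the same way: the topology and the sheaf are
  generated by a supply \<open>F\<close> of pairs \<open>(D, s)\<close>, a domain together with a function that matters
  only there.  Treating both at once means that the sheaf axioms, and the criterion for a map
  into such a space to be a morphism, are proved only once.
\<close>

locale fraction_space =
  fixes X :: "'a fspace" and F :: "('a set \<times> ('a \<Rightarrow> complex)) set"
  assumes top_eq: "fs_top X = topology_generated_by {{z \<in> D. s z \<noteq> 0} |D s. (D, s) \<in> F}"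
    and reg_iff: "reg X W h \<longleftrightarrow> openin (fs_top X) W \<and>
      (\<forall>z\<in>W. \<exists>D s t. (D, s) \<in> F \<and> (D, t) \<in> F \<and> z \<in> D \<and> s z \<noteq> 0 \<and>
         (\<forall>w\<in>W \<inter> D. s w \<noteq> 0 \<longrightarrow> h w = t w / s w))"
    and F_const: "(D, s) \<in> F \<Longrightarrow> (D, \<lambda>_. c) \<in> F"
    and F_add: "(D, s) \<in> F \<Longrightarrow> (D, t) \<in> F \<Longrightarrow> (D, \<lambda>x. s x + t x) \<in> F"
    and F_mult: "(D, s) \<in> F \<Longrightarrow> (E, t) \<in> F \<Longrightarrow> (D \<inter> E, \<lambda>x. s x * t x) \<in> F"
begin

lemma openin_generator: "(D, s) \<in> F \<Longrightarrow> openin (fs_top X) {z \<in> D. s z \<noteq> 0}"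
  unfolding top_eq by (rule topology_generated_by_Basis) blast

lemma openin_domain: "(D, s) \<in> F \<Longrightarrow> openin (fs_top X) D"
  using openin_generator[OF F_const[of D s 1]] by simp

lemma basis:
  assumes "openin (fs_top X) W" "x \<in> W"
  shows "\<exists>D s. (D, s) \<in> F \<and> x \<in> D \<and> s x \<noteq> 0 \<and> {z \<in> D. s z \<noteq> 0} \<subseteq> W"
proof -
  have "generate_topology_on {{z \<in> D. s z \<noteq> 0} |D s. (D, s) \<in> F} W"
    using assms(1) unfolding top_eq by (rule openin_topology_generated_by)
  then show ?thesis using assms(2)
  proof (induction arbitrary: x)
    case (Int a b)
    have ab: "x \<in> a" "x \<in> b" using Int.prems by auto
    obtain D s where *: "(D, s) \<in> F" "x \<in> D" "s x \<noteq> 0" "{z \<in> D. s z \<noteq> 0} \<subseteq> a"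
      using Int.IH(1)[OF ab(1)] by (elim exE conjE) (rule that)
    obtain E t where **: "(E, t) \<in> F" "x \<in> E" "t x \<noteq> 0" "{z \<in> E. t z \<noteq> 0} \<subseteq> b"
      using Int.IH(2)[OF ab(2)] by (elim exE conjE) (rule that)
    show ?case
      using * ** F_mult[OF *(1) **(1)]
      by (intro exI[of _ "D \<inter> E"] exI[of _ "\<lambda>x. s x * t x"]) auto
  next
    case (UN K)
    then show ?case by (meson UnionE Union_upper subset_trans)
  next
    case (Basis a)
    then show ?case by blast
  qed simp
qed

definition fraction_at :: "'a set \<Rightarrow> ('a \<Rightarrow> complex) \<Rightarrow> 'a \<Rightarrow> bool" where
  "fraction_at W h z \<longleftrightarrow> (\<exists>D s t. (D, s) \<in> F \<and> (D, t) \<in> F \<and> z \<in> D \<and> s z \<noteq> 0 \<and>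
     (\<forall>w\<in>W \<inter> D. s w \<noteq> 0 \<longrightarrow> h w = t w / s w))"

lemma fraction_atI:
  assumes "(D, s) \<in> F" "(D, t) \<in> F" "z \<in> D" "s z \<noteq> 0"
    and "\<And>w. w \<in> W \<Longrightarrow> w \<in> D \<Longrightarrow> s w \<noteq> 0 \<Longrightarrow> h w = t w / s w"
  shows "fraction_at W h z"
  unfolding fraction_at_def using assms by (intro exI[of _ D] exI[of _ s] exI[of _ t]) simp

lemma regI: "openin (fs_top X) W \<Longrightarrow> (\<And>z. z \<in> W \<Longrightarrow> fraction_at W h z) \<Longrightarrow> reg X W h"
  unfolding reg_iff fraction_at_def by simp

lemma regE:
  assumes "reg X W h" "z \<in> W"
  obtains D s t where "(D, s) \<in> F" "(D, t) \<in> F" "z \<in> D" "s z \<noteq> 0"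
    "\<forall>w\<in>W \<inter> D. s w \<noteq> 0 \<longrightarrow> h w = t w / s w"
proof -
  have "fraction_at W h z" using assms unfolding reg_iff fraction_at_def by simp
  then show thesis unfolding fraction_at_def by (elim exE conjE) (rule that)
qed

lemma reg_generator:
  assumes "(D, s) \<in> F"
  shows "reg X D s"
  by (rule regI[OF openin_domain[OF assms] fraction_atI[OF F_const[OF assms, of 1] assms]]) auto

lemma function_space: "function_space X"
proof
  show "openin (fs_top X) U" if "reg X U f" for U f
    using that unfolding reg_iff by blast
next
  fix U f
  assume U: "openin (fs_top X) U" and loc: "\<And>x. x \<in> U \<Longrightarrow> locally_reg X U f x"
  show "reg X U f"
  proof (rule regI[OF U])
    fix x assume "x \<in> U"
    from loc[OF this] obtain V g where V: "openin (fs_top X) V" "x \<in> V" "reg X V g" "\<forall>y\<in>U \<inter> V. f y = g y"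
      by (rule locally_regE)
    obtain D s t where st: "(D, s) \<in> F" "(D, t) \<in> F" "x \<in> D" "s x \<noteq> 0"
      "\<forall>w\<in>V \<inter> D. s w \<noteq> 0 \<longrightarrow> g w = t w / s w"
      by (rule regE[OF V(3,2)])
    obtain E u where u: "(E, u) \<in> F" "x \<in> E" "u x \<noteq> 0" "{z \<in> E. u z \<noteq> 0} \<subseteq> V"
      using basis[OF V(1,2)] by blast
    \<comment> \<open>Multiplying numerator and denominator by \<open>u\<close> confines the fraction to \<open>V\<close>.\<close>
    show "fraction_at U f x"
      by (rule fraction_atI[OF F_mult[OF st(1) u(1)] F_mult[OF st(2) u(1)]]) (use st(3-5) u(2-4) V(4) in auto)
  qed
next
  fix U V f
  assume f: "reg X U f" and V: "openin (fs_top X) V" "V \<subseteq> U"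
  show "reg X V f"
  proof (rule regI[OF V(1)])
    fix x assume "x \<in> V"
    then have x: "x \<in> U" using V(2) by blast
    obtain D s t where st: "(D, s) \<in> F" "(D, t) \<in> F" "x \<in> D" "s x \<noteq> 0"
      "\<forall>w\<in>U \<inter> D. s w \<noteq> 0 \<longrightarrow> f w = t w / s w"
      by (rule regE[OF f x])
    show "fraction_at V f x" by (rule fraction_atI[OF st(1-4)]) (use st(5) V(2) in auto)
  qed
next
  fix U and c :: complex
  assume U: "openin (fs_top X) U"
  show "reg X U (\<lambda>_. c)"
  proof (rule regI[OF U])
    fix x assume "x \<in> U"
    then obtain D s where s: "(D, s) \<in> F" "x \<in> D" using basis[OF U] by blast
    show "fraction_at U (\<lambda>_. c) x"
      by (rule fraction_atI[OF F_const[OF s(1), of 1] F_const[OF s(1), of c] s(2)]) simp_all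
  qed
next
  fix U f g
  assume f: "reg X U f" and g: "reg X U g"
  then have U: "openin (fs_top X) U" unfolding reg_iff by blast
  have common: thesis
    if x: "x \<in> U"
      and *: "\<And>D s t u. (D, s) \<in> F \<Longrightarrow> (D, t) \<in> F \<Longrightarrow> (D, u) \<in> F \<Longrightarrow> x \<in> D \<Longrightarrow> s x \<noteq> 0 \<Longrightarrow>
         \<forall>w\<in>U \<inter> D. s w \<noteq> 0 \<longrightarrow> f w = t w / s w \<and> g w = u w / s w \<Longrightarrow> thesis" for x thesis
  proof -
    obtain D s t where st: "(D, s) \<in> F" "(D, t) \<in> F" "x \<in> D" "s x \<noteq> 0"
      "\<forall>w\<in>U \<inter> D. s w \<noteq> 0 \<longrightarrow> f w = t w / s w"
      by (rule regE[OF f x])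
    obtain E s' u where u: "(E, s') \<in> F" "(E, u) \<in> F" "x \<in> E" "s' x \<noteq> 0"
      "\<forall>w\<in>U \<inter> E. s' w \<noteq> 0 \<longrightarrow> g w = u w / s' w"
      by (rule regE[OF g x])
    show thesis
      by (rule *[OF F_mult[OF st(1) u(1)] F_mult[OF st(2) u(1)] F_mult[OF st(1) u(2)]])
        (use st(3-5) u(3-5) in auto)
  qed
  show "reg X U (\<lambda>x. f x + g x)"
  proof (rule regI[OF U])
    fix x assume "x \<in> U"
    then obtain D s t u where st: "(D, s) \<in> F" "(D, t) \<in> F" "(D, u) \<in> F" "x \<in> D" "s x \<noteq> 0"
         "\<forall>w\<in>U \<inter> D. s w \<noteq> 0 \<longrightarrow> f w = t w / s w \<and> g w = u w / s w"
      by (rule common)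
    show "fraction_at U (\<lambda>x. f x + g x) x"
      by (rule fraction_atI[OF st(1) F_add[OF st(2,3)] st(4,5)]) (simp add: st(6) add_divide_distrib)
  qed
  show "reg X U (\<lambda>x. f x * g x)"
  proof (rule regI[OF U])
    fix x assume "x \<in> U"
    then obtain D s t u where st: "(D, s) \<in> F" "(D, t) \<in> F" "(D, u) \<in> F" "x \<in> D" "s x \<noteq> 0"
         "\<forall>w\<in>U \<inter> D. s w \<noteq> 0 \<longrightarrow> f w = t w / s w \<and> g w = u w / s w"
      by (rule common)
    show "fraction_at U (\<lambda>x. f x * g x) x"
      by (rule fraction_atI[OF F_mult[OF st(1,1)] F_mult[OF st(2,3)]]) (use st(4,5) in \<open>auto simp: st(6)\<close>)
  qed
next
  fix U f
  assume f: "reg X U f" and nz: "\<And>x. x \<in> U \<Longrightarrow> f x \<noteq> 0"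
  then have U: "openin (fs_top X) U" unfolding reg_iff by blast
  show "reg X U (\<lambda>x. inverse (f x))"
  proof (rule regI[OF U])
    fix x assume x: "x \<in> U"
    obtain D s t where st: "(D, s) \<in> F" "(D, t) \<in> F" "x \<in> D" "s x \<noteq> 0"
      "\<forall>w\<in>U \<inter> D. s w \<noteq> 0 \<longrightarrow> f w = t w / s w"
      by (rule regE[OF f x])
    \<comment> \<open>The reciprocal of \<open>t / s\<close> is written as \<open>s s / (s t)\<close>, which makes sense only where
       both \<open>s\<close> and \<open>t\<close> are nonzero.\<close>
    show "fraction_at U (\<lambda>x. inverse (f x)) x"
      by (rule fraction_atI[OF F_mult[OF st(1,2)] F_mult[OF st(1,1)]]) (use st(3-5) x nz[OF x] in auto)
  qed
next
  fix U f
  assume f: "reg X U f"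
  then have U: "openin (fs_top X) U" unfolding reg_iff by blast
  show "openin (fs_top X) {x \<in> U. f x \<noteq> 0}"
  proof (subst openin_subopen, intro ballI)
    fix x assume "x \<in> {x \<in> U. f x \<noteq> 0}"
    then have x: "x \<in> U" "f x \<noteq> 0" by auto
    obtain D s t where st: "(D, s) \<in> F" "(D, t) \<in> F" "x \<in> D" "s x \<noteq> 0"
      "\<forall>w\<in>U \<inter> D. s w \<noteq> 0 \<longrightarrow> f w = t w / s w"
      by (rule regE[OF f x(1)])
    have "openin (fs_top X) (U \<inter> {z \<in> D \<inter> D. s z * t z \<noteq> 0})"
      by (intro openin_Int U openin_generator F_mult st(1,2))
    moreover have "x \<in> U \<inter> {z \<in> D \<inter> D. s z * t z \<noteq> 0}" using x st(3-5) by auto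
    moreover have "U \<inter> {z \<in> D \<inter> D. s z * t z \<noteq> 0} \<subseteq> {x \<in> U. f x \<noteq> 0}" using st(5) by auto
    ultimately show "\<exists>T. openin (fs_top X) T \<and> x \<in> T \<and> T \<subseteq> {x \<in> U. f x \<noteq> 0}"
      by blast
  qed
qed

lemma points_eq: "fs_points X = (\<Union>(D, s)\<in>F. D)"
proof
  show "fs_points X \<subseteq> (\<Union>(D, s)\<in>F. D)"
    unfolding top_eq topology_generated_by_topspace by auto
  show "(\<Union>(D, s)\<in>F. D) \<subseteq> fs_points X"
    using openin_domain openin_subset by blast
qed

text \<open>
  It suffices to pull back the generating functions, because every regular function is locally a
  quotient of two of them.
\<close>

lemma morphism_into:
  assumes Z: "function_space Z"
    and into: "\<phi> ` fs_points Z \<subseteq> fs_points X"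
    and pull: "\<And>D s. (D, s) \<in> F \<Longrightarrow> reg Z {x \<in> fs_points Z. \<phi> x \<in> D} (s \<circ> \<phi>)"
  shows "fs_morphism Z X \<phi>"
proof -
  interpret Z: function_space Z by fact
  have pre: "openin (fs_top Z) {x \<in> fs_points Z. \<phi> x \<in> W}" if W: "openin (fs_top X) W" for W
  proof (subst openin_subopen, intro ballI)
    fix x assume "x \<in> {x \<in> fs_points Z. \<phi> x \<in> W}"
    then have x: "x \<in> fs_points Z" "\<phi> x \<in> W" by auto
    obtain D s where s: "(D, s) \<in> F" "\<phi> x \<in> D" "s (\<phi> x) \<noteq> 0" "{z \<in> D. s z \<noteq> 0} \<subseteq> W"
      using basis[OF W x(2)] by blast
    have "openin (fs_top Z) {y \<in> {x \<in> fs_points Z. \<phi> x \<in> D}. (s \<circ> \<phi>) y \<noteq> 0}"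
      using Z.openin_nonzero[OF pull[OF s(1)]] .
    then show "\<exists>T. openin (fs_top Z) T \<and> x \<in> T \<and> T \<subseteq> {x \<in> fs_points Z. \<phi> x \<in> W}"
      using x s by (intro exI[of _ "{y \<in> {x \<in> fs_points Z. \<phi> x \<in> D}. (s \<circ> \<phi>) y \<noteq> 0}"]) auto
  qed
  show ?thesis
    unfolding fs_morphism_def
  proof (intro conjI allI impI)
    show "continuous_map (fs_top Z) (fs_top X) \<phi>"
      using into pre unfolding continuous_map_def by auto
    fix V h assume V: "openin (fs_top X) V" "reg X V h"
    show "reg Z {x \<in> fs_points Z. \<phi> x \<in> V} (h \<circ> \<phi>)"
    proof (rule Z.reg_local[OF pre[OF V(1)]])
      fix x assume "x \<in> {x \<in> fs_points Z. \<phi> x \<in> V}"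
      then have x: "x \<in> fs_points Z" "\<phi> x \<in> V" by auto
      obtain D s t where st: "(D, s) \<in> F" "(D, t) \<in> F" "\<phi> x \<in> D" "s (\<phi> x) \<noteq> 0"
        "\<forall>w\<in>V \<inter> D. s w \<noteq> 0 \<longrightarrow> h w = t w / s w"
        by (rule regE[OF V(2) x(2)])
      let ?D = "{x \<in> fs_points Z. \<phi> x \<in> D}"
      let ?W = "{y \<in> ?D. (s \<circ> \<phi>) y \<noteq> 0}"
      have W: "openin (fs_top Z) ?W" using Z.openin_nonzero[OF pull[OF st(1)]] .
      have "reg Z ?W (\<lambda>x. (t \<circ> \<phi>) x / (s \<circ> \<phi>) x)"
        by (intro Z.reg_divide Z.reg_subset[OF pull[OF st(1)] W] Z.reg_subset[OF pull[OF st(2)] W]) auto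
      then show "locally_reg Z {x \<in> fs_points Z. \<phi> x \<in> V} (h \<circ> \<phi>) x"
        by (rule locally_regI[OF W, rotated]) (use x st in auto)
    qed
  qed
qed

end


section \<open>The basic constructions and their universal properties\<close>

subsection \<open>Quasi-affine varieties\<close>

lemma fraction_space_quasi_affine: "fraction_space (quasi_affine C S) (Pair S ` polyfun C)"
proof
  show "fs_top (quasi_affine C S) = topology_generated_by {{z \<in> D. s z \<noteq> 0} |D s. (D, s) \<in> Pair S ` polyfun C}"
    unfolding quasi_affine_def by (auto simp: Let_def intro!: arg_cong[of _ _ topology_generated_by])
  then have sub: "W \<subseteq> S" if "openin (fs_top (quasi_affine C S)) W" for W
    using openin_subset[OF that] by auto
  show "reg (quasi_affine C S) W h \<longleftrightarrow> openin (fs_top (quasi_affine C S)) W \<and>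
      (\<forall>z\<in>W. \<exists>D s t. (D, s) \<in> Pair S ` polyfun C \<and> (D, t) \<in> Pair S ` polyfun C \<and> z \<in> D \<and> s z \<noteq> 0 \<and>
         (\<forall>w\<in>W \<inter> D. s w \<noteq> 0 \<longrightarrow> h w = t w / s w))" (is "_ \<longleftrightarrow> ?R") for W h
  proof -
    have "reg (quasi_affine C S) W h \<longleftrightarrow> openin (fs_top (quasi_affine C S)) W \<and>
       (\<forall>x\<in>W. \<exists>p\<in>polyfun C. \<exists>q\<in>polyfun C.
            q x \<noteq> 0 \<and> (\<forall>y\<in>W. q y \<noteq> 0 \<longrightarrow> h y = p y / q y))"
      unfolding quasi_affine_def by (simp add: Let_def)
    also have "\<dots> \<longleftrightarrow> ?R"
    proof (intro conj_cong ball_cong refl iffI)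
      fix x
      assume W: "openin (fs_top (quasi_affine C S)) W" and x: "x \<in> W"
      {
        assume "\<exists>p\<in>polyfun C. \<exists>q\<in>polyfun C. q x \<noteq> 0 \<and> (\<forall>y\<in>W. q y \<noteq> 0 \<longrightarrow> h y = p y / q y)"
        then show "\<exists>D s t. (D, s) \<in> Pair S ` polyfun C \<and> (D, t) \<in> Pair S ` polyfun C \<and> x \<in> D \<and> s x \<noteq> 0 \<and>
         (\<forall>w\<in>W \<inter> D. s w \<noteq> 0 \<longrightarrow> h w = t w / s w)"
          using sub[OF W] x by blast
      }
      {
        assume "\<exists>D s t. (D, s) \<in> Pair S ` polyfun C \<and> (D, t) \<in> Pair S ` polyfun C \<and> x \<in> D \<and> s x \<noteq> 0 \<and>
         (\<forall>w\<in>W \<inter> D. s w \<noteq> 0 \<longrightarrow> h w = t w / s w)"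
        then show "\<exists>p\<in>polyfun C. \<exists>q\<in>polyfun C. q x \<noteq> 0 \<and> (\<forall>y\<in>W. q y \<noteq> 0 \<longrightarrow> h y = p y / q y)"
          using sub[OF W] by blast
      }
    qed
    finally show ?thesis .
  qed
qed (auto intro: polyfun.intros)

lemma function_space_quasi_affine: "function_space (quasi_affine C S)"
  by (rule fraction_space.function_space[OF fraction_space_quasi_affine])

lemma points_quasi_affine [simp]: "fs_points (quasi_affine C S) = S"
  using fraction_space.points_eq[OF fraction_space_quasi_affine, of C S]
  by (auto intro: polyfun.const)

lemma reg_quasi_affine: "p \<in> polyfun C \<Longrightarrow> reg (quasi_affine C S) S p"
  by (rule fraction_space.reg_generator[OF fraction_space_quasi_affine]) simp

lemma (in function_space) reg_polyfun_comp:
  assumes "\<And>c. c \<in> C \<Longrightarrow> reg X U (c \<circ> \<phi>)" "openin (fs_top X) U" "p \<in> polyfun C"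
  shows "reg X U (p \<circ> \<phi>)"
  using assms(3) by induction (use assms in \<open>auto simp: o_def intro: reg_const reg_add reg_mult\<close>)

text \<open>
  This is how maps given by formulas are recognized as morphisms: only coordinates are tested.
\<close>

lemma morphism_into_quasi_affine:
  assumes "function_space Z" "\<And>x. x \<in> fs_points Z \<Longrightarrow> \<phi> x \<in> S"
    and "\<And>c. c \<in> C \<Longrightarrow> reg Z (fs_points Z) (c \<circ> \<phi>)"
  shows "fs_morphism Z (quasi_affine C S) \<phi>"
proof (rule fraction_space.morphism_into[OF fraction_space_quasi_affine assms(1)])
  fix D s assume "(D, s) \<in> Pair S ` polyfun C"
  then have "D = S" "s \<in> polyfun C" by auto
  moreover have "{x \<in> fs_points Z. \<phi> x \<in> S} = fs_points Z" using assms(2) by auto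
  ultimately show "reg Z {x \<in> fs_points Z. \<phi> x \<in> D} (s \<circ> \<phi>)"
    using function_space.reg_polyfun_comp[OF assms(1,3)] by simp
qed (use assms(2) in auto)


subsection \<open>Morphisms\<close>

lemma morphism_regD:
  "fs_morphism X Y \<phi> \<Longrightarrow> openin (fs_top Y) V \<Longrightarrow> reg Y V h \<Longrightarrow> reg X {x \<in> fs_points X. \<phi> x \<in> V} (h \<circ> \<phi>)"
  unfolding fs_morphism_def by blast

lemma morphism_openin:
  "fs_morphism X Y \<phi> \<Longrightarrow> openin (fs_top Y) V \<Longrightarrow> openin (fs_top X) {x \<in> fs_points X. \<phi> x \<in> V}"
  unfolding fs_morphism_def continuous_map_def by blast

lemma morphism_points: "fs_morphism X Y \<phi> \<Longrightarrow> x \<in> fs_points X \<Longrightarrow> \<phi> x \<in> fs_points Y"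
  unfolding fs_morphism_def continuous_map_def by blast

lemma morphism_reg_points:
  assumes "fs_morphism X Y \<phi>" "reg Y (fs_points Y) h"
  shows "reg X (fs_points X) (h \<circ> \<phi>)"
proof -
  have "{x \<in> fs_points X. \<phi> x \<in> fs_points Y} = fs_points X"
    using morphism_points[OF assms(1)] by auto
  then show ?thesis using morphism_regD[OF assms(1) openin_topspace assms(2)] by simp
qed

lemma morphism_comp:
  assumes "fs_morphism X Y \<phi>" "fs_morphism Y Z \<psi>"
  shows "fs_morphism X Z (\<psi> \<circ> \<phi>)"
  unfolding fs_morphism_def
proof (intro conjI allI impI)
  show "continuous_map (fs_top X) (fs_top Z) (\<psi> \<circ> \<phi>)"
    using assms unfolding fs_morphism_def by (blast intro: continuous_map_compose)
  fix V h assume V: "openin (fs_top Z) V" "reg Z V h"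
  have "{x \<in> fs_points X. (\<psi> \<circ> \<phi>) x \<in> V} = {x \<in> fs_points X. \<phi> x \<in> {y \<in> fs_points Y. \<psi> y \<in> V}}"
    using morphism_points[OF assms(1)] by auto
  then show "reg X {x \<in> fs_points X. (\<psi> \<circ> \<phi>) x \<in> V} (h \<circ> (\<psi> \<circ> \<phi>))"
    using morphism_regD[OF assms(1) morphism_openin[OF assms(2) V(1)] morphism_regD[OF assms(2) V]]
    by (simp add: o_assoc)
qed


subsection \<open>Subspaces\<close>

lemma fs_top_sub [simp]: "fs_top (fs_sub X S) = subtopology (fs_top X) S"
  by (simp add: fs_sub_def Let_def)

lemma reg_sub_iff:
  "reg (fs_sub X S) U f \<longleftrightarrow> openin (subtopology (fs_top X) S) U \<and> (\<forall>x\<in>U. locally_reg X U f x)"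
  by (simp add: fs_sub_def Let_def locally_reg_def)

lemma reg_subI:
  "openin (subtopology (fs_top X) S) U \<Longrightarrow> (\<And>x. x \<in> U \<Longrightarrow> locally_reg X U f x) \<Longrightarrow> reg (fs_sub X S) U f"
  unfolding reg_sub_iff by simp

lemma reg_subE:
  assumes "reg (fs_sub X S) U f" "x \<in> U"
  obtains V g where "openin (fs_top X) V" "x \<in> V" "reg X V g" "\<forall>y \<in> U \<inter> V. f y = g y"
proof -
  have "locally_reg X U f x" using assms unfolding reg_sub_iff by simp
  then show thesis by (elim locally_regE) (rule that)
qed

lemma reg_sub_restrict:
  assumes "function_space X" "reg X U f"
  shows "reg (fs_sub X S) (U \<inter> S) f"
proof (rule reg_subI)
  note U = function_space.reg_openin[OF assms]
  show "openin (subtopology (fs_top X) S) (U \<inter> S)" using U by (rule openin_subtopology_Int)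
  show "locally_reg X (U \<inter> S) f x" if "x \<in> U \<inter> S" for x
    by (rule locally_regI[OF U _ assms(2)]) (use that in auto)
qed

lemma function_space_sub:
  assumes X: "function_space X"
  shows "function_space (fs_sub X S)"
proof -
  interpret X: function_space X by fact
  let ?T = "subtopology (fs_top X) S"
  have op: "openin ?T U" if "reg (fs_sub X S) U f" for U f
    using that unfolding reg_sub_iff by simp
  show ?thesis
  proof
    show "openin (fs_top (fs_sub X S)) U" if "reg (fs_sub X S) U f" for U f
      using op[OF that] by simp
  next
    fix U f
    assume U: "openin (fs_top (fs_sub X S)) U" and loc: "\<And>x. x \<in> U \<Longrightarrow> locally_reg (fs_sub X S) U f x"
    show "reg (fs_sub X S) U f"
    proof (rule reg_subI)
      show "openin ?T U" using U by simp
      have US: "U \<subseteq> S" using U openin_subset by force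
      fix x assume "x \<in> U"
      from loc[OF this] obtain V g where V: "openin (fs_top (fs_sub X S)) V" "x \<in> V" "reg (fs_sub X S) V g"
          "\<forall>y\<in>U \<inter> V. f y = g y"
        by (rule locally_regE)
      obtain W h where W: "openin (fs_top X) W" "x \<in> W" "reg X W h" "\<forall>y\<in>V \<inter> W. g y = h y"
        by (rule reg_subE[OF V(3,2)])
      obtain V' where V': "openin (fs_top X) V'" "V = V' \<inter> S"
        using V(1) by (auto simp: openin_subtopology)
      have o: "openin (fs_top X) (V' \<inter> W)" using V'(1) W(1) by (rule openin_Int)
      show "locally_reg X U f x"
        by (rule locally_regI[OF o _ X.reg_subset[OF W(3) o]]) (use V(2,4) W(2,4) V'(2) US in auto)
    qed
  next
    fix U V f
    assume f: "reg (fs_sub X S) U f" and V: "openin (fs_top (fs_sub X S)) V" "V \<subseteq> U"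
    show "reg (fs_sub X S) V f"
    proof (rule reg_subI)
      show "openin ?T V" using V(1) by simp
      fix x assume "x \<in> V"
      then have x: "x \<in> U" using V(2) by auto
      obtain W h where W: "openin (fs_top X) W" "x \<in> W" "reg X W h" "\<forall>y\<in>U \<inter> W. f y = h y"
        by (rule reg_subE[OF f x])
      show "locally_reg X V f x" by (rule locally_regI[OF W(1-3)]) (use W(4) V(2) in auto)
    qed
  next
    fix U and c :: complex
    assume U: "openin (fs_top (fs_sub X S)) U"
    show "reg (fs_sub X S) U (\<lambda>_. c)"
    proof (rule reg_subI)
      show "openin ?T U" using U by simp
      show "locally_reg X U (\<lambda>_. c) x" if "x \<in> U" for x
        by (rule locally_regI[OF openin_topspace _ X.reg_const[OF openin_topspace, of c]])
          (use that openin_subset[OF U] in auto)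
    qed
  next
    fix U f g assume f: "reg (fs_sub X S) U f" and g: "reg (fs_sub X S) U g"
    have common: thesis
      if x: "x \<in> U"
        and *: "\<And>V f' g'. openin (fs_top X) V \<Longrightarrow> x \<in> V \<Longrightarrow> reg X V f' \<Longrightarrow> reg X V g' \<Longrightarrow>
          \<forall>y\<in>U \<inter> V. f y = f' y \<and> g y = g' y \<Longrightarrow> thesis" for x thesis
    proof -
      obtain V f' where 1: "openin (fs_top X) V" "x \<in> V" "reg X V f'" "\<forall>y \<in> U \<inter> V. f y = f' y"
        by (rule reg_subE[OF f x])
      obtain W g' where 2: "openin (fs_top X) W" "x \<in> W" "reg X W g'" "\<forall>y \<in> U \<inter> W. g y = g' y"
        by (rule reg_subE[OF g x])
      have VW: "openin (fs_top X) (V \<inter> W)" using 1 2 by auto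
      show thesis
        by (rule *[OF VW _ X.reg_subset[OF 1(3) VW] X.reg_subset[OF 2(3) VW]]) (use 1 2 in auto)
    qed
    show "reg (fs_sub X S) U (\<lambda>x. f x + g x)"
    proof (rule reg_subI[OF op[OF f]])
      fix x assume "x \<in> U"
      then obtain V f' g' where V: "openin (fs_top X) V" "x \<in> V" "reg X V f'" "reg X V g'"
        "\<forall>y\<in>U \<inter> V. f y = f' y \<and> g y = g' y" by (rule common)
      show "locally_reg X U (\<lambda>x. f x + g x) x"
        by (rule locally_regI[OF V(1,2) X.reg_add[OF V(3,4)]]) (simp add: V(5))
    qed
    show "reg (fs_sub X S) U (\<lambda>x. f x * g x)"
    proof (rule reg_subI[OF op[OF f]])
      fix x assume "x \<in> U"
      then obtain V f' g' where V: "openin (fs_top X) V" "x \<in> V" "reg X V f'" "reg X V g'"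
        "\<forall>y\<in>U \<inter> V. f y = f' y \<and> g y = g' y" by (rule common)
      show "locally_reg X U (\<lambda>x. f x * g x) x"
        by (rule locally_regI[OF V(1,2) X.reg_mult[OF V(3,4)]]) (simp add: V(5))
    qed
  next
    fix U f assume f: "reg (fs_sub X S) U f" and nz: "\<And>x. x \<in> U \<Longrightarrow> f x \<noteq> 0"
    show "reg (fs_sub X S) U (\<lambda>x. inverse (f x))"
    proof (rule reg_subI[OF op[OF f]])
      fix x assume x: "x \<in> U"
      obtain V f' where V: "openin (fs_top X) V" "x \<in> V" "reg X V f'" "\<forall>y \<in> U \<inter> V. f y = f' y"
        by (rule reg_subE[OF f x])
      \<comment> \<open>The extension \<open>f'\<close> may vanish outside \<open>S\<close>.\<close>
      have o: "openin (fs_top X) {y \<in> V. f' y \<noteq> 0}" by (rule X.openin_nonzero[OF V(3)])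
      have "reg X {y \<in> V. f' y \<noteq> 0} (\<lambda>x. inverse (f' x))"
        by (rule X.reg_inverse[OF X.reg_subset[OF V(3) o]]) auto
      then show "locally_reg X U (\<lambda>x. inverse (f x)) x"
        by (rule locally_regI[OF o, rotated]) (use V(2,4) x nz[OF x] in auto)
    qed
  next
    fix U f assume f: "reg (fs_sub X S) U f"
    show "openin (fs_top (fs_sub X S)) {x \<in> U. f x \<noteq> 0}"
    proof (subst openin_subopen, intro ballI)
      fix x assume "x \<in> {x \<in> U. f x \<noteq> 0}"
      then have x: "x \<in> U" "f x \<noteq> 0" by auto
      obtain V f' where V: "openin (fs_top X) V" "x \<in> V" "reg X V f'" "\<forall>y \<in> U \<inter> V. f y = f' y"
        by (rule reg_subE[OF f x(1)])
      have US: "U \<subseteq> S" using op[OF f] openin_subset by force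
      have "openin ?T ({y \<in> V. f' y \<noteq> 0} \<inter> S)"
        using X.openin_nonzero[OF V(3)] by (rule openin_subtopology_Int)
      then have "openin ?T ({y \<in> V. f' y \<noteq> 0} \<inter> S \<inter> U)" using op[OF f] by (rule openin_Int)
      then show "\<exists>T. openin (fs_top (fs_sub X S)) T \<and> x \<in> T \<and> T \<subseteq> {x \<in> U. f x \<noteq> 0}"
        using V x US by (intro exI[of _ "{y \<in> V. f' y \<noteq> 0} \<inter> S \<inter> U"]) auto
    qed
  qed
qed

lemma morphism_inclusion:
  assumes "function_space X"
  shows "fs_morphism (fs_sub X S) X (\<lambda>x. x)"
  unfolding fs_morphism_def
proof (intro conjI allI impI)
  show "continuous_map (fs_top (fs_sub X S)) (fs_top X) (\<lambda>x. x)"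
    using continuous_map_from_subtopology[OF continuous_map_id] by (simp add: id_def)
  fix V h assume V: "openin (fs_top X) V" "reg X V h"
  have "{x \<in> fs_points (fs_sub X S). x \<in> V} = V \<inter> S" using openin_subset[OF V(1)] by auto
  then show "reg (fs_sub X S) {x \<in> fs_points (fs_sub X S). x \<in> V} (h \<circ> (\<lambda>x. x))"
    using reg_sub_restrict[OF assms V(2), of S] by (simp add: o_def)
qed

lemma morphism_restrict:
  "function_space X \<Longrightarrow> fs_morphism X Y \<phi> \<Longrightarrow> fs_morphism (fs_sub X S) Y \<phi>"
  using morphism_comp[OF morphism_inclusion] by (force simp: o_def)

lemma morphism_into_sub:
  assumes Z: "function_space Z" and \<phi>: "fs_morphism Z X \<phi>"
    and S: "\<And>x. x \<in> fs_points Z \<Longrightarrow> \<phi> x \<in> S"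
  shows "fs_morphism Z (fs_sub X S) \<phi>"
  unfolding fs_morphism_def
proof (intro conjI allI impI)
  interpret Z: function_space Z by fact
  show c: "continuous_map (fs_top Z) (fs_top (fs_sub X S)) \<phi>"
    using \<phi> S unfolding fs_morphism_def by (auto simp: continuous_map_in_subtopology)
  fix V h assume V: "openin (fs_top (fs_sub X S)) V" "reg (fs_sub X S) V h"
  show "reg Z {x \<in> fs_points Z. \<phi> x \<in> V} (h \<circ> \<phi>)"
  proof (rule Z.reg_local)
    show "openin (fs_top Z) {x \<in> fs_points Z. \<phi> x \<in> V}"
      using c V(1) unfolding continuous_map_def by blast
    fix x assume "x \<in> {x \<in> fs_points Z. \<phi> x \<in> V}"
    then have x: "x \<in> fs_points Z" "\<phi> x \<in> V" by auto
    obtain W g where W: "openin (fs_top X) W" "\<phi> x \<in> W" "reg X W g" "\<forall>y \<in> V \<inter> W. h y = g y"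
      by (rule reg_subE[OF V(2) x(2)])
    show "locally_reg Z {x \<in> fs_points Z. \<phi> x \<in> V} (h \<circ> \<phi>) x"
      by (rule locally_regI[OF morphism_openin[OF \<phi> W(1)] _ morphism_regD[OF \<phi> W(1,3)]]) (use x W(2,4) in auto)
  qed
qed

lemma reg_sub_open_iff:
  assumes "function_space X" "openin (fs_top X) U"
  shows "reg (fs_sub X U) V f \<longleftrightarrow> V \<subseteq> U \<and> reg X V f"
proof
  interpret function_space X by fact
  assume *: "reg (fs_sub X U) V f"
  then have V: "openin (fs_top X) V" "V \<subseteq> U"
    using assms(2) unfolding reg_sub_iff by (auto simp: openin_open_subtopology)
  moreover have "reg X V f"
    by (rule reg_local[OF V(1)]) (use * in \<open>simp add: reg_sub_iff\<close>)
  ultimately show "V \<subseteq> U \<and> reg X V f" by blast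
next
  assume "V \<subseteq> U \<and> reg X V f"
  then show "reg (fs_sub X U) V f"
    using reg_sub_restrict[OF assms(1), of V f U] by (simp add: Int_absorb2)
qed

text \<open>
  Locality on the source allows a map out of a quotient to be described by representatives of the
  orbits that can be chosen only locally.
\<close>

lemma morphism_local:
  assumes X: "function_space X"
    and loc: "\<And>x. x \<in> fs_points X \<Longrightarrow> \<exists>U \<psi>. openin (fs_top X) U \<and> x \<in> U \<and>
      fs_morphism (fs_sub X U) Y \<psi> \<and> (\<forall>y\<in>U. \<phi> y = \<psi> y)"
  shows "fs_morphism X Y \<phi>"
proof -
  interpret function_space X by fact
  have pre: "\<exists>U. openin (fs_top X) U \<and> x \<in> U \<and>
      openin (fs_top X) {y \<in> U. \<phi> y \<in> V} \<and>
      (\<forall>h. reg Y V h \<longrightarrow> reg X {y \<in> U. \<phi> y \<in> V} (h \<circ> \<phi>))"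
    if x: "x \<in> fs_points X" and V: "openin (fs_top Y) V" for x V
  proof -
    obtain U \<psi> where U: "openin (fs_top X) U" "x \<in> U" "fs_morphism (fs_sub X U) Y \<psi>" "\<forall>y\<in>U. \<phi> y = \<psi> y"
      using loc[OF x] by (elim exE conjE) (rule that)
    have eq: "{y \<in> fs_points (fs_sub X U). \<psi> y \<in> V} = {y \<in> U. \<phi> y \<in> V}"
      using U(4) openin_subset[OF U(1)] by auto
    have "openin (fs_top X) {y \<in> U. \<phi> y \<in> V}"
      using morphism_openin[OF U(3) V] unfolding eq using U(1) by (simp add: openin_open_subtopology)
    moreover have "reg X {y \<in> U. \<phi> y \<in> V} (h \<circ> \<phi>)" if "reg Y V h" for h
    proof -
      have "reg X {y \<in> U. \<phi> y \<in> V} (h \<circ> \<psi>)"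
        using morphism_regD[OF U(3) V that] unfolding eq reg_sub_open_iff[OF X U(1)] by blast
      then show ?thesis by (rule reg_cong) (use U(4) in auto)
    qed
    ultimately show ?thesis using U by blast
  qed
  have op: "openin (fs_top X) {x \<in> fs_points X. \<phi> x \<in> V}" if V: "openin (fs_top Y) V" for V
  proof (subst openin_subopen, intro ballI)
    fix x assume "x \<in> {x \<in> fs_points X. \<phi> x \<in> V}"
    then have x: "x \<in> fs_points X" "\<phi> x \<in> V" by auto
    then obtain U where U: "openin (fs_top X) U" "x \<in> U" "openin (fs_top X) {y \<in> U. \<phi> y \<in> V}"
      using pre[OF _ V] by blast
    then show "\<exists>T. openin (fs_top X) T \<and> x \<in> T \<and> T \<subseteq> {x \<in> fs_points X. \<phi> x \<in> V}"
      using x openin_subset[OF U(1)] by (intro exI[of _ "{y \<in> U. \<phi> y \<in> V}"]) auto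
  qed
  show ?thesis
    unfolding fs_morphism_def
  proof (intro conjI allI impI)
    have "\<phi> x \<in> fs_points Y" if "x \<in> fs_points X" for x
    proof -
      obtain U \<psi> where U: "openin (fs_top X) U" "x \<in> U" "fs_morphism (fs_sub X U) Y \<psi>" "\<forall>y\<in>U. \<phi> y = \<psi> y"
        using loc[OF \<open>x \<in> fs_points X\<close>] by (elim exE conjE) (rule that)
      then show ?thesis using morphism_points[OF U(3), of x] that by simp
    qed
    then show "continuous_map (fs_top X) (fs_top Y) \<phi>"
      using op unfolding continuous_map_def by blast
    fix V h assume V: "openin (fs_top Y) V" "reg Y V h"
    show "reg X {x \<in> fs_points X. \<phi> x \<in> V} (h \<circ> \<phi>)"
    proof (rule reg_local[OF op[OF V(1)]])
      fix x assume "x \<in> {x \<in> fs_points X. \<phi> x \<in> V}"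
      then have x: "x \<in> fs_points X" "\<phi> x \<in> V" by auto
      then obtain U where U: "openin (fs_top X) U" "x \<in> U" "openin (fs_top X) {y \<in> U. \<phi> y \<in> V}"
        "reg X {y \<in> U. \<phi> y \<in> V} (h \<circ> \<phi>)"
        using pre[OF _ V(1)] V(2) by blast
      show "locally_reg X {x \<in> fs_points X. \<phi> x \<in> V} (h \<circ> \<phi>) x"
        by (rule locally_regI[OF U(3) _ U(4)]) (use x U(2) in auto)
    qed
  qed
qed


subsection \<open>Products\<close>

text \<open>
  Arbitrary finite index sets make sums and products of tensors easy to form: their indices are a
  disjoint union and a set of pairs.
\<close>

lemma tensor_funI:
  assumes "finite I" "\<And>i. i \<in> I \<Longrightarrow> reg X U (f i)" "\<And>i. i \<in> I \<Longrightarrow> reg Y V (g i)"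
  shows "(\<lambda>(x, y). \<Sum>i\<in>I. f i x * g i y) \<in> tensor_fun X Y U V"
proof -
  obtain b where b: "bij_betw b {..<card I} I"
    using ex_bij_betw_nat_finite[OF assms(1)] by (auto simp: atLeast0LessThan)
  have "(\<lambda>(x, y). \<Sum>i\<in>I. f i x * g i y) = (\<lambda>(x, y). \<Sum>k<card I. f (b k) x * g (b k) y)"
    by (simp add: fun_eq_iff sum.reindex_bij_betw[OF b, symmetric])
  moreover have "\<forall>k<card I. reg X U (f (b k)) \<and> reg Y V (g (b k))"
    using assms(2,3) bij_betwE[OF b] by auto
  ultimately show ?thesis
    unfolding tensor_fun_def by (intro CollectI exI[of _ "card I"] exI[of _ "\<lambda>k. f (b k)"] exI[of _ "\<lambda>k. g (b k)"]) simp
qed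

lemma tensor_funE:
  assumes "s \<in> tensor_fun X Y U V"
  obtains n :: nat and f g where "s = (\<lambda>(x, y). \<Sum>i<n. f i x * g i y)"
    "\<forall>i<n. reg X U (f i)" "\<forall>i<n. reg Y V (g i)"
proof -
  have "\<exists>n::nat. \<exists>f g. s = (\<lambda>(x, y). \<Sum>i<n. f i x * g i y) \<and>
    (\<forall>i<n. reg X U (f i)) \<and> (\<forall>i<n. reg Y V (g i))"
    using assms unfolding tensor_fun_def by fastforce
  then show thesis by (elim exE conjE) (rule that)
qed

definition box_functions :: "'a fspace \<Rightarrow> 'b fspace \<Rightarrow> (('a \<times> 'b) set \<times> ('a \<times> 'b \<Rightarrow> complex)) set" where
  "box_functions X Y = {(U \<times> V, s) |U V s. openin (fs_top X) U \<and> openin (fs_top Y) V \<and> s \<in> tensor_fun X Y U V}"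

lemma tensor_fun_subset:
  assumes "function_space X" "function_space Y" "s \<in> tensor_fun X Y U V"
    and "openin (fs_top X) U'" "U' \<subseteq> U" "openin (fs_top Y) V'" "V' \<subseteq> V"
  shows "s \<in> tensor_fun X Y U' V'"
proof -
  obtain n :: nat and f g where s: "s = (\<lambda>(x, y). \<Sum>i<n. f i x * g i y)"
    "\<forall>i<n. reg X U (f i)" "\<forall>i<n. reg Y V (g i)"
    using assms(3) by (rule tensor_funE)
  show ?thesis
    unfolding s(1)
    by (rule tensor_funI)
      (use s(2,3) function_space.reg_subset[OF assms(1) _ assms(4,5)]
        function_space.reg_subset[OF assms(2) _ assms(6,7)] in auto)
qed

lemma tensor_fun_add:
  assumes "s \<in> tensor_fun X Y U V" "t \<in> tensor_fun X Y U V"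
  shows "(\<lambda>z. s z + t z) \<in> tensor_fun X Y U V"
proof -
  obtain n :: nat and f g where s: "s = (\<lambda>(x, y). \<Sum>i<n. f i x * g i y)"
    "\<forall>i<n. reg X U (f i)" "\<forall>i<n. reg Y V (g i)"
    using assms(1) by (rule tensor_funE)
  obtain m :: nat and f' g' where t: "t = (\<lambda>(x, y). \<Sum>i<m. f' i x * g' i y)"
    "\<forall>i<m. reg X U (f' i)" "\<forall>i<m. reg Y V (g' i)"
    using assms(2) by (rule tensor_funE)
  have "(\<lambda>(x, y). \<Sum>i\<in>{..<n::nat} <+> {..<m::nat}. case_sum f f' i x * case_sum g g' i y) \<in> tensor_fun X Y U V"
    by (rule tensor_funI) (use s t in auto)
  also have "(\<lambda>(x, y). \<Sum>i\<in>{..<n::nat} <+> {..<m::nat}. case_sum f f' i x * case_sum g g' i y) = (\<lambda>z. s z + t z)"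
    unfolding s(1) t(1) by (auto simp: fun_eq_iff sum.Plus)
  finally show ?thesis .
qed

lemma tensor_fun_mult:
  assumes "function_space X" "function_space Y" "s \<in> tensor_fun X Y U V" "t \<in> tensor_fun X Y U V"
  shows "(\<lambda>z. s z * t z) \<in> tensor_fun X Y U V"
proof -
  obtain n :: nat and f g where s: "s = (\<lambda>(x, y). \<Sum>i<n. f i x * g i y)"
    "\<forall>i<n. reg X U (f i)" "\<forall>i<n. reg Y V (g i)"
    using assms(3) by (rule tensor_funE)
  obtain m :: nat and f' g' where t: "t = (\<lambda>(x, y). \<Sum>i<m. f' i x * g' i y)"
    "\<forall>i<m. reg X U (f' i)" "\<forall>i<m. reg Y V (g' i)"
    using assms(4) by (rule tensor_funE)
  have "(\<lambda>(x, y). \<Sum>k\<in>{..<n} \<times> {..<m}. (f (fst k) x * f' (snd k) x) * (g (fst k) y * g' (snd k) y))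
      \<in> tensor_fun X Y U V"
    by (rule tensor_funI)
      (use s t function_space.reg_mult[OF assms(1)] function_space.reg_mult[OF assms(2)] in auto)
  also have "(\<lambda>(x, y). \<Sum>k\<in>{..<n} \<times> {..<m}. (f (fst k) x * f' (snd k) x) * (g (fst k) y * g' (snd k) y))
      = (\<lambda>z. s z * t z)"
    unfolding s(1) t(1)
    by (simp add: fun_eq_iff sum_product sum.cartesian_product case_prod_beta')
      (intro allI sum.cong refl, simp add: mult_ac)
  finally show ?thesis .
qed

lemma fraction_space_prod:
  assumes X: "function_space X" and Y: "function_space Y"
  shows "fraction_space (fs_prod X Y) (box_functions X Y)"
proof
  interpret X: function_space X by fact
  interpret Y: function_space Y by fact
  show "fs_top (fs_prod X Y) = topology_generated_by {{z \<in> D. s z \<noteq> 0} |D s. (D, s) \<in> box_functions X Y}"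
    unfolding fs_prod_def Let_def box_functions_def fspace.simps
    by (rule arg_cong[of _ _ topology_generated_by]) (auto; blast)
  show "reg (fs_prod X Y) W h \<longleftrightarrow> openin (fs_top (fs_prod X Y)) W \<and>
      (\<forall>z\<in>W. \<exists>D s t. (D, s) \<in> box_functions X Y \<and> (D, t) \<in> box_functions X Y \<and> z \<in> D \<and> s z \<noteq> 0 \<and>
         (\<forall>w\<in>W \<inter> D. s w \<noteq> 0 \<longrightarrow> h w = t w / s w))" for W h
  proof -
    have "(\<exists>U V s t. openin (fs_top X) U \<and> openin (fs_top Y) V \<and>
            s \<in> tensor_fun X Y U V \<and> t \<in> tensor_fun X Y U V \<and>
            z \<in> U \<times> V \<and> s z \<noteq> 0 \<and> (\<forall>w \<in> W \<inter> (U \<times> V). s w \<noteq> 0 \<longrightarrow> h w = t w / s w)) \<longleftrightarrow>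
      (\<exists>D s t. (D, s) \<in> box_functions X Y \<and> (D, t) \<in> box_functions X Y \<and> z \<in> D \<and> s z \<noteq> 0 \<and>
         (\<forall>w\<in>W \<inter> D. s w \<noteq> 0 \<longrightarrow> h w = t w / s w))" (is "?L \<longleftrightarrow> ?R") for z
    proof
      assume ?L
      then obtain U V s t where *: "openin (fs_top X) U" "openin (fs_top Y) V"
            "s \<in> tensor_fun X Y U V" "t \<in> tensor_fun X Y U V"
            "z \<in> U \<times> V" "s z \<noteq> 0" "\<forall>w \<in> W \<inter> (U \<times> V). s w \<noteq> 0 \<longrightarrow> h w = t w / s w"
        by (elim exE conjE) (rule that)
      show ?R
        by (rule exI[of _ "U \<times> V"], rule exI[of _ s], rule exI[of _ t])
          (use * in \<open>auto simp: box_functions_def\<close>)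
    next
      assume ?R
      then obtain D s t where *: "(D, s) \<in> box_functions X Y" "(D, t) \<in> box_functions X Y"
         "z \<in> D" "s z \<noteq> 0" "\<forall>w\<in>W \<inter> D. s w \<noteq> 0 \<longrightarrow> h w = t w / s w"
        by (elim exE conjE) (rule that)
      from *(1) obtain U V where UV: "D = U \<times> V" "openin (fs_top X) U" "openin (fs_top Y) V"
            "s \<in> tensor_fun X Y U V"
        unfolding box_functions_def by auto
      from *(2) obtain U' V' where UV': "D = U' \<times> V'" "t \<in> tensor_fun X Y U' V'"
        unfolding box_functions_def by auto
      have "U' = U" "V' = V" using UV(1) UV'(1) *(3) by (auto simp: times_eq_iff)
      then show ?L
        by (intro exI[of _ U] exI[of _ V] exI[of _ s] exI[of _ t]) (use * UV UV' in auto)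
    qed
    then show ?thesis unfolding fs_prod_def by (simp only: Let_def fspace.simps)
  qed
  show "(D, \<lambda>_. c) \<in> box_functions X Y" if Ds: "(D, s) \<in> box_functions X Y" for D s c
  proof -
    from Ds obtain U V where UV: "D = U \<times> V" "openin (fs_top X) U" "openin (fs_top Y) V"
      unfolding box_functions_def by auto
    have "(\<lambda>(x, y). \<Sum>i\<in>{()}. c * 1) \<in> tensor_fun X Y U V"
      by (rule tensor_funI) (use UV X.reg_const Y.reg_const in auto)
    then show ?thesis using UV unfolding box_functions_def by (auto simp: case_prod_beta')
  qed
  \<comment> \<open>An empty box is a product of open sets in several ways, so even two functions on the same
     domain are first restricted to a common pair of factors.\<close>
  have both: "(D \<inter> E, \<lambda>x. s x * t x) \<in> box_functions X Y \<and> (D \<inter> E, \<lambda>x. s x + t x) \<in> box_functions X Y"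
    if st: "(D, s) \<in> box_functions X Y" "(E, t) \<in> box_functions X Y" for D s E t
  proof -
  from st(1) obtain U V where UV: "D = U \<times> V" "openin (fs_top X) U" "openin (fs_top Y) V"
          "s \<in> tensor_fun X Y U V"
    unfolding box_functions_def by auto
  from st(2) obtain U' V' where UV': "E = U' \<times> V'" "openin (fs_top X) U'" "openin (fs_top Y) V'"
          "t \<in> tensor_fun X Y U' V'"
    unfolding box_functions_def by auto
  have DE: "D \<inter> E = (U \<inter> U') \<times> (V \<inter> V')" using UV UV' by auto
  have o: "openin (fs_top X) (U \<inter> U')" "openin (fs_top Y) (V \<inter> V')" using UV UV' by auto
  have *: "s \<in> tensor_fun X Y (U \<inter> U') (V \<inter> V')" "t \<in> tensor_fun X Y (U \<inter> U') (V \<inter> V')"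
    by (rule tensor_fun_subset[OF X Y UV(4) o(1) _ o(2)] tensor_fun_subset[OF X Y UV'(4) o(1) _ o(2)]; blast)+
  show ?thesis
    using tensor_fun_mult[OF X Y *] tensor_fun_add[OF *] o unfolding DE box_functions_def by auto
  qed
  show "(D \<inter> E, \<lambda>x. s x * t x) \<in> box_functions X Y"
    if "(D, s) \<in> box_functions X Y" "(E, t) \<in> box_functions X Y" for D s E t
    using both[OF that] by simp
  show "(D, \<lambda>x. s x + t x) \<in> box_functions X Y"
    if "(D, s) \<in> box_functions X Y" "(D, t) \<in> box_functions X Y" for D s t
    using both[OF that] by simp
qed

lemma function_space_prod:
  "function_space X \<Longrightarrow> function_space Y \<Longrightarrow> function_space (fs_prod X Y)"
  by (rule fraction_space.function_space[OF fraction_space_prod])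

lemma box_functions_fst:
  assumes "function_space Y" "reg X U h" "openin (fs_top X) U"
  shows "(U \<times> fs_points Y, h \<circ> fst) \<in> box_functions X Y"
proof -
  have "(\<lambda>(x, y). \<Sum>i\<in>{()}. h x * 1) \<in> tensor_fun X Y U (fs_points Y)"
    by (rule tensor_funI) (use assms function_space.reg_const[OF assms(1) openin_topspace] in auto)
  also have "(\<lambda>(x, y). \<Sum>i\<in>{()}. h x * 1) = (h \<circ> fst :: 'b \<times> 'a \<Rightarrow> complex)"
    by (simp add: fun_eq_iff)
  finally show ?thesis using assms(3) unfolding box_functions_def by blast
qed

lemma box_functions_snd:
  assumes "function_space X" "reg Y V h" "openin (fs_top Y) V"
  shows "(fs_points X \<times> V, h \<circ> snd) \<in> box_functions X Y"
proof -
  have "(\<lambda>(x, y). \<Sum>i\<in>{()}. 1 * h y) \<in> tensor_fun X Y (fs_points X) V"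
    by (rule tensor_funI) (use assms function_space.reg_const[OF assms(1) openin_topspace] in auto)
  also have "(\<lambda>(x, y). \<Sum>i\<in>{()}. 1 * h y) = (h \<circ> snd :: 'a \<times> 'b \<Rightarrow> complex)"
    by (simp add: fun_eq_iff)
  finally show ?thesis using assms(3) unfolding box_functions_def by blast
qed

lemma points_prod [simp]:
  assumes "function_space X" "function_space Y"
  shows "fs_points (fs_prod X Y) = fs_points X \<times> fs_points Y"
proof -
  have "fs_points (fs_prod X Y) = (\<Union>(D, s)\<in>box_functions X Y. D)"
    by (rule fraction_space.points_eq[OF fraction_space_prod[OF assms]])
  also have "\<dots> = fs_points X \<times> fs_points Y"
  proof
    show "(\<Union>(D, s)\<in>box_functions X Y. D) \<subseteq> fs_points X \<times> fs_points Y"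
      unfolding box_functions_def using openin_subset[of "fs_top X"] openin_subset[of "fs_top Y"] by auto
    show "fs_points X \<times> fs_points Y \<subseteq> (\<Union>(D, s)\<in>box_functions X Y. D)"
      using box_functions_fst[OF assms(2) function_space.reg_const[OF assms(1) openin_topspace] openin_topspace]
      by auto
  qed
  finally show ?thesis .
qed

lemma morphism_fst:
  assumes X: "function_space X" and Y: "function_space Y"
  shows "fs_morphism (fs_prod X Y) X fst"
  unfolding fs_morphism_def continuous_map_def
proof (intro conjI allI impI)
  interpret P: fraction_space "fs_prod X Y" "box_functions X Y" by (rule fraction_space_prod[OF X Y])
  have pre: "{x \<in> fs_points (fs_prod X Y). fst x \<in> U} = U \<times> fs_points Y" if "openin (fs_top X) U" for U
    using openin_subset[OF that] by (auto simp: X Y)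
  show "fst \<in> fs_points (fs_prod X Y) \<rightarrow> fs_points X" by (auto simp: X Y)
  show "openin (fs_top (fs_prod X Y)) {x \<in> fs_points (fs_prod X Y). fst x \<in> U}"
    if U: "openin (fs_top X) U" for U
    unfolding pre[OF U]
    by (rule P.openin_domain[OF box_functions_fst[OF Y function_space.reg_const[OF X U] U]])
  show "reg (fs_prod X Y) {x \<in> fs_points (fs_prod X Y). fst x \<in> U} (h \<circ> fst)"
    if U: "openin (fs_top X) U" "reg X U h" for U h
    unfolding pre[OF U(1)] by (rule P.reg_generator[OF box_functions_fst[OF Y U(2,1)]])
qed

lemma morphism_snd:
  assumes X: "function_space X" and Y: "function_space Y"
  shows "fs_morphism (fs_prod X Y) Y snd"
  unfolding fs_morphism_def continuous_map_def
proof (intro conjI allI impI)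
  interpret P: fraction_space "fs_prod X Y" "box_functions X Y" by (rule fraction_space_prod[OF X Y])
  have pre: "{x \<in> fs_points (fs_prod X Y). snd x \<in> U} = fs_points X \<times> U" if "openin (fs_top Y) U" for U
    using openin_subset[OF that] by (auto simp: X Y)
  show "snd \<in> fs_points (fs_prod X Y) \<rightarrow> fs_points Y" by (auto simp: X Y)
  show "openin (fs_top (fs_prod X Y)) {x \<in> fs_points (fs_prod X Y). snd x \<in> U}"
    if U: "openin (fs_top Y) U" for U
    unfolding pre[OF U]
    by (rule P.openin_domain[OF box_functions_snd[OF X function_space.reg_const[OF Y U] U]])
  show "reg (fs_prod X Y) {x \<in> fs_points (fs_prod X Y). snd x \<in> U} (h \<circ> snd)"
    if U: "openin (fs_top Y) U" "reg Y U h" for U h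
    unfolding pre[OF U(1)] by (rule P.reg_generator[OF box_functions_snd[OF X U(2,1)]])
qed

text \<open>
  Together with the two projections this is the universal property of the product in the category
  of spaces with functions.
\<close>

lemma morphism_pair:
  assumes X: "function_space X" and Y: "function_space Y" and Z: "function_space Z"
    and \<phi>: "fs_morphism Z X \<phi>" and \<psi>: "fs_morphism Z Y \<psi>"
  shows "fs_morphism Z (fs_prod X Y) (\<lambda>z. (\<phi> z, \<psi> z))"
proof (rule fraction_space.morphism_into[OF fraction_space_prod[OF X Y] Z])
  interpret Z: function_space Z by fact
  show "(\<lambda>z. (\<phi> z, \<psi> z)) ` fs_points Z \<subseteq> fs_points (fs_prod X Y)"
    using morphism_points[OF \<phi>] morphism_points[OF \<psi>] by (auto simp: X Y)
  fix D s assume "(D, s) \<in> box_functions X Y"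
  then obtain U V where UV: "D = U \<times> V" "openin (fs_top X) U" "openin (fs_top Y) V"
          "s \<in> tensor_fun X Y U V"
    unfolding box_functions_def by auto
  obtain n :: nat and f g where s: "s = (\<lambda>(x, y). \<Sum>i<n. f i x * g i y)"
    "\<forall>i<n. reg X U (f i)" "\<forall>i<n. reg Y V (g i)"
    using UV(4) by (rule tensor_funE)
  let ?U = "{x \<in> fs_points Z. \<phi> x \<in> U}" and ?V = "{x \<in> fs_points Z. \<psi> x \<in> V}"
  have eq: "{x \<in> fs_points Z. (\<phi> x, \<psi> x) \<in> D} = ?U \<inter> ?V" using UV(1) by auto
  have o: "openin (fs_top Z) (?U \<inter> ?V)"
    by (intro openin_Int morphism_openin[OF \<phi> UV(2)] morphism_openin[OF \<psi> UV(3)])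
  have "reg Z (?U \<inter> ?V) (\<lambda>z. \<Sum>i<n. (f i \<circ> \<phi>) z * (g i \<circ> \<psi>) z)"
  proof (intro Z.reg_sum[OF o] Z.reg_mult)
    fix i assume i: "i \<in> {..<n}"
    show "reg Z (?U \<inter> ?V) (f i \<circ> \<phi>)"
      by (rule Z.reg_subset[OF morphism_regD[OF \<phi> UV(2)] o]) (use s(2) i in auto)
    show "reg Z (?U \<inter> ?V) (g i \<circ> \<psi>)"
      by (rule Z.reg_subset[OF morphism_regD[OF \<psi> UV(3)] o]) (use s(3) i in auto)
  qed
  then show "reg Z {x \<in> fs_points Z. (\<phi> x, \<psi> x) \<in> D} (s \<circ> (\<lambda>z. (\<phi> z, \<psi> z)))"
    unfolding eq s(1) by (simp add: o_def)
qed


subsection \<open>Quotients\<close>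

lemma fs_top_quotient [simp]: "fs_top (fs_quotient X G \<phi>) = quotient_top (fs_top X) G \<phi>"
  by (simp add: fs_quotient_def Let_def)

lemma reg_quotient_iff:
  "reg (fs_quotient X G \<phi>) U h \<longleftrightarrow> openin (quotient_top (fs_top X) G \<phi>) U \<and>
     reg X {x \<in> fs_points X. Group_Action.orbit G \<phi> x \<in> U} (\<lambda>x. h (Group_Action.orbit G \<phi> x))"
  by (simp add: fs_quotient_def Let_def)

lemma points_quotient [simp]: "fs_points (fs_quotient X G \<phi>) = orbits G (fs_points X) \<phi>"
proof
  show "fs_points (fs_quotient X G \<phi>) \<subseteq> orbits G (fs_points X) \<phi>"
    using openin_quotient_top[of "fs_top X" G \<phi> "fs_points (fs_quotient X G \<phi>)"]
    by (metis fs_top_quotient openin_topspace)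
  have eq: "{x \<in> fs_points X. Group_Action.orbit G \<phi> x \<in> orbits G (fs_points X) \<phi>} = fs_points X"
    by (auto simp: orbits_def)
  have "openin (quotient_top (fs_top X) G \<phi>) (orbits G (fs_points X) \<phi>)"
    unfolding openin_quotient_top eq by simp
  then show "orbits G (fs_points X) \<phi> \<subseteq> fs_points (fs_quotient X G \<phi>)"
    using openin_subset by fastforce
qed

lemma function_space_quotient:
  assumes "function_space X"
  shows "function_space (fs_quotient X G \<phi>)"
proof -
  interpret X: function_space X by fact
  let ?T = "quotient_top (fs_top X) G \<phi>" and ?p = "Group_Action.orbit G \<phi>"
  let ?pre = "\<lambda>U. {x \<in> fs_points X. ?p x \<in> U}"
  have pre: "openin (fs_top X) (?pre U)" if "openin ?T U" for U
    using that unfolding openin_quotient_top by simp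
  show ?thesis
  proof (unfold_locales, unfold reg_quotient_iff fs_top_quotient)
    fix U f
    assume U: "openin ?T U" and loc: "\<And>x. x \<in> U \<Longrightarrow> locally_reg (fs_quotient X G \<phi>) U f x"
    have "reg X (?pre U) (\<lambda>x. f (?p x))"
    proof (rule X.reg_local[OF pre[OF U]])
      fix x assume "x \<in> ?pre U"
      then have x: "x \<in> fs_points X" "?p x \<in> U" by auto
      from loc[OF x(2)] obtain V g where V: "openin ?T V" "?p x \<in> V" "reg X (?pre V) (\<lambda>x. g (?p x))"
          "\<forall>y\<in>U \<inter> V. f y = g y"
        by (rule locally_regE) (simp add: reg_quotient_iff)
      show "locally_reg X (?pre U) (\<lambda>x. f (?p x)) x"
        by (rule locally_regI[OF pre[OF V(1)] _ V(3)]) (use x V(2,4) in auto)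
    qed
    then show "openin ?T U \<and> reg X (?pre U) (\<lambda>x. f (?p x))" using U by simp
  next
    fix U V f
    assume f: "openin ?T U \<and> reg X (?pre U) (\<lambda>x. f (?p x))" and V: "openin ?T V" "V \<subseteq> U"
    have "reg X (?pre V) (\<lambda>x. f (?p x))"
      by (rule X.reg_subset[OF _ pre[OF V(1)]]) (use f V in auto)
    then show "openin ?T V \<and> reg X (?pre V) (\<lambda>x. f (?p x))" using V by simp
  next
    fix U f assume f: "openin ?T U \<and> reg X (?pre U) (\<lambda>x. f (?p x))"
    have eq: "?pre {x \<in> U. f x \<noteq> 0} = {x \<in> ?pre U. f (?p x) \<noteq> 0}" by auto
    have "openin (fs_top X) (?pre {x \<in> U. f x \<noteq> 0})"
      unfolding eq using f by (intro X.openin_nonzero) simp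
    then show "openin ?T {x \<in> U. f x \<noteq> 0}"
      using f unfolding openin_quotient_top by auto
  qed (auto simp: pre intro: X.reg_const X.reg_add X.reg_mult X.reg_inverse)
qed

lemma morphism_orbit: "fs_morphism X (fs_quotient X G \<phi>) (Group_Action.orbit G \<phi>)"
  unfolding fs_morphism_def continuous_map_def fs_top_quotient reg_quotient_iff
  by (auto simp: openin_quotient_top o_def simp flip: fs_top_quotient)
    (auto simp: orbits_def openin_quotient_top)

text \<open>
  The hypothesis \<open>fac\<close> contains the invariance of \<open>\<psi>\<close>: a function that factors through the
  set of orbits is constant on each of them.
\<close>

lemma morphism_from_quotient:
  assumes \<psi>: "fs_morphism X Y \<psi>"
    and fac: "\<And>x. x \<in> fs_points X \<Longrightarrow> \<theta> (Group_Action.orbit G \<phi> x) = \<psi> x"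
    and X: "function_space X"
  shows "fs_morphism (fs_quotient X G \<phi>) Y \<theta>"
proof -
  let ?T = "quotient_top (fs_top X) G \<phi>" and ?p = "Group_Action.orbit G \<phi>"
  have pre: "{x \<in> fs_points X. ?p x \<in> {y \<in> orbits G (fs_points X) \<phi>. \<theta> y \<in> V}} = {x \<in> fs_points X. \<psi> x \<in> V}" for V
    using fac by (auto simp: orbits_def)
  have op: "openin ?T {y \<in> orbits G (fs_points X) \<phi>. \<theta> y \<in> V}" if "openin (fs_top Y) V" for V
    unfolding openin_quotient_top pre using morphism_openin[OF \<psi> that] by auto
  have "continuous_map ?T (fs_top Y) \<theta>"
    unfolding continuous_map_def using op points_quotient[of X G \<phi>] morphism_points[OF \<psi>] fac
    by (auto simp: orbits_def)
  moreover have "reg X {x \<in> fs_points X. \<psi> x \<in> V} (\<lambda>x. h (\<theta> (?p x)))"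
    if "openin (fs_top Y) V" "reg Y V h" for V h
    by (rule function_space.reg_cong[OF X morphism_regD[OF \<psi> that]]) (simp add: fac)
  ultimately show ?thesis
    unfolding fs_morphism_def points_quotient reg_quotient_iff pre using op by simp
qed


section \<open>Linear algebra\<close>

text \<open>
  A spanning set contains a basis, in terms of determinants.  Starting from the identity matrix, the
  columns are exchanged one after the other for elements of \<open>S\<close>: if every element of \<open>S\<close> made the
  determinant vanish, the linear form given by the cofactors of that column would annihilate \<open>S\<close>,
  hence be zero, contrary to the determinant being nonzero before the exchange.
\<close>

lemma exists_det_nonzero_columns:
  fixes S :: "'a :: field vec set"
  assumes S: "S \<subseteq> carrier_vec n"
    and ann: "\<And>r. r \<in> carrier_vec n \<Longrightarrow> (\<And>s. s \<in> S \<Longrightarrow> r \<bullet> s = 0) \<Longrightarrow> r = 0\<^sub>v n"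
  shows "\<exists>p. (\<forall>k<n. p k \<in> S) \<and> det (mat n n (\<lambda>(i, j). p j $ i)) \<noteq> 0"
proof -
  have "\<exists>p. (\<forall>k<m. p k \<in> S) \<and> det (mat n n (\<lambda>(i, j). p j $ i)) \<noteq> 0" if "m \<le> n" for m
    using that
  proof (induction m)
    case 0
    have "mat n n (\<lambda>(i, j). unit_vec n j $ i) = (1\<^sub>m n :: 'a mat)" by (rule eq_matI) auto
    then show ?case by (intro exI[of _ "unit_vec n"]) simp
  next
    case (Suc m)
    then have m: "m < n" by simp
    obtain p where p: "\<forall>k<m. p k \<in> S" "det (mat n n (\<lambda>(i, j). p j $ i)) \<noteq> 0"
      using Suc by auto
    let ?M = "\<lambda>p. mat n n (\<lambda>(i, j). p j $ i)"
    \<comment> \<open>As a function of column \<open>m\<close> the determinant is the linear form given by the cofactors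
       of that column.\<close>
    define r where "r = vec n (\<lambda>i. cofactor (?M p) i m)"
    have det: "det (?M (p(m := s))) = r \<bullet> s" if s: "s \<in> carrier_vec n" for s
    proof -
      have "det (?M (p(m := s))) = (\<Sum>i<n. ?M (p(m := s)) $$ (i, m) * cofactor (?M (p(m := s))) i m)"
        by (rule laplace_expansion_column) (use m in auto)
      also have "\<dots> = (\<Sum>i<n. r $ i * s $ i)"
      proof (rule sum.cong[OF refl])
        fix i assume i: "i \<in> {..<n}"
        have "mat_delete (?M (p(m := s))) i m = mat_delete (?M p) i m"
          by (rule eq_matI) (use i m in \<open>auto simp: mat_delete_def\<close>)
        then show "?M (p(m := s)) $$ (i, m) * cofactor (?M (p(m := s))) i m = r $ i * s $ i"
          using i m by (simp add: cofactor_def r_def)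
      qed
      also have "\<dots> = r \<bullet> s" using s by (simp add: scalar_prod_def atLeast0LessThan)
      finally show ?thesis .
    qed
    have "r \<noteq> 0\<^sub>v n"
    proof
      assume "r = 0\<^sub>v n"
      have "det (?M p) = (\<Sum>i<n. ?M p $$ (i, m) * cofactor (?M p) i m)"
        by (rule laplace_expansion_column) (use m in auto)
      also have "\<dots> = (\<Sum>i<n. ?M p $$ (i, m) * r $ i)" by (simp add: r_def)
      also have "\<dots> = 0" using \<open>r = 0\<^sub>v n\<close> by simp
      finally show False using p(2) by simp
    qed
    moreover have "r \<in> carrier_vec n" by (simp add: r_def)
    ultimately obtain s where s: "s \<in> S" "r \<bullet> s \<noteq> 0" using ann by blast
    show ?case
      using p(1) s det[of s] S by (intro exI[of _ "p(m := s)"]) (auto simp: less_Suc_eq)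
  qed
  from this[of n] show ?thesis by simp
qed

text \<open>
  Cramer's formula is chosen because it exhibits the entries of the inverse as regular functions.
\<close>

definition mat_inv :: "complex mat \<Rightarrow> complex mat" where
  "mat_inv g = inverse (det g) \<cdot>\<^sub>m adj_mat g"

lemma
  assumes "g \<in> carrier_mat n n" "det g \<noteq> 0"
  shows mat_inv_carrier: "mat_inv g \<in> carrier_mat n n"
    and mat_inv_left: "mat_inv g * g = 1\<^sub>m n"
    and mat_inv_right: "g * mat_inv g = 1\<^sub>m n"
  using adj_mat[OF assms(1)] assms(2)
  by (auto simp: mat_inv_def mult_smult_assoc_mat[OF adj_mat(1)[OF assms(1)] assms(1)]
      mult_smult_distrib[OF assms(1) adj_mat(1)[OF assms(1)]] intro!: eq_matI)

lemma det_mat_inv: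
  assumes "g \<in> carrier_mat n n" "det g \<noteq> 0"
  shows "det (mat_inv g) \<noteq> 0"
  using det_mult[OF mat_inv_carrier[OF assms] assms(1)] mat_inv_left[OF assms] by auto

lemma GL_carrier_iff: "g \<in> carrier (GL n) \<longleftrightarrow> g \<in> carrier_mat n n \<and> det g \<noteq> 0"
proof
  assume "g \<in> carrier (GL n)"
  then have g: "g \<in> Units (ring_mat TYPE(complex) n ())" by (simp add: units_of_carrier)
  then show "g \<in> carrier_mat n n \<and> det g \<noteq> 0"
    using unit_imp_det_non_zero[OF g] by (auto simp: Units_def ring_mat_def)
next
  assume "g \<in> carrier_mat n n \<and> det g \<noteq> 0"
  then show "g \<in> carrier (GL n)" by (simp add: units_of_carrier det_non_zero_imp_unit)
qed

lemma GL_inv: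
  assumes "g \<in> carrier_mat n n" "det g \<noteq> 0"
  shows "inv\<^bsub>GL n\<^esub> g = mat_inv g"
proof -
  interpret R: ring "ring_mat TYPE(complex) n ()" by (rule ring_mat)
  interpret G: group "GL n" by (rule R.units_group)
  show ?thesis
  proof (rule G.inv_equality)
    show "mat_inv g \<otimes>\<^bsub>GL n\<^esub> g = \<one>\<^bsub>GL n\<^esub>"
      using mat_inv_left[OF assms] by (simp add: units_of_mult units_of_one ring_mat_def)
    show "g \<in> carrier (GL n)" "mat_inv g \<in> carrier (GL n)"
      using assms mat_inv_carrier[OF assms] det_mat_inv[OF assms] by (simp_all add: GL_carrier_iff)
  qed
qed

definition mat_trace :: "complex mat \<Rightarrow> complex" where
  "mat_trace A = (\<Sum>i<dim_row A. A $$ (i, i))"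

lemma mat_trace_mult_commute:
  assumes "A \<in> carrier_mat n m" "B \<in> carrier_mat m n"
  shows "mat_trace (A * B) = mat_trace (B * A)"
proof -
  have "mat_trace (A * B) = (\<Sum>i<n. \<Sum>j<m. A $$ (i, j) * B $$ (j, i))"
    using assms by (simp add: mat_trace_def scalar_prod_def atLeast0LessThan)
  also have "\<dots> = (\<Sum>j<m. \<Sum>i<n. B $$ (j, i) * A $$ (i, j))"
    by (subst sum.swap) (simp add: mult.commute)
  also have "\<dots> = mat_trace (B * A)"
    using assms by (simp add: mat_trace_def scalar_prod_def atLeast0LessThan)
  finally show ?thesis .
qed

lemma mat_trace_add:
  "A \<in> carrier_mat n n \<Longrightarrow> B \<in> carrier_mat n n \<Longrightarrow> mat_trace (A + B) = mat_trace A + mat_trace B"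
  by (simp add: mat_trace_def sum.distrib)

lemma mat_surj_section:
  fixes \<pi> :: "complex mat"
  assumes \<pi>: "\<pi> \<in> carrier_mat m n"
    and surj: "(\<lambda>x. \<pi> *\<^sub>v x) ` carrier_vec n = carrier_vec m"
  obtains s where "s \<in> carrier_mat n m" "\<pi> * s = 1\<^sub>m m"
proof -
  have "\<exists>x\<in>carrier_vec n. \<pi> *\<^sub>v x = unit_vec m j" for j
    using surj by (metis (no_types, lifting) imageE unit_vec_carrier)
  then obtain x where x: "\<And>j. x j \<in> carrier_vec n" "\<And>j. \<pi> *\<^sub>v x j = unit_vec m j" by metis
  let ?s = "mat n m (\<lambda>(i, j). x j $ i)"
  have col: "col ?s j = x j" if "j < m" for j
    using x(1)[of j] that by (intro eq_vecI) auto
  have "\<pi> * ?s = 1\<^sub>m m"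
  proof (rule eq_matI)
    fix i j assume ij: "i < dim_row (1\<^sub>m m :: complex mat)" "j < dim_col (1\<^sub>m m :: complex mat)"
    then have "(\<pi> * ?s) $$ (i, j) = (\<pi> *\<^sub>v x j) $ i" using \<pi> col by simp
    also have "\<dots> = 1\<^sub>m m $$ (i, j)" unfolding x(2) using ij by auto
    finally show "(\<pi> * ?s) $$ (i, j) = 1\<^sub>m m $$ (i, j)" .
  qed (use \<pi> in auto)
  then show thesis by (intro that[of ?s]) auto
qed

lemma mat_surjI:
  fixes \<pi> :: "complex mat"
  assumes "\<pi> \<in> carrier_mat m n" "s \<in> carrier_mat n m" "\<pi> * s = 1\<^sub>m m"
  shows "(\<lambda>x. \<pi> *\<^sub>v x) ` carrier_vec n = carrier_vec m"
proof
  show "(\<lambda>x. \<pi> *\<^sub>v x) ` carrier_vec n \<subseteq> carrier_vec m" using assms(1) by auto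
  show "carrier_vec m \<subseteq> (\<lambda>x. \<pi> *\<^sub>v x) ` carrier_vec n"
  proof
    fix y :: "complex vec" assume y: "y \<in> carrier_vec m"
    have "\<pi> *\<^sub>v (s *\<^sub>v y) = y"
      using assms y assoc_mult_mat_vec[OF assms(1,2) y] by simp
    then show "y \<in> (\<lambda>x. \<pi> *\<^sub>v x) ` carrier_vec n"
      using assms(2) y by (metis imageI mult_mat_vec_carrier)
  qed
qed

text \<open>
  The trace is additive in the short exact sequence formed by the kernel of \<open>\<pi>\<close>, the source and the
  target.  As the kernel is a line, the trace of \<open>A\<close> on it is the scalar by which \<open>A\<close> acts there.
\<close>

lemma kernel_eigenvalue:
  fixes \<pi> A B :: "complex mat"
  assumes \<pi>: "\<pi> \<in> carrier_mat m n" and n: "n = Suc m"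
    and surj: "(\<lambda>x. \<pi> *\<^sub>v x) ` carrier_vec n = carrier_vec m"
    and A: "A \<in> carrier_mat n n" and B: "B \<in> carrier_mat m m" and AB: "\<pi> * A = B * \<pi>"
    and x: "x \<in> carrier_vec n" "\<pi> *\<^sub>v x = 0\<^sub>v m"
  shows "A *\<^sub>v x = (mat_trace A - mat_trace B) \<cdot>\<^sub>v x"
proof (cases "x = 0\<^sub>v n")
  case True
  then show ?thesis using A by auto
next
  case False
  obtain s where s: "s \<in> carrier_mat n m" "\<pi> * s = 1\<^sub>m m" by (rule mat_surj_section[OF \<pi> surj])
  obtain k where k: "k < n" "x $ k \<noteq> 0" using False x(1) by (metis carrier_vecD eq_vecI index_zero_vec)
  define X where "X = mat n 1 (\<lambda>(i, j). x $ i)"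
  define R where "R = mat 1 n (\<lambda>(i, j). if j = k then inverse (x $ k) else 0)"
  have X: "X \<in> carrier_mat n 1" and R: "R \<in> carrier_mat 1 n" by (simp_all add: X_def R_def)
  have \<pi>X: "\<pi> * X = 0\<^sub>m m 1"
  proof (rule eq_matI)
    fix i j assume ij: "i < dim_row (0\<^sub>m m 1 :: complex mat)" "j < dim_col (0\<^sub>m m 1 :: complex mat)"
    have "col X j = x" using x(1) ij by (intro eq_vecI) (auto simp: X_def)
    then have "(\<pi> * X) $$ (i, j) = (\<pi> *\<^sub>v x) $ i" using ij \<pi> X by simp
    then show "(\<pi> * X) $$ (i, j) = 0\<^sub>m m 1 $$ (i, j)" using ij x(2) by simp
  qed (use \<pi> X in auto)
  have RX: "R * X = 1\<^sub>m 1"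
  proof (rule eq_matI)
    fix i j assume ij: "i < dim_row (1\<^sub>m 1 :: complex mat)" "j < dim_col (1\<^sub>m 1 :: complex mat)"
    have "(R * X) $$ (i, j) = (\<Sum>l<n. (if l = k then inverse (x $ k) else 0) * x $ l)"
      using ij by (simp add: R_def X_def scalar_prod_def atLeast0LessThan)
    also have "\<dots> = (\<Sum>l<n. if l = k then 1 else 0)"
      using k(2) by (intro sum.cong) auto
    also have "\<dots> = 1" using k(1) by simp
    finally show "(R * X) $$ (i, j) = 1\<^sub>m 1 $$ (i, j)" using ij by simp
  qed (use X R in auto)
  \<comment> \<open>Correct the section so that its image is the kernel of \<open>R\<close>; then \<open>(\<pi>, R)\<close> and
     \<open>(s', X)\<close> are mutually inverse.\<close>
  define s' where "s' = s - X * (R * s)"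
  have s': "s' \<in> carrier_mat n m"
    unfolding s'_def by (rule minus_carrier_mat) (rule mult_carrier_mat[OF X mult_carrier_mat[OF R s(1)]])
  have \<pi>s': "\<pi> * s' = 1\<^sub>m m"
  proof -
    have "\<pi> * s' = \<pi> * s - \<pi> * (X * (R * s))"
      unfolding s'_def using \<pi> s X R by (intro mult_minus_distrib_mat) auto
    also have "\<pi> * (X * (R * s)) = (\<pi> * X) * (R * s)"
      using \<pi> s X R by (intro assoc_mult_mat[symmetric]) auto
    also have "(\<pi> * X) * (R * s) = 0\<^sub>m m m" using \<pi>X s R by (simp add: left_mult_zero_mat[of _ 1 m])
    also have "\<pi> * s - 0\<^sub>m m m = 1\<^sub>m m" unfolding s(2) by (rule eq_matI) auto
    finally show ?thesis .
  qed
  have Rs': "R * s' = 0\<^sub>m 1 m"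
  proof -
    have "R * s' = R * s - R * (X * (R * s))"
      unfolding s'_def using s X R by (intro mult_minus_distrib_mat) auto
    also have "R * (X * (R * s)) = (R * X) * (R * s)"
      using s X R by (intro assoc_mult_mat[symmetric]) auto
    finally show ?thesis using RX s R by simp
  qed
  let ?C = "four_block_mat \<pi> (0\<^sub>m m 0) R (0\<^sub>m 1 0)" and ?D = "four_block_mat s' X (0\<^sub>m 0 m) (0\<^sub>m 0 1)"
  have C: "?C \<in> carrier_mat n n" and D: "?D \<in> carrier_mat n n"
    using four_block_carrier_mat[OF \<pi>, of "0\<^sub>m 1 0" 1 0] four_block_carrier_mat[OF s', of "0\<^sub>m 0 1" 0 1] n by auto
  have "?C * ?D = four_block_mat (1\<^sub>m m) (0\<^sub>m m 1) (0\<^sub>m 1 m) (1\<^sub>m 1)"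
    by (subst mult_four_block_mat[OF \<pi> _ R _ s' X]) (use \<pi>s' \<pi>X Rs' RX in auto)
  also have "\<dots> = 1\<^sub>m n" using four_block_one_mat[of m 1] n by simp
  finally have "?D * ?C = 1\<^sub>m n" by (rule mat_mult_left_right_inverse[OF C D])
  moreover have "?D * ?C = four_block_mat (s' * \<pi> + X * R) (0\<^sub>m n 0) (0\<^sub>m 0 n) (0\<^sub>m 0 0)"
    by (subst mult_four_block_mat[OF s' X _ _ \<pi> _ R]) (use \<pi> s' X R in auto)
  moreover have "\<dots> = s' * \<pi> + X * R"
    by (rule eq_matI) (use s' \<pi> X R in auto)
  ultimately have one: "s' * \<pi> + X * R = 1\<^sub>m n" by simp
  define a where "a = (R * (A * X)) $$ (0, 0)"
  have RAX: "R * (A * X) \<in> carrier_mat 1 1" using R A X by auto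
  have split: "A * M = s' * (B * (\<pi> * M)) + X * (R * (A * M))" if M: "M \<in> carrier_mat n l" for M l
  proof -
    have "A * M = (s' * \<pi> + X * R) * (A * M)" using one A M by simp
    also have "\<dots> = s' * \<pi> * (A * M) + X * R * (A * M)"
      using s' \<pi> X R A M by (intro add_mult_distrib_mat) auto
    also have "s' * \<pi> * (A * M) = s' * ((\<pi> * A) * M)"
      using s' \<pi> A M by (simp add: assoc_mult_mat[of _ n m _ n _ l] assoc_mult_mat[of _ m n _ n _ l])
    also have "(\<pi> * A) * M = B * (\<pi> * M)"
      using AB B \<pi> M by simp
    also have "X * R * (A * M) = X * (R * (A * M))"
      using X R A M by (intro assoc_mult_mat) auto
    finally show ?thesis .
  qed
  have "A * X = s' * (B * 0\<^sub>m m 1) + X * (R * (A * X))" using split[OF X] \<pi>X by simp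
  also have "\<dots> = X * (R * (A * X))" using s' B X RAX by simp
  also have "\<dots> = a \<cdot>\<^sub>m X"
    by (rule eq_matI) (use X RAX in \<open>auto simp: a_def scalar_prod_def\<close>)
  finally have AX: "A * X = a \<cdot>\<^sub>m X" .
  have "A *\<^sub>v x = a \<cdot>\<^sub>v x"
  proof (rule eq_vecI)
    have col: "col X 0 = x" using x(1) by (intro eq_vecI) (auto simp: X_def)
    fix i assume i: "i < dim_vec (a \<cdot>\<^sub>v x)"
    then have "(A *\<^sub>v x) $ i = (A * X) $$ (i, 0)" using A X x col by simp
    also have "\<dots> = (a \<cdot>\<^sub>v x) $ i" unfolding AX using i x(1) by (simp add: X_def)
    finally show "(A *\<^sub>v x) $ i = (a \<cdot>\<^sub>v x) $ i" .
  qed (use A x in auto)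
  moreover have "mat_trace A = mat_trace B + a"
  proof -
    have "A = s' * (B * \<pi>) + X * (R * A)" using split[of "1\<^sub>m n" n] A \<pi> by simp
    then have "mat_trace A = mat_trace (s' * (B * \<pi>)) + mat_trace (X * (R * A))"
      using s' B \<pi> X R A by (metis mat_trace_add mult_carrier_mat)
    also have "mat_trace (s' * (B * \<pi>)) = mat_trace (B * \<pi> * s')"
      using s' B \<pi> by (intro mat_trace_mult_commute) auto
    also have "B * \<pi> * s' = B" using s' B \<pi> \<pi>s' by (simp add: assoc_mult_mat[of _ m m _ n _ m])
    also have "mat_trace (X * (R * A)) = mat_trace (R * A * X)"
      using X R A by (intro mat_trace_mult_commute) auto
    also have "R * A * X = R * (A * X)" using X R A by (intro assoc_mult_mat) auto
    also have "mat_trace (R * (A * X)) = a" using RAX R by (simp add: mat_trace_def a_def)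
    finally show ?thesis .
  qed
  ultimately show ?thesis by simp
qed

lemma mat_mult_unit_vec:
  fixes A :: "'a :: comm_ring_1 mat"
  assumes "A \<in> carrier_mat m n" "j < n"
  shows "A *\<^sub>v unit_vec n j = col A j"
  using assms by (intro eq_vecI) auto

lemma mat_eqI_mult_vec:
  fixes A B :: "'a :: comm_ring_1 mat"
  assumes A: "A \<in> carrier_mat m n" and B: "B \<in> carrier_mat m n"
    and eq: "\<And>x. x \<in> carrier_vec n \<Longrightarrow> A *\<^sub>v x = B *\<^sub>v x"
  shows "A = B"
proof (rule eq_matI)
  fix i j assume ij: "i < dim_row B" "j < dim_col B"
  then have "col A j = col B j"
    using eq[of "unit_vec n j"] mat_mult_unit_vec[OF A] mat_mult_unit_vec[OF B] B by simp
  then have "col A j $ i = col B j $ i" by simp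
  then show "A $$ (i, j) = B $$ (i, j)" using ij A B by simp
qed (use A B in auto)

text \<open>
  If \<open>A\<close> kills the kernel and \<open>s\<close> is a section of \<open>\<pi>\<close>, then \<open>A = A s \<pi>\<close>, and by commuting the two
  factors its trace is that of \<open>\<pi> A s = B\<close>.
\<close>

lemma trace_eq_if_vanishes_on_kernel:
  fixes \<pi> A B :: "complex mat"
  assumes \<pi>: "\<pi> \<in> carrier_mat m n"
    and surj: "(\<lambda>x. \<pi> *\<^sub>v x) ` carrier_vec n = carrier_vec m"
    and A: "A \<in> carrier_mat n n" and B: "B \<in> carrier_mat m m" and AB: "\<pi> * A = B * \<pi>"
    and van: "\<And>x. x \<in> carrier_vec n \<Longrightarrow> \<pi> *\<^sub>v x = 0\<^sub>v m \<Longrightarrow> A *\<^sub>v x = 0\<^sub>v n"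
  shows "mat_trace A = mat_trace B"
proof -
  obtain s where s: "s \<in> carrier_mat n m" "\<pi> * s = 1\<^sub>m m" by (rule mat_surj_section[OF \<pi> surj])
  have s\<pi>: "s * \<pi> \<in> carrier_mat n n" using s \<pi> by auto
  \<comment> \<open>\<open>1 - s \<pi>\<close> is a projection onto the kernel of \<open>\<pi>\<close>, so that \<open>A = A s \<pi>\<close>.\<close>
  have "A *\<^sub>v x = (A * (s * \<pi>)) *\<^sub>v x" if x: "x \<in> carrier_vec n" for x
  proof -
    have px: "\<pi> *\<^sub>v x \<in> carrier_vec m" and y: "s *\<^sub>v (\<pi> *\<^sub>v x) \<in> carrier_vec n" using \<pi> s x by auto
    have "\<pi> *\<^sub>v (s *\<^sub>v (\<pi> *\<^sub>v x)) = \<pi> *\<^sub>v x"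
      using assoc_mult_mat_vec[OF \<pi> s(1) px] s(2) px by simp
    then have "\<pi> *\<^sub>v (x - s *\<^sub>v (\<pi> *\<^sub>v x)) = 0\<^sub>v m"
      using mult_minus_distrib_mat_vec[OF \<pi> x y] px by simp
    then have "A *\<^sub>v (x - s *\<^sub>v (\<pi> *\<^sub>v x)) = 0\<^sub>v n" using van x y by simp
    then have "A *\<^sub>v x - A *\<^sub>v (s *\<^sub>v (\<pi> *\<^sub>v x)) = 0\<^sub>v n"
      using mult_minus_distrib_mat_vec[OF A x y] by simp
    then have "A *\<^sub>v x = A *\<^sub>v (s *\<^sub>v (\<pi> *\<^sub>v x))"
      using A by (auto simp: vec_eq_iff)
    also have "\<dots> = (A * (s * \<pi>)) *\<^sub>v x"
      using assoc_mult_mat_vec[OF s(1) \<pi> x] assoc_mult_mat_vec[OF A s\<pi> x] by simp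
    finally show ?thesis .
  qed
  then have "A = A * (s * \<pi>)"
    using A s\<pi> by (intro mat_eqI_mult_vec[of _ n n]) auto
  also have "A * (s * \<pi>) = (A * s) * \<pi>" using A s \<pi> by simp
  finally have "mat_trace A = mat_trace ((A * s) * \<pi>)" by simp
  also have "\<dots> = mat_trace (\<pi> * (A * s))"
    using A s \<pi> by (intro mat_trace_mult_commute) auto
  also have "\<pi> * (A * s) = (\<pi> * A) * s" using A s \<pi> by simp
  also have "\<dots> = B" unfolding AB using B s \<pi> by simp
  finally show ?thesis .
qed

lemma kernel_trivial_if_square_surj:
  fixes \<pi> :: "complex mat"
  assumes \<pi>: "\<pi> \<in> carrier_mat n n"
    and surj: "(\<lambda>x. \<pi> *\<^sub>v x) ` carrier_vec n = carrier_vec n"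
    and x: "x \<in> carrier_vec n" "\<pi> *\<^sub>v x = 0\<^sub>v n"
  shows "x = 0\<^sub>v n"
proof -
  obtain s where s: "s \<in> carrier_mat n n" "\<pi> * s = 1\<^sub>m n" by (rule mat_surj_section[OF \<pi> surj])
  have "s * \<pi> = 1\<^sub>m n" by (rule mat_mult_left_right_inverse[OF \<pi> s])
  then have "x = s *\<^sub>v (\<pi> *\<^sub>v x)" using assoc_mult_mat_vec[OF s(1) \<pi> x(1)] x(1) by simp
  also have "\<dots> = 0\<^sub>v n" using x(2) s(1) by auto
  finally show ?thesis .
qed


lemma mat_intertwine_comp:
  fixes A A' A'' :: "complex mat"
  assumes "A \<in> carrier_mat m n" "A' \<in> carrier_mat m' n'" "A'' \<in> carrier_mat m'' n''"
    and "h \<in> carrier_mat m' m" "t \<in> carrier_mat n' n" "h' \<in> carrier_mat m'' m'" "t' \<in> carrier_mat n'' n'"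
    and "h * A = A' * t" "h' * A' = A'' * t'"
  shows "(h' * h) * A = A'' * (t' * t)"
proof -
  have "(h' * h) * A = h' * (h * A)" using assms(1-7) by simp
  also have "\<dots> = (h' * A') * t" unfolding assms(8) using assms(1-7) by simp
  also have "\<dots> = A'' * (t' * t)" unfolding assms(9) using assms(1-7) by simp
  finally show ?thesis .
qed

lemma mat_intertwine_mult:
  fixes A A' B B' :: "complex mat"
  assumes "A \<in> carrier_mat m n" "A' \<in> carrier_mat m' n'" "B \<in> carrier_mat n l" "B' \<in> carrier_mat n' l'"
    and "g \<in> carrier_mat m' m" "h \<in> carrier_mat n' n" "k \<in> carrier_mat l' l"
    and "g * A = A' * h" "h * B = B' * k"
  shows "g * (A * B) = A' * B' * k"
proof -
  have "g * (A * B) = (g * A) * B" using assms(1-7) by simp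
  also have "\<dots> = A' * (h * B)" unfolding assms(8) using assms(1-7) by simp
  also have "\<dots> = A' * B' * k" unfolding assms(9) using assms(1-7) by simp
  finally show ?thesis .
qed

lemma mat_intertwine_vec:
  fixes A A' :: "complex mat"
  assumes "A \<in> carrier_mat m n" "A' \<in> carrier_mat m' n'" "h \<in> carrier_mat m' m" "t \<in> carrier_mat n' n"
    and "x \<in> carrier_vec n" "h * A = A' * t"
  shows "h *\<^sub>v (A *\<^sub>v x) = A' *\<^sub>v (t *\<^sub>v x)"
  using assoc_mult_mat_vec[OF assms(3,1,5)] assoc_mult_mat_vec[OF assms(2,4,5)] assms(6) by simp


section \<open>Representations and their maps\<close>

locale quiver = fin_digraph Q for Q :: "('v, 'e) pre_digraph"
begin

lemma tail_verts [simp]: "e \<in> arcs Q \<Longrightarrow> tail Q e \<in> verts Q"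
  and head_verts [simp]: "e \<in> arcs Q \<Longrightarrow> head Q e \<in> verts Q"
  by simp_all

lemma
  assumes "D \<in> qreps Q d f"
  shows rA_carrier: "e \<in> arcs Q \<Longrightarrow> rA D e \<in> carrier_mat (d (head Q e)) (d (tail Q e))"
    and rB_carrier: "e \<in> arcs Q \<Longrightarrow> rB D e \<in> carrier_mat (d (tail Q e)) (d (head Q e))"
    and ri_carrier: "w \<in> verts Q \<Longrightarrow> ri D w \<in> carrier_mat (d w) (f w)"
    and rj_carrier: "w \<in> verts Q \<Longrightarrow> rj D w \<in> carrier_mat (f w) (d w)"
  using assms unfolding qreps_def by (auto simp: PiE_iff)

lemma qrep_eqI:
  assumes D: "D \<in> qreps Q d f" and D': "D' \<in> qreps Q d' f'"
    and "\<And>e. e \<in> arcs Q \<Longrightarrow> rA D e = rA D' e" "\<And>e. e \<in> arcs Q \<Longrightarrow> rB D e = rB D' e"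
    and "\<And>w. w \<in> verts Q \<Longrightarrow> ri D w = ri D' w" "\<And>w. w \<in> verts Q \<Longrightarrow> rj D w = rj D' w"
  shows "D = D'"
proof (rule qrep.equality)
  show "rA D = rA D'"
    by (rule extensionalityI[of _ "arcs Q"]) (use assms in \<open>simp_all add: qreps_def PiE_iff\<close>)
  show "rB D = rB D'"
    by (rule extensionalityI[of _ "arcs Q"]) (use assms in \<open>simp_all add: qreps_def PiE_iff\<close>)
  show "ri D = ri D'"
    by (rule extensionalityI[of _ "verts Q"]) (use assms in \<open>simp_all add: qreps_def PiE_iff\<close>)
  show "rj D = rj D'"
    by (rule extensionalityI[of _ "verts Q"]) (use assms in \<open>simp_all add: qreps_def PiE_iff\<close>)
qed simp

lemma
  assumes "\<pi> \<in> qrep_maps Q d d' D D'"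
  shows map_carrier: "w \<in> verts Q \<Longrightarrow> \<pi> w \<in> carrier_mat (d' w) (d w)"
    and map_rA: "e \<in> arcs Q \<Longrightarrow> \<pi> (head Q e) * rA D e = rA D' e * \<pi> (tail Q e)"
    and map_rB: "e \<in> arcs Q \<Longrightarrow> \<pi> (tail Q e) * rB D e = rB D' e * \<pi> (head Q e)"
    and map_ri: "w \<in> verts Q \<Longrightarrow> \<pi> w * ri D w = ri D' w"
    and map_rj: "w \<in> verts Q \<Longrightarrow> rj D' w * \<pi> w = rj D w"
  using assms unfolding qrep_maps_def by (auto simp: PiE_iff)

lemma map_ext:
  assumes "\<pi> \<in> qrep_maps Q d d' D D'" "\<rho> \<in> qrep_maps Q c c' E E'"
    and "\<And>w. w \<in> verts Q \<Longrightarrow> \<pi> w = \<rho> w"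
  shows "\<pi> = \<rho>"
proof (rule extensionalityI[of _ "verts Q"])
  show "\<pi> \<in> extensional (verts Q)" "\<rho> \<in> extensional (verts Q)"
    using assms unfolding qrep_maps_def by (simp_all add: PiE_iff)
qed (rule assms(3))

lemma map_comp:
  assumes D: "D \<in> qreps Q d f" and D': "D' \<in> qreps Q d' f" and D'': "D'' \<in> qreps Q d'' f"
    and \<pi>: "\<pi> \<in> qrep_maps Q d d' D D'" and \<rho>: "\<rho> \<in> qrep_maps Q d' d'' D' D''"
  shows "(\<lambda>w\<in>verts Q. \<rho> w * \<pi> w) \<in> qrep_maps Q d d'' D D''"
  unfolding qrep_maps_def
proof (intro CollectI conjI ballI)
  show "(\<lambda>w\<in>verts Q. \<rho> w * \<pi> w) \<in> (\<Pi>\<^sub>E w\<in>verts Q. carrier_mat (d'' w) (d w))"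
    using mult_carrier_mat[OF map_carrier[OF \<rho>] map_carrier[OF \<pi>]] by auto
  fix e assume e: "e \<in> arcs Q"
  note t = tail_verts[OF e] and h = head_verts[OF e]
  show "(\<lambda>w\<in>verts Q. \<rho> w * \<pi> w) (head Q e) * rA D e = rA D'' e * (\<lambda>w\<in>verts Q. \<rho> w * \<pi> w) (tail Q e)"
    using mat_intertwine_comp[OF rA_carrier[OF D e] rA_carrier[OF D' e] rA_carrier[OF D'' e] map_carrier[OF \<pi> h]
        map_carrier[OF \<pi> t] map_carrier[OF \<rho> h] map_carrier[OF \<rho> t] map_rA[OF \<pi> e] map_rA[OF \<rho> e]] t h by simp
  show "(\<lambda>w\<in>verts Q. \<rho> w * \<pi> w) (tail Q e) * rB D e = rB D'' e * (\<lambda>w\<in>verts Q. \<rho> w * \<pi> w) (head Q e)"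
    using mat_intertwine_comp[OF rB_carrier[OF D e] rB_carrier[OF D' e] rB_carrier[OF D'' e] map_carrier[OF \<pi> t]
        map_carrier[OF \<pi> h] map_carrier[OF \<rho> t] map_carrier[OF \<rho> h] map_rB[OF \<pi> e] map_rB[OF \<rho> e]] t h by simp
next
  fix w assume w: "w \<in> verts Q"
  note c = map_carrier[OF \<pi> w] map_carrier[OF \<rho> w] ri_carrier[OF D w] rj_carrier[OF D'' w]
  have "\<rho> w * \<pi> w * ri D w = ri D'' w"
    using c map_ri[OF \<pi> w] map_ri[OF \<rho> w] by simp
  then show "(\<lambda>w\<in>verts Q. \<rho> w * \<pi> w) w * ri D w = ri D'' w" using w by simp
  have "rj D'' w * (\<rho> w * \<pi> w) = rj D w"
    using c map_rj[OF \<pi> w] map_rj[OF \<rho> w] by (simp flip: assoc_mult_mat)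
  then show "rj D'' w * (\<lambda>w\<in>verts Q. \<rho> w * \<pi> w) w = rj D w" using w by simp
qed

lemma mat_intertwine_inverse:
  fixes A A' g h :: "complex mat"
  assumes A: "A \<in> carrier_mat m n" and A': "A' \<in> carrier_mat m n"
    and g: "g \<in> carrier_mat m m" "det g \<noteq> 0" and h: "h \<in> carrier_mat n n" "det h \<noteq> 0"
    and eq: "g * A = A' * h"
  shows "mat_inv g * A' = A * mat_inv h" and "A' = g * A * mat_inv h"
proof -
  have gi: "mat_inv g \<in> carrier_mat m m" and hi: "mat_inv h \<in> carrier_mat n n"
    using mat_inv_carrier g h by auto
  have "A' = A' * (h * mat_inv h)" using A' mat_inv_right[OF h] by simp
  also have "\<dots> = (A' * h) * mat_inv h" using A' h hi by (intro assoc_mult_mat[symmetric])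
  finally show A'_eq: "A' = g * A * mat_inv h" unfolding eq .
  have "mat_inv g * (g * A * mat_inv h) = (mat_inv g * (g * A)) * mat_inv h"
    using g A hi gi by (intro assoc_mult_mat[symmetric]) auto
  also have "mat_inv g * (g * A) = (mat_inv g * g) * A"
    using g A gi by (intro assoc_mult_mat[symmetric]) auto
  finally show "mat_inv g * A' = A * mat_inv h"
    using A mat_inv_left[OF g] by (simp flip: A'_eq)
qed

lemma map_inverse:
  assumes D: "D \<in> qreps Q d f" and D': "D' \<in> qreps Q d f"
    and g: "g \<in> qrep_maps Q d d D D'" and det: "\<And>w. w \<in> verts Q \<Longrightarrow> det (g w) \<noteq> 0"
  shows "(\<lambda>w\<in>verts Q. mat_inv (g w)) \<in> qrep_maps Q d d D' D"
  unfolding qrep_maps_def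
proof (intro CollectI conjI ballI)
  show "(\<lambda>w\<in>verts Q. mat_inv (g w)) \<in> (\<Pi>\<^sub>E w\<in>verts Q. carrier_mat (d w) (d w))"
    using mat_inv_carrier[OF map_carrier[OF g] det] by auto
  fix e assume e: "e \<in> arcs Q"
  have [simp]: "tail Q e \<in> verts Q" "head Q e \<in> verts Q" using e by auto
  show "(\<lambda>w\<in>verts Q. mat_inv (g w)) (head Q e) * rA D' e = rA D e * (\<lambda>w\<in>verts Q. mat_inv (g w)) (tail Q e)"
    using mat_intertwine_inverse(1)[OF rA_carrier[OF D e] rA_carrier[OF D' e] map_carrier[OF g] det map_carrier[OF g] det map_rA[OF g e]]
    by simp
  show "(\<lambda>w\<in>verts Q. mat_inv (g w)) (tail Q e) * rB D' e = rB D e * (\<lambda>w\<in>verts Q. mat_inv (g w)) (head Q e)"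
    using mat_intertwine_inverse(1)[OF rB_carrier[OF D e] rB_carrier[OF D' e] map_carrier[OF g] det map_carrier[OF g] det map_rB[OF g e]]
    by simp
next
  fix w assume w: "w \<in> verts Q"
  note gw = map_carrier[OF g w] det[OF w]
  note inv = mat_inv_carrier[OF gw] mat_inv_left[OF gw] mat_inv_right[OF gw]
  have "mat_inv (g w) * (g w * ri D w) = ri D w"
    using gw(1) inv ri_carrier[OF D w] by (simp flip: assoc_mult_mat)
  then show "(\<lambda>w\<in>verts Q. mat_inv (g w)) w * ri D' w = ri D w"
    using w by (simp add: map_ri[OF g w])
  have "(rj D' w * g w) * mat_inv (g w) = rj D' w"
    using gw(1) inv rj_carrier[OF D' w] by simp
  then show "rj D w * (\<lambda>w\<in>verts Q. mat_inv (g w)) w = rj D' w"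
    using w by (simp add: map_rj[OF g w])
qed


section \<open>Orbits as isomorphism classes\<close>

text \<open>
  Working with invertible intertwiners instead of the action avoids the inverses in its formula; the
  two points of view agree by \<open>rep_orbit_iff\<close>.
\<close>

definition qrep_iso :: "('v \<Rightarrow> nat) \<Rightarrow> ('v, 'e) qrep \<Rightarrow> ('v, 'e) qrep \<Rightarrow> bool" where
  "qrep_iso d D D' \<longleftrightarrow> (\<exists>g\<in>qrep_maps Q d d D D'. \<forall>w\<in>verts Q. det (g w) \<noteq> 0)"

lemma identity_map: "D \<in> qreps Q d f \<Longrightarrow> (\<lambda>w\<in>verts Q. 1\<^sub>m (d w)) \<in> qrep_maps Q d d D D"
  unfolding qrep_maps_def
  by (auto simp: left_mult_one_mat[OF rA_carrier] right_mult_one_mat[OF rA_carrier]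
      left_mult_one_mat[OF rB_carrier] right_mult_one_mat[OF rB_carrier]
      left_mult_one_mat[OF ri_carrier] right_mult_one_mat[OF rj_carrier])

lemma qrep_iso_refl: "D \<in> qreps Q d f \<Longrightarrow> qrep_iso d D D"
  unfolding qrep_iso_def by (rule bexI[OF _ identity_map]) auto

lemma qrep_iso_sym:
  assumes "D \<in> qreps Q d f" "D' \<in> qreps Q d f" "qrep_iso d D D'"
  shows "qrep_iso d D' D"
proof -
  obtain g where g: "g \<in> qrep_maps Q d d D D'" "\<And>w. w \<in> verts Q \<Longrightarrow> det (g w) \<noteq> 0"
    using assms(3) unfolding qrep_iso_def by blast
  show ?thesis
    unfolding qrep_iso_def
    using det_mat_inv[OF map_carrier[OF g(1)] g(2)]
    by (intro bexI[OF _ map_inverse[OF assms(1,2) g]]) auto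
qed

lemma qrep_iso_trans:
  assumes D: "D \<in> qreps Q d f" "D' \<in> qreps Q d f" "D'' \<in> qreps Q d f"
    and "qrep_iso d D D'" "qrep_iso d D' D''"
  shows "qrep_iso d D D''"
proof -
  obtain g where g: "g \<in> qrep_maps Q d d D D'" "\<And>w. w \<in> verts Q \<Longrightarrow> det (g w) \<noteq> 0"
    using assms(4) unfolding qrep_iso_def by blast
  obtain h where h: "h \<in> qrep_maps Q d d D' D''" "\<And>w. w \<in> verts Q \<Longrightarrow> det (h w) \<noteq> 0"
    using assms(5) unfolding qrep_iso_def by blast
  show ?thesis
    unfolding qrep_iso_def
    by (rule bexI[OF _ map_comp[OF D g(1) h(1)]])
      (use g(2) h(2) det_mult[OF map_carrier[OF h(1)] map_carrier[OF g(1)]] in auto)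
qed

lemma gauge_group_iff:
  "g \<in> carrier (gauge_group Q d) \<longleftrightarrow>
     g \<in> (\<Pi>\<^sub>E w\<in>verts Q. carrier_mat (d w) (d w)) \<and> (\<forall>w\<in>verts Q. det (g w) \<noteq> 0)"
  unfolding gauge_group_def by (simp only: carrier_product_group PiE_iff GL_carrier_iff) blast

lemma
  assumes D: "D \<in> qreps Q d f" and g: "g \<in> carrier (gauge_group Q d)"
  shows gauge_act_qreps: "gauge_act Q d g D \<in> qreps Q d f"
    and gauge_act_map: "g \<in> qrep_maps Q d d D (gauge_act Q d g D)"
proof -
  have gc: "g w \<in> carrier_mat (d w) (d w)" and gd: "det (g w) \<noteq> 0" if "w \<in> verts Q" for w
    using g that unfolding gauge_group_iff by auto
  note inv = mat_inv_carrier[OF gc gd] mat_inv_left[OF gc gd]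
  have can: "M * mat_inv (g w) * g w = M" if "w \<in> verts Q" "M \<in> carrier_mat m (d w)" for M w m
    using gc[OF that(1)] inv[OF that(1) that(1)] that(2) by simp
  show "gauge_act Q d g D \<in> qreps Q d f"
    unfolding qreps_def gauge_act_def
    using mult_carrier_mat[OF mult_carrier_mat[OF gc rA_carrier[OF D]] inv(1)]
      mult_carrier_mat[OF mult_carrier_mat[OF gc rB_carrier[OF D]] inv(1)]
      mult_carrier_mat[OF gc ri_carrier[OF D]] mult_carrier_mat[OF rj_carrier[OF D] inv(1)]
    by (simp add: GL_inv[OF gc gd])
  show "g \<in> qrep_maps Q d d D (gauge_act Q d g D)"
    unfolding qrep_maps_def
  proof (intro CollectI conjI ballI)
    show "g \<in> (\<Pi>\<^sub>E w\<in>verts Q. carrier_mat (d w) (d w))" using g unfolding gauge_group_iff by auto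
    fix e assume e: "e \<in> arcs Q"
    have [simp]: "tail Q e \<in> verts Q" "head Q e \<in> verts Q" using e by auto
    show "g (head Q e) * rA D e = rA (gauge_act Q d g D) e * g (tail Q e)"
      using e can[of "tail Q e" "g (head Q e) * rA D e" "d (head Q e)"] gc[of "head Q e"] rA_carrier[OF D e]
      by (simp add: gauge_act_def GL_inv[OF gc gd])
    show "g (tail Q e) * rB D e = rB (gauge_act Q d g D) e * g (head Q e)"
      using e can[of "head Q e" "g (tail Q e) * rB D e" "d (tail Q e)"] gc[of "tail Q e"] rB_carrier[OF D e]
      by (simp add: gauge_act_def GL_inv[OF gc gd])
  next
    fix w assume w: "w \<in> verts Q"
    show "g w * ri D w = ri (gauge_act Q d g D) w" using w by (simp add: gauge_act_def)
    show "rj (gauge_act Q d g D) w * g w = rj D w"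
      using w can[OF w rj_carrier[OF D w]] by (simp add: gauge_act_def GL_inv[OF gc gd])
  qed
qed

lemma map_gauge:
  assumes "g \<in> qrep_maps Q d d D D'" "\<And>w. w \<in> verts Q \<Longrightarrow> det (g w) \<noteq> 0"
  shows "g \<in> carrier (gauge_group Q d)"
  using assms unfolding gauge_group_iff qrep_maps_def by blast

lemma map_gauge_act:
  assumes D: "D \<in> qreps Q d f" and D': "D' \<in> qreps Q d f"
    and g: "g \<in> qrep_maps Q d d D D'" and det: "\<And>w. w \<in> verts Q \<Longrightarrow> det (g w) \<noteq> 0"
  shows "gauge_act Q d g D = D'"
proof (rule qrep_eqI[OF gauge_act_qreps[OF D map_gauge[OF g det]] D'])
  fix e assume e: "e \<in> arcs Q"
  have [simp]: "tail Q e \<in> verts Q" "head Q e \<in> verts Q" using e by auto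
  show "rA (gauge_act Q d g D) e = rA D' e"
    using mat_intertwine_inverse(2)[OF rA_carrier[OF D e] rA_carrier[OF D' e] map_carrier[OF g] det map_carrier[OF g] det map_rA[OF g e]] e
    by (simp add: gauge_act_def GL_inv[OF map_carrier[OF g] det])
  show "rB (gauge_act Q d g D) e = rB D' e"
    using mat_intertwine_inverse(2)[OF rB_carrier[OF D e] rB_carrier[OF D' e] map_carrier[OF g] det map_carrier[OF g] det map_rB[OF g e]] e
    by (simp add: gauge_act_def GL_inv[OF map_carrier[OF g] det])
next
  fix w assume w: "w \<in> verts Q"
  show "ri (gauge_act Q d g D) w = ri D' w"
    using w map_ri[OF g w] by (simp add: gauge_act_def)
  have "rj D w * mat_inv (g w) = rj D' w"
    unfolding map_rj[OF g w, symmetric]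
    using rj_carrier[OF D' w] map_carrier[OF g w] mat_inv_carrier[OF map_carrier[OF g w] det[OF w]]
      mat_inv_right[OF map_carrier[OF g w] det[OF w]] by simp
  then show "rj (gauge_act Q d g D) w = rj D' w"
    using w by (simp add: gauge_act_def GL_inv[OF map_carrier[OF g] det])
qed

abbreviation rep_orbit :: "('v \<Rightarrow> nat) \<Rightarrow> ('v, 'e) qrep \<Rightarrow> ('v, 'e) qrep set" where
  "rep_orbit d \<equiv> Group_Action.orbit (gauge_group Q d) (gauge_act Q d)"

lemma rep_orbit_iff:
  assumes D: "D \<in> qreps Q d f"
  shows "D' \<in> rep_orbit d D \<longleftrightarrow> D' \<in> qreps Q d f \<and> qrep_iso d D D'"
proof
  assume "D' \<in> rep_orbit d D"
  then obtain g where g: "g \<in> carrier (gauge_group Q d)" "D' = gauge_act Q d g D"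
    unfolding Group_Action.orbit_def by blast
  then show "D' \<in> qreps Q d f \<and> qrep_iso d D D'"
    using gauge_act_qreps[OF D g(1)] gauge_act_map[OF D g(1)] g
    unfolding qrep_iso_def gauge_group_iff by blast
next
  assume *: "D' \<in> qreps Q d f \<and> qrep_iso d D D'"
  then obtain g where g: "g \<in> qrep_maps Q d d D D'" "\<And>w. w \<in> verts Q \<Longrightarrow> det (g w) \<noteq> 0"
    unfolding qrep_iso_def by blast
  show "D' \<in> rep_orbit d D"
    using map_gauge[OF g] map_gauge_act[OF D _ g] * unfolding Group_Action.orbit_def by blast
qed

lemma rep_orbit_eq_iff:
  assumes D: "D \<in> qreps Q d f" and D': "D' \<in> qreps Q d f"
  shows "rep_orbit d D = rep_orbit d D' \<longleftrightarrow> qrep_iso d D D'"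
proof
  assume "rep_orbit d D = rep_orbit d D'"
  then have "D' \<in> rep_orbit d D" using rep_orbit_iff[OF D'] D' qrep_iso_refl[OF D'] by blast
  then show "qrep_iso d D D'" using rep_orbit_iff[OF D] by blast
next
  assume iso: "qrep_iso d D D'"
  show "rep_orbit d D = rep_orbit d D'"
    using rep_orbit_iff[OF D] rep_orbit_iff[OF D'] qrep_iso_trans[OF D D' _ iso]
      qrep_iso_trans[OF D' D _ qrep_iso_sym[OF D D' iso]] by blast
qed

end


section \<open>Covariants, frames and stability\<close>

lemma mult_mat_zero_vec: "A \<in> carrier_mat m n \<Longrightarrow> A *\<^sub>v 0\<^sub>v n = (0\<^sub>v m :: complex vec)"
  by (intro eq_vecI) auto

lemma mat_right_cancel:
  fixes A B M :: "complex mat"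
  assumes A: "A \<in> carrier_mat m n" and B: "B \<in> carrier_mat m n" and M: "M \<in> carrier_mat n n"
    and "det M \<noteq> 0" "A * M = B * M"
  shows "A = B"
proof -
  note inv = mat_inv_carrier[OF M assms(4)] mat_inv_right[OF M assms(4)]
  have "A = A * (M * mat_inv M)" using A inv by simp
  also have "\<dots> = B * M * mat_inv M" using A M inv(1) assms(5) by (simp flip: assoc_mult_mat)
  also have "\<dots> = B" using B M inv by simp
  finally show ?thesis .
qed

context quiver
begin

text \<open>
  The vectors obtained by applying a word in the arrows to a framing vector, regarded as functions
  of the representation.  One word can be evaluated on representations of any dimension vector,
  which is what makes it possible to compare the source and the target of a map.
\<close>

inductive covariant :: "('v \<Rightarrow> nat) \<Rightarrow> 'v \<Rightarrow> (('v, 'e) qrep \<Rightarrow> complex vec) \<Rightarrow> bool"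
  for f :: "'v \<Rightarrow> nat" where
  framing: "w \<in> verts Q \<Longrightarrow> k < f w \<Longrightarrow> covariant f w (\<lambda>D. col (ri D w) k)"
| forward: "e \<in> arcs Q \<Longrightarrow> covariant f (tail Q e) p \<Longrightarrow> covariant f (head Q e) (\<lambda>D. rA D e *\<^sub>v p D)"
| backward: "e \<in> arcs Q \<Longrightarrow> covariant f (head Q e) p \<Longrightarrow> covariant f (tail Q e) (\<lambda>D. rB D e *\<^sub>v p D)"

lemma covariant_carrier:
  assumes "covariant f w p" "D \<in> qreps Q d f"
  shows "p D \<in> carrier_vec (d w)"
  using assms(1)
proof induction
  case (framing w k)
  then show ?case using ri_carrier[OF assms(2)] by (intro col_carrier_vec) auto
next
  case (forward e p)
  then show ?case using mult_mat_vec_carrier[OF rA_carrier[OF assms(2)]] by blast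
next
  case (backward e p)
  then show ?case using mult_mat_vec_carrier[OF rB_carrier[OF assms(2)]] by blast
qed

lemma covariant_map:
  assumes "covariant f w p" and D: "D \<in> qreps Q d f" and D': "D' \<in> qreps Q d' f"
    and \<pi>: "\<pi> \<in> qrep_maps Q d d' D D'"
  shows "\<pi> w *\<^sub>v p D = p D'"
  using assms(1)
proof induction
  case (framing w k)
  then show ?case
    using col_mult2[OF map_carrier[OF \<pi>] ri_carrier[OF D]] map_ri[OF \<pi>] by metis
next
  case (forward e p)
  note t = tail_verts[OF forward(1)] and h = head_verts[OF forward(1)]
  show ?case
    using mat_intertwine_vec[OF rA_carrier[OF D forward(1)] rA_carrier[OF D' forward(1)] map_carrier[OF \<pi> h]
        map_carrier[OF \<pi> t] covariant_carrier[OF forward(2) D] map_rA[OF \<pi> forward(1)]] forward.IH by simp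
next
  case (backward e p)
  note t = tail_verts[OF backward(1)] and h = head_verts[OF backward(1)]
  show ?case
    using mat_intertwine_vec[OF rB_carrier[OF D backward(1)] rB_carrier[OF D' backward(1)] map_carrier[OF \<pi> t]
        map_carrier[OF \<pi> h] covariant_carrier[OF backward(2) D] map_rB[OF \<pi> backward(1)]] backward.IH by simp
qed

text \<open>
  The columns are the covariants \<open>p w k\<close> for \<open>k < n w\<close>; the rows belong to the dimension vector \<open>m\<close>
  of \<open>D\<close>.  The two differ when covariants that form a basis for the source of a map are evaluated on
  its target.
\<close>

definition frame_mat ::
    "('v \<Rightarrow> nat) \<Rightarrow> ('v \<Rightarrow> nat) \<Rightarrow> ('v \<Rightarrow> nat \<Rightarrow> ('v, 'e) qrep \<Rightarrow> complex vec) \<Rightarrow> 'v \<Rightarrow> ('v, 'e) qrep \<Rightarrow> complex mat"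
  where "frame_mat m n p w D = mat (m w) (n w) (\<lambda>(i, k). p w k D $ i)"

definition frame :: "('v \<Rightarrow> nat) \<Rightarrow> ('v \<Rightarrow> nat) \<Rightarrow> ('v \<Rightarrow> nat \<Rightarrow> ('v, 'e) qrep \<Rightarrow> complex vec) \<Rightarrow> bool"
  where "frame f n p \<longleftrightarrow> (\<forall>w\<in>verts Q. \<forall>k<n w. covariant f w (p w k))"

lemma frame_mat_carrier [simp]: "frame_mat m n p w D \<in> carrier_mat (m w) (n w)"
  by (simp add: frame_mat_def)

lemma frame_mat_map:
  assumes p: "frame f n p" and w: "w \<in> verts Q" and D: "D \<in> qreps Q d f" and D': "D' \<in> qreps Q d' f"
    and \<pi>: "\<pi> \<in> qrep_maps Q d d' D D'"
  shows "\<pi> w * frame_mat d n p w D = frame_mat d' n p w D'"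
proof (rule eq_matI)
  fix i k assume "i < dim_row (frame_mat d' n p w D')" "k < dim_col (frame_mat d' n p w D')"
  then have ik: "i < d' w" "k < n w" by (simp_all add: frame_mat_def)
  then have c: "covariant f w (p w k)" using p w by (simp add: frame_def)
  have "col (frame_mat d n p w D) k = p w k D"
    using covariant_carrier[OF c D] ik by (intro eq_vecI) (auto simp: frame_mat_def)
  then have "(\<pi> w * frame_mat d n p w D) $$ (i, k) = (\<pi> w *\<^sub>v p w k D) $ i"
    using map_carrier[OF \<pi> w] ik by (simp add: frame_mat_def)
  also have "\<dots> = frame_mat d' n p w D' $$ (i, k)"
    unfolding covariant_map[OF c D D' \<pi>] using ik by (simp add: frame_mat_def)
  finally show "(\<pi> w * frame_mat d n p w D) $$ (i, k) = frame_mat d' n p w D' $$ (i, k)" .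
qed (use map_carrier[OF \<pi> w] in \<open>auto simp: frame_mat_def\<close>)

end

lemma subspace_vec_iff:
  "VectorSpace.subspace class_ring W (module_vec TYPE(complex) n) \<longleftrightarrow>
     W \<subseteq> carrier_vec n \<and> 0\<^sub>v n \<in> W \<and> (\<forall>x\<in>W. \<forall>y\<in>W. x + y \<in> W) \<and> (\<forall>c. \<forall>x\<in>W. c \<cdot>\<^sub>v x \<in> W)"
proof -
  have "submodule class_ring W (module_vec TYPE(complex) n) \<longleftrightarrow>
     W \<subseteq> carrier_vec n \<and> 0\<^sub>v n \<in> W \<and> (\<forall>x\<in>W. \<forall>y\<in>W. x + y \<in> W) \<and> (\<forall>c. \<forall>x\<in>W. c \<cdot>\<^sub>v x \<in> W)"
    unfolding submodule_def using vec_module[of n, where 'a = complex]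
    by (auto simp: module_vec_simps class_ring_simps)
  then show ?thesis unfolding subspace_def using vec_vs[of n, where 'a = complex] by blast
qed

context quiver
begin

lemma stableD:
  assumes "stable Q d f D"
    and "\<forall>w\<in>verts Q. VectorSpace.subspace class_ring (W w) (module_vec TYPE(complex) (d w))"
    and "\<forall>w\<in>verts Q. \<forall>x\<in>carrier_vec (f w). ri D w *\<^sub>v x \<in> W w"
    and "\<forall>e\<in>arcs Q. \<forall>x\<in>W (tail Q e). rA D e *\<^sub>v x \<in> W (head Q e)"
    and "\<forall>e\<in>arcs Q. \<forall>x\<in>W (head Q e). rB D e *\<^sub>v x \<in> W (tail Q e)"
  shows "\<forall>w\<in>verts Q. W w = carrier_vec (d w)"
  using assms(1)[unfolded stable_def, THEN spec[of _ W]] assms(2-) by (elim mp) simp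

text \<open>
  The vectors killed by all linear forms that kill the covariants make up a subrepresentation
  containing the image of the framing.  By stability it is everything, so only the zero form kills
  all covariants.
\<close>

lemma stable_frame:
  assumes D: "D \<in> qreps Q d f" and st: "stable Q d f D"
  obtains p where "frame f d p" "\<forall>w\<in>verts Q. det (frame_mat d d p w D) \<noteq> 0"
proof -
  define ann where "ann w = {r \<in> carrier_vec (d w). \<forall>p. covariant f w p \<longrightarrow> r \<bullet> p D = 0}" for w
  define D' where "D' w = {x \<in> carrier_vec (d w). \<forall>r\<in>ann w. r \<bullet> x = 0}" for w
  have closed: "M *\<^sub>v x \<in> D' u"
    if c: "M \<in> carrier_mat (d u) (d w)" and x: "x \<in> D' w"
      and M: "\<And>p. covariant f w p \<Longrightarrow> covariant f u (\<lambda>D. N D *\<^sub>v p D)" "N D = M" for M N u w x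
  proof -
    have xc: "x \<in> carrier_vec (d w)" using x by (simp add: D'_def)
    have "r \<bullet> (M *\<^sub>v x) = 0" if r: "r \<in> ann u" for r
    proof -
      have rc: "r \<in> carrier_vec (d u)" using r by (simp add: ann_def)
      have "transpose_mat M *\<^sub>v r \<in> ann w"
        unfolding ann_def
      proof (intro CollectI conjI allI impI)
        show "transpose_mat M *\<^sub>v r \<in> carrier_vec (d w)" using c rc by auto
        fix p assume p: "covariant f w p"
        then have "r \<bullet> (M *\<^sub>v p D) = 0" using r M(1)[OF p] M(2) by (auto simp: ann_def)
        then show "(transpose_mat M *\<^sub>v r) \<bullet> p D = 0"
          using transpose_vec_mult_scalar[OF c covariant_carrier[OF p D] rc] by simp
      qed
      then show ?thesis using x transpose_vec_mult_scalar[OF c xc rc] by (simp add: D'_def)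
    qed
    then show ?thesis using c xc by (auto simp: D'_def)
  qed
  have full: "\<forall>w\<in>verts Q. D' w = carrier_vec (d w)"
  proof (rule stableD[OF st]; intro ballI)
      fix w assume w: "w \<in> verts Q"
      show "VectorSpace.subspace class_ring (D' w) (module_vec TYPE(complex) (d w))"
        unfolding subspace_vec_iff
        by (auto simp: D'_def ann_def scalar_prod_add_distrib[of _ "d w"])
      fix x :: "complex vec" assume x: "x \<in> carrier_vec (f w)"
      note c = ri_carrier[OF D w]
      have "r \<bullet> (ri D w *\<^sub>v x) = 0" if r: "r \<in> ann w" for r
      proof -
        have rc: "r \<in> carrier_vec (d w)" using r by (simp add: ann_def)
        have "transpose_mat (ri D w) *\<^sub>v r = 0\<^sub>v (f w)"
        proof (rule eq_vecI)
          fix k assume k: "k < dim_vec (0\<^sub>v (f w) :: complex vec)"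
          then have "covariant f w (\<lambda>D. col (ri D w) k)" using w by (intro framing) auto
          then have "r \<bullet> col (ri D w) k = 0" using r by (auto simp: ann_def)
          then show "(transpose_mat (ri D w) *\<^sub>v r) $ k = 0\<^sub>v (f w) $ k"
            using k c rc by (simp add: comm_scalar_prod[of r "d w"])
        qed (use c in simp)
        then show ?thesis using transpose_vec_mult_scalar[OF c x rc] x c by simp
      qed
      then show "ri D w *\<^sub>v x \<in> D' w" using c x by (auto simp: D'_def)
    next
      fix e x assume e: "e \<in> arcs Q" and x: "x \<in> D' (tail Q e)"
      show "rA D e *\<^sub>v x \<in> D' (head Q e)"
        by (rule closed[where N = "\<lambda>D. rA D e", OF rA_carrier[OF D e] x forward[OF e] refl])
    next
      fix e x assume e: "e \<in> arcs Q" and x: "x \<in> D' (head Q e)"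
      show "rB D e *\<^sub>v x \<in> D' (tail Q e)"
        by (rule closed[where N = "\<lambda>D. rB D e", OF rB_carrier[OF D e] x backward[OF e] refl])
  qed
  have "\<exists>q. (\<forall>k<d w. q k \<in> {p. covariant f w p}) \<and> det (mat (d w) (d w) (\<lambda>(i, k). q k D $ i)) \<noteq> 0"
    if w: "w \<in> verts Q" for w
  proof -
    have "\<exists>p. (\<forall>k<d w. p k \<in> {p D |p. covariant f w p}) \<and> det (mat (d w) (d w) (\<lambda>(i, j). p j $ i)) \<noteq> 0"
    proof (rule exists_det_nonzero_columns)
      show "{p D |p. covariant f w p} \<subseteq> carrier_vec (d w)" using covariant_carrier[OF _ D] by auto
      fix r assume r: "r \<in> carrier_vec (d w)" "\<And>s. s \<in> {p D |p. covariant f w p} \<Longrightarrow> r \<bullet> s = 0"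
      then have "r \<in> ann w" by (auto simp: ann_def)
      then have rx: "r \<bullet> x = 0" if "x \<in> carrier_vec (d w)" for x
        using that full w by (auto simp: D'_def)
      have "r $ i = 0" if "i < d w" for i
        using rx[OF unit_vec_carrier, of i] unfolding scalar_prod_right_unit[OF that] .
      then show "r = 0\<^sub>v (d w)" using r(1) by (intro eq_vecI) auto
    qed
    then obtain s where s: "\<forall>k<d w. \<exists>p. s k = p D \<and> covariant f w p"
      "det (mat (d w) (d w) (\<lambda>(i, j). s j $ i)) \<noteq> 0" by auto
    then obtain q where q: "\<forall>k<d w. s k = q k D \<and> covariant f w (q k)" by metis
    have "mat (d w) (d w) (\<lambda>(i, j). s j $ i) = mat (d w) (d w) (\<lambda>(i, k). q k D $ i)"
      using q by (intro eq_matI) auto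
    then show ?thesis using q s(2) by (intro exI[of _ q]) auto
  qed
  then obtain q where q: "\<And>w. w \<in> verts Q \<Longrightarrow> (\<forall>k<d w. q w k \<in> {p. covariant f w p}) \<and>
      det (mat (d w) (d w) (\<lambda>(i, k). q w k D $ i)) \<noteq> 0" by metis
  show thesis
    by (rule that[of q]) (use q in \<open>auto simp: frame_def frame_mat_def\<close>)
qed

text \<open>
  Both maps send a basis of covariants of \<open>D\<close> to the same covariants of \<open>D'\<close>.
\<close>

lemma map_unique:
  assumes D: "D \<in> qreps Q d f" "stable Q d f D" and D': "D' \<in> qreps Q d' f"
    and \<pi>: "\<pi> \<in> qrep_maps Q d d' D D'" and \<rho>: "\<rho> \<in> qrep_maps Q d d' D D'"
  shows "\<pi> = \<rho>"
proof -
  obtain p where p: "frame f d p" "\<forall>w\<in>verts Q. det (frame_mat d d p w D) \<noteq> 0"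
    using stable_frame[OF D] by blast
  show ?thesis
  proof (rule map_ext[OF \<pi> \<rho>])
    fix w assume w: "w \<in> verts Q"
    have "\<pi> w * frame_mat d d p w D = \<rho> w * frame_mat d d p w D"
      using frame_mat_map[OF p(1) w D(1) D'] \<pi> \<rho> by simp
    then show "\<pi> w = \<rho> w"
      using mat_right_cancel[OF map_carrier[OF \<pi> w] map_carrier[OF \<rho> w] frame_mat_carrier[of d d p w D]] p(2) w
      by blast
  qed
qed

text \<open>
  The covariants that form a basis of \<open>D'\<close> are images of covariants of \<open>D\<close>.
\<close>

lemma map_surjective:
  assumes D: "D \<in> qreps Q d f" and D': "D' \<in> qreps Q d' f" "stable Q d' f D'"
    and \<pi>: "\<pi> \<in> qrep_maps Q d d' D D'"
  shows "surjective_map Q d d' \<pi>"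
  unfolding surjective_map_def
proof
  fix w assume w: "w \<in> verts Q"
  obtain p where p: "frame f d' p" "\<forall>w\<in>verts Q. det (frame_mat d' d' p w D') \<noteq> 0"
    using stable_frame[OF D'] by blast
  let ?P = "frame_mat d' d' p w D'" and ?S = "frame_mat d d' p w D"
  have det: "det ?P \<noteq> 0" using p(2) w by simp
  note inv = mat_inv_carrier[OF frame_mat_carrier det] mat_inv_right[OF frame_mat_carrier det]
  have "\<pi> w * (?S * mat_inv ?P) = (\<pi> w * ?S) * mat_inv ?P"
    by (rule assoc_mult_mat[OF map_carrier[OF \<pi> w] frame_mat_carrier[of d d' p w D] inv(1), symmetric])
  also have "\<dots> = 1\<^sub>m (d' w)"
    unfolding frame_mat_map[OF p(1) w D D'(1) \<pi>] by (rule inv(2))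
  finally show "(\<lambda>x. \<pi> w *\<^sub>v x) ` carrier_vec (d w) = carrier_vec (d' w)"
    by (intro mat_surjI[OF map_carrier[OF \<pi> w] mult_carrier_mat[OF frame_mat_carrier[of d d' p w D] inv(1)]])
qed


section \<open>Invariance of stability and of the moment map equations\<close>

text \<open>
  Invariant subspaces of \<open>D'\<close> are pulled back to invariant subspaces of \<open>D\<close>.
\<close>

lemma stable_iso:
  assumes D: "D \<in> qreps Q d f" "stable Q d f D" and D': "D' \<in> qreps Q d f" and "qrep_iso d D D'"
  shows "stable Q d f D'"
  unfolding stable_def
proof (intro allI impI; elim conjE)
  fix W :: "'v \<Rightarrow> complex vec set"
  assume W: "\<forall>w\<in>verts Q. VectorSpace.subspace class_ring (W w) (module_vec TYPE(complex) (d w))"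
    and Wi: "\<forall>w\<in>verts Q. \<forall>x\<in>carrier_vec (f w). ri D' w *\<^sub>v x \<in> W w"
    and WA: "\<forall>e\<in>arcs Q. \<forall>x\<in>W (tail Q e). rA D' e *\<^sub>v x \<in> W (head Q e)"
    and WB: "\<forall>e\<in>arcs Q. \<forall>x\<in>W (head Q e). rB D' e *\<^sub>v x \<in> W (tail Q e)"
  obtain g where g: "g \<in> qrep_maps Q d d D D'" "\<And>w. w \<in> verts Q \<Longrightarrow> det (g w) \<noteq> 0"
    using assms(4) unfolding qrep_iso_def by blast
  define W' where "W' w = {x \<in> carrier_vec (d w). g w *\<^sub>v x \<in> W w}" for w
  have "\<forall>w\<in>verts Q. W' w = carrier_vec (d w)"
  proof (rule stableD[OF D(2)]; intro ballI)
    fix w assume w: "w \<in> verts Q"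
    note c = map_carrier[OF g(1) w]
    show "VectorSpace.subspace class_ring (W' w) (module_vec TYPE(complex) (d w))"
      using W[rule_format, OF w] mult_mat_zero_vec[OF c] unfolding subspace_vec_iff W'_def
      using c by (auto simp: mult_add_distrib_mat_vec[OF c] mult_mat_vec[OF c])
    fix x :: "complex vec" assume x: "x \<in> carrier_vec (f w)"
    have "g w *\<^sub>v (ri D w *\<^sub>v x) = ri D' w *\<^sub>v x"
      using assoc_mult_mat_vec[OF c ri_carrier[OF D(1) w] x] map_ri[OF g(1) w] by simp
    then show "ri D w *\<^sub>v x \<in> W' w"
      using Wi w x mult_mat_vec_carrier[OF ri_carrier[OF D(1) w] x] by (simp add: W'_def)
  next
    fix e x assume e: "e \<in> arcs Q" and x: "x \<in> W' (tail Q e)"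
    have xc: "x \<in> carrier_vec (d (tail Q e))" using x by (simp add: W'_def)
    note ct = map_carrier[OF g(1) tail_verts[OF e]] and ch = map_carrier[OF g(1) head_verts[OF e]]
    have "g (head Q e) *\<^sub>v (rA D e *\<^sub>v x) = rA D' e *\<^sub>v (g (tail Q e) *\<^sub>v x)"
      by (rule mat_intertwine_vec[OF rA_carrier[OF D(1) e] rA_carrier[OF D' e] ch ct xc map_rA[OF g(1) e]])
    then show "rA D e *\<^sub>v x \<in> W' (head Q e)"
      using WA e x mult_mat_vec_carrier[OF rA_carrier[OF D(1) e] xc] by (simp add: W'_def)
  next
    fix e x assume e: "e \<in> arcs Q" and x: "x \<in> W' (head Q e)"
    have xc: "x \<in> carrier_vec (d (head Q e))" using x by (simp add: W'_def)
    note ct = map_carrier[OF g(1) tail_verts[OF e]] and ch = map_carrier[OF g(1) head_verts[OF e]]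
    have "g (tail Q e) *\<^sub>v (rB D e *\<^sub>v x) = rB D' e *\<^sub>v (g (head Q e) *\<^sub>v x)"
      by (rule mat_intertwine_vec[OF rB_carrier[OF D(1) e] rB_carrier[OF D' e] ct ch xc map_rB[OF g(1) e]])
    then show "rB D e *\<^sub>v x \<in> W' (tail Q e)"
      using WB e x mult_mat_vec_carrier[OF rB_carrier[OF D(1) e] xc] by (simp add: W'_def)
  qed
  show "\<forall>w\<in>verts Q. W w = carrier_vec (d w)"
  proof
    fix w assume w: "w \<in> verts Q"
    note c = map_carrier[OF g(1) w]
    note inv = mat_inv_carrier[OF c g(2)[OF w]] mat_inv_right[OF c g(2)[OF w]]
    have "y \<in> W w" if y: "y \<in> carrier_vec (d w)" for y
    proof -
      have "mat_inv (g w) *\<^sub>v y \<in> W' w"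
        using \<open>\<forall>w\<in>verts Q. W' w = carrier_vec (d w)\<close> w inv(1) y by auto
      moreover have "g w *\<^sub>v (mat_inv (g w) *\<^sub>v y) = y"
        using assoc_mult_mat_vec[OF c inv(1) y] inv(2) y by simp
      ultimately show ?thesis by (simp add: W'_def)
    qed
    then show "W w = carrier_vec (d w)" using W w unfolding subspace_vec_iff by blast
  qed
qed

definition moment :: "('v \<Rightarrow> nat) \<Rightarrow> ('v, 'e) qrep \<Rightarrow> 'v \<Rightarrow> complex mat" where
  "moment d D w = mat (d w) (d w) (\<lambda>(a, b).
     (\<Sum>e\<in>in_arcs Q w. (rA D e * rB D e) $$ (a, b))
     - (\<Sum>e\<in>out_arcs Q w. (rB D e * rA D e) $$ (a, b))
     + (ri D w * rj D w) $$ (a, b))"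

lemma moment_eq_iff: "moment_eq Q d D \<longleftrightarrow> (\<forall>w\<in>verts Q. moment d D w = 0\<^sub>m (d w) (d w))"
proof -
  have "moment d D w = 0\<^sub>m (d w) (d w) \<longleftrightarrow> (\<forall>a<d w. \<forall>b<d w. moment d D w $$ (a, b) = 0)" for w
    by (auto simp: mat_eq_iff moment_def)
  then show ?thesis unfolding moment_eq_def by (simp add: moment_def)
qed

end

lemma
  fixes g Z :: "complex mat"
  assumes g: "g \<in> carrier_mat n n" and X: "\<And>e. e \<in> I \<Longrightarrow> X e \<in> carrier_mat n n"
    and Y: "\<And>e. e \<in> J \<Longrightarrow> Y e \<in> carrier_mat n n" and Z: "Z \<in> carrier_mat n n" and ab: "a < n" "b < n"
  defines "M \<equiv> mat n n (\<lambda>(a, b). (\<Sum>e\<in>I. X e $$ (a, b)) - (\<Sum>e\<in>J. Y e $$ (a, b)) + Z $$ (a, b))"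
  shows mult_mat_sum_left:
      "(g * M) $$ (a, b) = (\<Sum>e\<in>I. (g * X e) $$ (a, b)) - (\<Sum>e\<in>J. (g * Y e) $$ (a, b)) + (g * Z) $$ (a, b)"
    and mult_mat_sum_right:
      "(M * g) $$ (a, b) = (\<Sum>e\<in>I. (X e * g) $$ (a, b)) - (\<Sum>e\<in>J. (Y e * g) $$ (a, b)) + (Z * g) $$ (a, b)"
proof -
  have entry: "(A * B) $$ (a, b) = (\<Sum>c<n. A $$ (a, c) * B $$ (c, b))"
    if "A \<in> carrier_mat n n" "B \<in> carrier_mat n n" for A B :: "complex mat"
    using that ab by (simp add: scalar_prod_def atLeast0LessThan)
  have M: "M \<in> carrier_mat n n" by (simp add: M_def)
  have "(g * M) $$ (a, b) = (\<Sum>c<n. g $$ (a, c) * ((\<Sum>e\<in>I. X e $$ (c, b)) - (\<Sum>e\<in>J. Y e $$ (c, b)) + Z $$ (c, b)))"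
    unfolding entry[OF g M] using ab by (simp add: M_def)
  also have "\<dots> = (\<Sum>e\<in>I. \<Sum>c<n. g $$ (a, c) * X e $$ (c, b)) - (\<Sum>e\<in>J. \<Sum>c<n. g $$ (a, c) * Y e $$ (c, b))
      + (\<Sum>c<n. g $$ (a, c) * Z $$ (c, b))"
    by (simp add: ring_distribs sum.distrib sum_subtractf sum_distrib_left sum.swap[of _ "{..<n}"])
  finally show "(g * M) $$ (a, b) = (\<Sum>e\<in>I. (g * X e) $$ (a, b)) - (\<Sum>e\<in>J. (g * Y e) $$ (a, b)) + (g * Z) $$ (a, b)"
    using entry[OF g X] entry[OF g Y] entry[OF g Z] by simp
  have "(M * g) $$ (a, b) = (\<Sum>c<n. ((\<Sum>e\<in>I. X e $$ (a, c)) - (\<Sum>e\<in>J. Y e $$ (a, c)) + Z $$ (a, c)) * g $$ (c, b))"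
    unfolding entry[OF M g] using ab by (simp add: M_def)
  also have "\<dots> = (\<Sum>e\<in>I. \<Sum>c<n. X e $$ (a, c) * g $$ (c, b)) - (\<Sum>e\<in>J. \<Sum>c<n. Y e $$ (a, c) * g $$ (c, b))
      + (\<Sum>c<n. Z $$ (a, c) * g $$ (c, b))"
    by (simp add: ring_distribs sum.distrib sum_subtractf sum_distrib_right sum.swap[of _ "{..<n}"])
  finally show "(M * g) $$ (a, b) = (\<Sum>e\<in>I. (X e * g) $$ (a, b)) - (\<Sum>e\<in>J. (Y e * g) $$ (a, b)) + (Z * g) $$ (a, b)"
    using entry[OF X g] entry[OF Y g] entry[OF Z g] by simp
qed

context quiver
begin

text \<open>
  Equivariance of the moment map, in a form without inverses.
\<close>

lemma moment_map:
  assumes D: "D \<in> qreps Q d f" and D': "D' \<in> qreps Q d f"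
    and g: "g \<in> qrep_maps Q d d D D'" and w: "w \<in> verts Q"
  shows "g w * moment d D w = moment d D' w * g w"
proof (rule eq_matI)
  have gc: "g u \<in> carrier_mat (d u) (d u)" if "u \<in> verts Q" for u using map_carrier[OF g that] .
  have AB: "rA E e * rB E e \<in> carrier_mat (d w) (d w)" if "E \<in> qreps Q d f" "e \<in> in_arcs Q w" for E e
    using mult_carrier_mat[OF rA_carrier[OF that(1), of e] rB_carrier[OF that(1), of e]] that(2) by auto
  have BA: "rB E e * rA E e \<in> carrier_mat (d w) (d w)" if "E \<in> qreps Q d f" "e \<in> out_arcs Q w" for E e
    using mult_carrier_mat[OF rB_carrier[OF that(1), of e] rA_carrier[OF that(1), of e]] that(2) by auto
  have ij: "ri E w * rj E w \<in> carrier_mat (d w) (d w)" if "E \<in> qreps Q d f" for E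
    using mult_carrier_mat[OF ri_carrier[OF that w] rj_carrier[OF that w]] .
  have gAB: "g w * (rA D e * rB D e) = rA D' e * rB D' e * g w" if "e \<in> in_arcs Q w" for e
  proof -
    have e: "e \<in> arcs Q" "head Q e = w" using that by auto
    show ?thesis
      using mat_intertwine_mult[OF rA_carrier[OF D e(1)] rA_carrier[OF D' e(1)] rB_carrier[OF D e(1)] rB_carrier[OF D' e(1)]
          gc[OF head_verts] gc[OF tail_verts] gc[OF head_verts] map_rA[OF g e(1)] map_rB[OF g e(1)]] e by simp
  qed
  have gBA: "g w * (rB D e * rA D e) = rB D' e * rA D' e * g w" if "e \<in> out_arcs Q w" for e
  proof -
    have e: "e \<in> arcs Q" "tail Q e = w" using that by auto
    show ?thesis
      using mat_intertwine_mult[OF rB_carrier[OF D e(1)] rB_carrier[OF D' e(1)] rA_carrier[OF D e(1)] rA_carrier[OF D' e(1)]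
          gc[OF tail_verts] gc[OF head_verts] gc[OF tail_verts] map_rB[OF g e(1)] map_rA[OF g e(1)]] e by simp
  qed
  have gij: "g w * (ri D w * rj D w) = ri D' w * rj D' w * g w"
    by (rule mat_intertwine_mult[OF ri_carrier[OF D w] ri_carrier[OF D' w] rj_carrier[OF D w] rj_carrier[OF D' w]
          gc[OF w] one_carrier_mat gc[OF w]])
      (use map_ri[OF g w] map_rj[OF g w] ri_carrier[OF D' w] rj_carrier[OF D w] in auto)
  fix a b assume "a < dim_row (moment d D' w * g w)" "b < dim_col (moment d D' w * g w)"
  then have ab: "a < d w" "b < d w" using gc[OF w] by (auto simp: moment_def)
  have "(g w * moment d D w) $$ (a, b) = (\<Sum>e\<in>in_arcs Q w. (g w * (rA D e * rB D e)) $$ (a, b))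
      - (\<Sum>e\<in>out_arcs Q w. (g w * (rB D e * rA D e)) $$ (a, b)) + (g w * (ri D w * rj D w)) $$ (a, b)"
    unfolding moment_def by (rule mult_mat_sum_left[OF gc[OF w] AB[OF D] BA[OF D] ij[OF D] ab])
  also have "\<dots> = (\<Sum>e\<in>in_arcs Q w. (rA D' e * rB D' e * g w) $$ (a, b))
      - (\<Sum>e\<in>out_arcs Q w. (rB D' e * rA D' e * g w) $$ (a, b)) + (ri D' w * rj D' w * g w) $$ (a, b)"
    using gAB gBA gij by simp
  also have "\<dots> = (moment d D' w * g w) $$ (a, b)"
    unfolding moment_def by (rule mult_mat_sum_right[OF gc[OF w] AB[OF D'] BA[OF D'] ij[OF D'] ab, symmetric])
  finally show "(g w * moment d D w) $$ (a, b) = (moment d D' w * g w) $$ (a, b)" .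
qed (use map_carrier[OF g w] in \<open>auto simp: moment_def\<close>)

lemma moment_iso:
  assumes D: "D \<in> qreps Q d f" "moment_eq Q d D" and D': "D' \<in> qreps Q d f" and "qrep_iso d D D'"
  shows "moment_eq Q d D'"
  unfolding moment_eq_iff
proof
  fix w assume w: "w \<in> verts Q"
  obtain g where g: "g \<in> qrep_maps Q d d D D'" "\<And>w. w \<in> verts Q \<Longrightarrow> det (g w) \<noteq> 0"
    using assms(4) unfolding qrep_iso_def by blast
  note gc = map_carrier[OF g(1) w]
  have m: "moment d D' w \<in> carrier_mat (d w) (d w)" by (simp add: moment_def)
  have "moment d D' w * g w = g w * moment d D w" by (rule moment_map[OF D(1) D' g(1) w, symmetric])
  also have "moment d D w = 0\<^sub>m (d w) (d w)" using D(2) w unfolding moment_eq_iff by blast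
  also have "g w * 0\<^sub>m (d w) (d w) = 0\<^sub>m (d w) (d w) * g w" using gc by simp
  finally show "moment d D' w = 0\<^sub>m (d w) (d w)"
    by (rule mat_right_cancel[OF m zero_carrier_mat gc g(2)[OF w]])
qed

lemma nak_reps_iso:
  "D \<in> nak_reps Q d f \<Longrightarrow> D' \<in> qreps Q d f \<Longrightarrow> qrep_iso d D D' \<Longrightarrow> D' \<in> nak_reps Q d f"
  unfolding nak_reps_def using moment_iso stable_iso by blast

end


section \<open>Shifting the loops by scalars\<close>

locale quiver_vertex = quiver Q for Q :: "('v, 'e) pre_digraph" +
  fixes v :: 'v
  assumes v: "v \<in> verts Q"
begin

abbreviation loops :: "'e set" where
  "loops \<equiv> arcs_between Q v v"

text \<open>
  The size of the scalar matrix is read off from \<open>M\<close>, so that the same shift applies to both ends of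
  a map.
\<close>

definition shift_arrow :: "'e \<Rightarrow> complex \<Rightarrow> complex mat \<Rightarrow> complex mat" where
  "shift_arrow e c M = (if e \<in> loops then M + c \<cdot>\<^sub>m 1\<^sub>m (dim_row M) else M)"

definition shift :: "('e \<Rightarrow> complex) \<Rightarrow> ('e \<Rightarrow> complex) \<Rightarrow> ('v, 'e) qrep \<Rightarrow> ('v, 'e) qrep" where
  "shift a b D = D\<lparr>rA := (\<lambda>e\<in>arcs Q. shift_arrow e (a e) (rA D e)),
                   rB := (\<lambda>e\<in>arcs Q. shift_arrow e (b e) (rB D e))\<rparr>"

lemma shift_simps [simp]:
  "e \<in> arcs Q \<Longrightarrow> rA (shift a b D) e = shift_arrow e (a e) (rA D e)"
  "e \<in> arcs Q \<Longrightarrow> rB (shift a b D) e = shift_arrow e (b e) (rB D e)"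
  "ri (shift a b D) = ri D" "rj (shift a b D) = rj D"
  by (simp_all add: shift_def)

lemma loopsD: "e \<in> loops \<Longrightarrow> e \<in> arcs Q \<and> head Q e = v \<and> tail Q e = v"
  by (simp add: arcs_between_def)

lemma shift_arrow_carrier: "M \<in> carrier_mat m n \<Longrightarrow> (e \<in> loops \<Longrightarrow> m = n) \<Longrightarrow> shift_arrow e c M \<in> carrier_mat m n"
  by (auto simp: shift_arrow_def)

lemma shift_qreps:
  assumes D: "D \<in> qreps Q d f"
  shows "shift a b D \<in> qreps Q d f"
proof -
  have "shift_arrow e (a e) (rA D e) \<in> carrier_mat (d (head Q e)) (d (tail Q e))"
    "shift_arrow e (b e) (rB D e) \<in> carrier_mat (d (tail Q e)) (d (head Q e))" if "e \<in> arcs Q" for e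
    using shift_arrow_carrier[OF rA_carrier[OF D that]] shift_arrow_carrier[OF rB_carrier[OF D that]] loopsD by auto
  then show ?thesis using D unfolding qreps_def by (simp add: shift_def)
qed

lemma shift_arrow_shift_arrow: "shift_arrow e c (shift_arrow e c' M) = shift_arrow e (c + c') M"
  if "e \<in> loops \<Longrightarrow> M \<in> carrier_mat n n"
  using that by (auto simp: shift_arrow_def algebra_simps intro!: eq_matI)

lemma shift_arrow_0: "shift_arrow e 0 M = M"
  if "e \<in> loops \<Longrightarrow> M \<in> carrier_mat n n"
  using that by (auto simp: shift_arrow_def intro!: eq_matI)

lemma loop_carrier:
  assumes "D \<in> qreps Q d f" "e \<in> loops"
  shows "rA D e \<in> carrier_mat (d v) (d v)" "rB D e \<in> carrier_mat (d v) (d v)"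
  using rA_carrier[OF assms(1), of e] rB_carrier[OF assms(1), of e] loopsD[OF assms(2)] by auto

lemma shift_shift:
  assumes D: "D \<in> qreps Q d f"
  shows "shift a b (shift a' b' D) = shift (\<lambda>e. a e + a' e) (\<lambda>e. b e + b' e) D"
  by (rule qrep_eqI[OF shift_qreps[OF shift_qreps[OF D]] shift_qreps[OF D]])
    (use loop_carrier[OF D] in \<open>auto intro: shift_arrow_shift_arrow\<close>)

lemma shift_zero:
  assumes D: "D \<in> qreps Q d f"
  shows "shift (\<lambda>_. 0) (\<lambda>_. 0) D = D"
  by (rule qrep_eqI[OF shift_qreps[OF D] D])
    (use loop_carrier[OF D] in \<open>auto intro: shift_arrow_0\<close>)

lemma shift_cong:
  assumes "\<And>e. e \<in> loops \<Longrightarrow> a e = a' e" "\<And>e. e \<in> loops \<Longrightarrow> b e = b' e"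
  shows "shift a b D = shift a' b' D"
  using assms unfolding shift_def shift_arrow_def by (auto intro!: qrep.equality restrict_ext)

lemma mult_shift_arrow:
  assumes "M \<in> carrier_mat n n" "N \<in> carrier_mat m n" "e \<in> loops"
  shows "N * shift_arrow e c M = N * M + c \<cdot>\<^sub>m N"
  using assms by (simp add: shift_arrow_def mult_add_distrib_mat[OF assms(2,1)] mult_smult_distrib[OF assms(2) one_carrier_mat]
      right_mult_one_mat[OF assms(2)])

lemma shift_arrow_mult:
  assumes "M \<in> carrier_mat n n" "N \<in> carrier_mat n m" "e \<in> loops"
  shows "shift_arrow e c M * N = M * N + c \<cdot>\<^sub>m N"
  using assms by (simp add: shift_arrow_def add_mult_distrib_mat[OF assms(1) _ assms(2)]
      mult_smult_assoc_mat[OF one_carrier_mat assms(2)] left_mult_one_mat[OF assms(2)])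

lemma shift_arrow_mult_vec:
  assumes "M \<in> carrier_mat n n" "x \<in> carrier_vec n" "e \<in> loops"
  shows "shift_arrow e c M *\<^sub>v x = M *\<^sub>v x + c \<cdot>\<^sub>v x"
proof (rule eq_vecI)
  fix i assume i: "i < dim_vec (M *\<^sub>v x + c \<cdot>\<^sub>v x)"
  then have "(c \<cdot>\<^sub>v unit_vec n i) \<bullet> x = c * x $ i"
    using assms by simp
  then show "(shift_arrow e c M *\<^sub>v x) $ i = (M *\<^sub>v x + c \<cdot>\<^sub>v x) $ i"
    using i assms by (simp add: shift_arrow_def add_scalar_prod_distrib[of _ n])
qed (use assms in \<open>auto simp: shift_arrow_def\<close>)

lemma shift_map:
  assumes D: "D \<in> qreps Q d f" and D': "D' \<in> qreps Q d' f" and \<pi>: "\<pi> \<in> qrep_maps Q d d' D D'"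
  shows "\<pi> \<in> qrep_maps Q d d' (shift a b D) (shift a b D')"
proof -
  have *: "\<pi> u * shift_arrow e c M = shift_arrow e c M' * \<pi> w"
    if "\<pi> u * M = M' * \<pi> w"
      and "e \<in> loops \<Longrightarrow> u = v \<and> w = v \<and> M \<in> carrier_mat (d v) (d v) \<and> M' \<in> carrier_mat (d' v) (d' v)" for u w e c M M'
  proof (cases "e \<in> loops")
    case True
    then show ?thesis
      using mult_shift_arrow[OF _ map_carrier[OF \<pi> v] True, of M c] shift_arrow_mult[OF _ map_carrier[OF \<pi> v] True, of M' c] that
      by simp
  qed (simp add: shift_arrow_def that)
  have "\<pi> (head Q e) * shift_arrow e c (rA D e) = shift_arrow e c (rA D' e) * \<pi> (tail Q e)"
    and "\<pi> (tail Q e) * shift_arrow e c (rB D e) = shift_arrow e c (rB D' e) * \<pi> (head Q e)" if e: "e \<in> arcs Q" for e c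
    using *[OF map_rA[OF \<pi> e]] *[OF map_rB[OF \<pi> e]] loopsD loop_carrier[OF D] loop_carrier[OF D'] by auto
  then show ?thesis using \<pi> unfolding qrep_maps_def by simp
qed

lemma shift_iso:
  assumes "D \<in> qreps Q d f" "D' \<in> qreps Q d f" "qrep_iso d D D'"
  shows "qrep_iso d (shift a b D) (shift a b D')"
  using assms(3) shift_map[OF assms(1,2)] unfolding qrep_iso_def by blast

text \<open>
  A subspace is preserved by a matrix if and only if it is preserved after adding a scalar.
\<close>

lemma shift_stable:
  assumes D: "D \<in> qreps Q d f" and st: "stable Q d f D"
  shows "stable Q d f (shift a b D)"
  unfolding stable_def
proof (intro allI impI; elim conjE)
  fix W :: "'v \<Rightarrow> complex vec set"
  assume W: "\<forall>w\<in>verts Q. VectorSpace.subspace class_ring (W w) (module_vec TYPE(complex) (d w))"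
    and Wi: "\<forall>w\<in>verts Q. \<forall>x\<in>carrier_vec (f w). ri (shift a b D) w *\<^sub>v x \<in> W w"
    and WA: "\<forall>e\<in>arcs Q. \<forall>x\<in>W (tail Q e). rA (shift a b D) e *\<^sub>v x \<in> W (head Q e)"
    and WB: "\<forall>e\<in>arcs Q. \<forall>x\<in>W (head Q e). rB (shift a b D) e *\<^sub>v x \<in> W (tail Q e)"
  have unshift: "M *\<^sub>v x \<in> W u"
    if cl: "shift_arrow e c M *\<^sub>v x \<in> W u" and x: "x \<in> W w"
      and e: "e \<in> loops \<Longrightarrow> u = v \<and> w = v \<and> M \<in> carrier_mat (d v) (d v)" for M x e c u w
  proof (cases "e \<in> loops")
    case True
    note e' = e[OF True]
    have xc: "x \<in> carrier_vec (d v)" using x e' W v unfolding subspace_vec_iff by blast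
    have "M *\<^sub>v x = shift_arrow e c M *\<^sub>v x + (- c) \<cdot>\<^sub>v x"
      unfolding shift_arrow_mult_vec[OF conjunct2[OF conjunct2[OF e']] xc True] using e' xc by (intro eq_vecI) auto
    then show ?thesis using W v x cl e' unfolding subspace_vec_iff by simp
  next
    case False
    then show ?thesis using cl by (simp add: shift_arrow_def)
  qed
  show "\<forall>w\<in>verts Q. W w = carrier_vec (d w)"
  proof (rule stableD[OF st W]; intro ballI)
    show "ri D w *\<^sub>v x \<in> W w" if "w \<in> verts Q" "x \<in> carrier_vec (f w)" for w x using Wi that by simp
    show "rA D e *\<^sub>v x \<in> W (head Q e)" if e: "e \<in> arcs Q" and x: "x \<in> W (tail Q e)" for e x
      by (rule unshift[of e "a e", OF _ x]) (use WA e x loopsD loop_carrier[OF D] in auto)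
    show "rB D e *\<^sub>v x \<in> W (tail Q e)" if e: "e \<in> arcs Q" and x: "x \<in> W (head Q e)" for e x
      by (rule unshift[of e "b e", OF _ x]) (use WB e x loopsD loop_carrier[OF D] in auto)
  qed
qed

lemma shift_moment:
  assumes D: "D \<in> qreps Q d f" and m: "moment_eq Q d D"
  shows "moment_eq Q d (shift a b D)"
  unfolding moment_eq_def
proof (intro ballI allI impI)
  fix w x y assume w: "w \<in> verts Q" and xy: "x < d w" "y < d w"
  let ?S = "shift a b D"
  \<comment> \<open>A shifted loop changes \<open>A B\<close> and \<open>B A\<close> by the same matrix.\<close>
  define t where "t e = (if e \<in> loops then b e * rA D e $$ (x, y) + a e * rB D e $$ (x, y)
      + a e * b e * (1\<^sub>m (d v) :: complex mat) $$ (x, y) else 0)" for e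
  have prod: "(shift_arrow e p M * shift_arrow e q N) $$ (x, y)
      = (M * N) $$ (x, y) + (q * M $$ (x, y) + p * N $$ (x, y) + p * q * (1\<^sub>m (d v) :: complex mat) $$ (x, y))"
    if e: "e \<in> loops" and M: "M \<in> carrier_mat (d v) (d v)" and N: "N \<in> carrier_mat (d v) (d v)" and "w = v" for e p q M N
  proof -
    have "shift_arrow e p M * shift_arrow e q N = M * N + p \<cdot>\<^sub>m N + q \<cdot>\<^sub>m shift_arrow e p M"
      using mult_shift_arrow[OF N shift_arrow_carrier[OF M refl] e] shift_arrow_mult[OF M N e] by simp
    then show ?thesis
      using xy M N e \<open>w = v\<close> by (simp add: shift_arrow_def algebra_simps del: index_mult_mat(1))
  qed
  have AB: "(rA ?S e * rB ?S e) $$ (x, y) = (rA D e * rB D e) $$ (x, y) + t e"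
    if "e \<in> in_arcs Q w" for e
  proof (cases "e \<in> loops")
    case True
    have "w = v" using that loopsD[OF True] by auto
    then show ?thesis
      using prod[OF True loop_carrier(1)[OF D True] loop_carrier(2)[OF D True], of "a e" "b e"] that True
      by (simp add: t_def ac_simps del: index_mult_mat(1))
  qed (use that in \<open>simp add: shift_arrow_def t_def\<close>)
  have BA: "(rB ?S e * rA ?S e) $$ (x, y) = (rB D e * rA D e) $$ (x, y) + t e"
    if "e \<in> out_arcs Q w" for e
  proof (cases "e \<in> loops")
    case True
    have "w = v" using that loopsD[OF True] by auto
    then show ?thesis
      using prod[OF True loop_carrier(2)[OF D True] loop_carrier(1)[OF D True], of "b e" "a e"] that True
      by (simp add: t_def ac_simps del: index_mult_mat(1))
  qed (use that in \<open>simp add: shift_arrow_def t_def\<close>)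
  have "sum t (in_arcs Q w) = sum t (in_arcs Q w \<inter> loops)"
    by (rule sum.mono_neutral_right) (auto simp: t_def)
  also have "in_arcs Q w \<inter> loops = out_arcs Q w \<inter> loops" by (auto simp: arcs_between_def)
  also have "sum t (out_arcs Q w \<inter> loops) = sum t (out_arcs Q w)"
    by (rule sum.mono_neutral_left) (auto simp: t_def)
  finally have "sum t (in_arcs Q w) = sum t (out_arcs Q w)" .
  moreover have "(\<Sum>e\<in>in_arcs Q w. (rA D e * rB D e) $$ (x, y)) - (\<Sum>e\<in>out_arcs Q w. (rB D e * rA D e) $$ (x, y))
     + (ri D w * rj D w) $$ (x, y) = 0"
    using m w xy unfolding moment_eq_def by blast
  ultimately show "(\<Sum>e\<in>in_arcs Q w. (rA ?S e * rB ?S e) $$ (x, y)) - (\<Sum>e\<in>out_arcs Q w. (rB ?S e * rA ?S e) $$ (x, y))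
     + (ri ?S w * rj ?S w) $$ (x, y) = 0"
    by (simp add: AB BA sum.distrib del: index_mult_mat(1) shift_simps(1,2))
qed

lemma shift_nak: "D \<in> nak_reps Q d f \<Longrightarrow> shift a b D \<in> nak_reps Q d f"
  unfolding nak_reps_def using shift_qreps shift_moment shift_stable by blast

end


section \<open>The kernel of a map and the defect of a loop\<close>

lemma mat_trace_shift:
  "M \<in> carrier_mat n n \<Longrightarrow> mat_trace (M + c \<cdot>\<^sub>m 1\<^sub>m n) = mat_trace M + of_nat n * c"
  by (simp add: mat_trace_def sum.distrib)

lemma mat_trace_conj:
  assumes A: "A \<in> carrier_mat n n" and A': "A' \<in> carrier_mat n n"
    and g: "g \<in> carrier_mat n n" "det g \<noteq> 0" and eq: "g * A = A' * g"
  shows "mat_trace A' = mat_trace A"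
proof -
  note inv = mat_inv_carrier[OF g] mat_inv_left[OF g] mat_inv_right[OF g]
  have "A' = A' * g * mat_inv g" using A' g inv by simp
  then have "mat_trace A' = mat_trace (g * A * mat_inv g)" unfolding eq by simp
  also have "\<dots> = mat_trace (mat_inv g * (g * A))"
    using A g inv by (intro mat_trace_mult_commute) auto
  also have "mat_inv g * (g * A) = A" using A g inv by (simp flip: assoc_mult_mat)
  finally show ?thesis .
qed

locale nakajima_pair = quiver_vertex Q v for Q :: "('v, 'e) pre_digraph" and v :: 'v +
  fixes d d' f :: "'v \<Rightarrow> nat"
  assumes dim_v: "d v = Suc (d' v)"
    and dim_other: "w \<in> verts Q \<Longrightarrow> w \<noteq> v \<Longrightarrow> d' w = d w"
begin

text \<open>
  For a pair related by a map, the defects are the scalars by which a loop acts on the kernel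
  (\<open>loop_on_kernel\<close>).  Being differences of traces, they are defined without reference to the map
  and are visibly regular and invariant.
\<close>

definition defect_A :: "('v, 'e) qrep \<Rightarrow> ('v, 'e) qrep \<Rightarrow> 'e \<Rightarrow> complex" where
  "defect_A D D' e = mat_trace (rA D e) - mat_trace (rA D' e)"

definition defect_B :: "('v, 'e) qrep \<Rightarrow> ('v, 'e) qrep \<Rightarrow> 'e \<Rightarrow> complex" where
  "defect_B D D' e = mat_trace (rB D e) - mat_trace (rB D' e)"

definition untwist :: "('v, 'e) qrep \<Rightarrow> ('v, 'e) qrep \<Rightarrow> ('v, 'e) qrep \<Rightarrow> ('v, 'e) qrep" where
  "untwist D D' = shift (\<lambda>e. - defect_A D D' e) (\<lambda>e. - defect_B D D' e)"

lemma nak_repsD: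
  assumes "D \<in> nak_reps Q c f"
  shows "D \<in> qreps Q c f" "stable Q c f D"
  using assms by (simp_all add: nak_reps_def)

context
  fixes D D' \<pi>
  assumes D: "D \<in> nak_reps Q d f" and D': "D' \<in> nak_reps Q d' f" and \<pi>: "\<pi> \<in> qrep_maps Q d d' D D'"
begin

lemma map_onto: "w \<in> verts Q \<Longrightarrow> (\<lambda>x. \<pi> w *\<^sub>v x) ` carrier_vec (d w) = carrier_vec (d' w)"
  using map_surjective[OF nak_repsD(1)[OF D] nak_repsD[OF D'] \<pi>] unfolding surjective_map_def by blast

lemma kernel_trivial:
  assumes "w \<in> verts Q" "w \<noteq> v" "x \<in> carrier_vec (d w)" "\<pi> w *\<^sub>v x = 0\<^sub>v (d' w)"
  shows "x = 0\<^sub>v (d w)"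
  using kernel_trivial_if_square_surj[of "\<pi> w" "d w" x] map_onto[OF assms(1)] map_carrier[OF \<pi> assms(1)] assms
  by (simp add: dim_other)

lemma loop_on_kernel:
  assumes e: "e \<in> loops" and x: "x \<in> carrier_vec (d v)" "\<pi> v *\<^sub>v x = 0\<^sub>v (d' v)"
  shows "rA D e *\<^sub>v x = defect_A D D' e \<cdot>\<^sub>v x" "rB D e *\<^sub>v x = defect_B D D' e \<cdot>\<^sub>v x"
proof -
  note D0 = nak_repsD(1)[OF D] and D0' = nak_repsD(1)[OF D']
  have "\<pi> v * rA D e = rA D' e * \<pi> v" "\<pi> v * rB D e = rB D' e * \<pi> v"
    using map_rA[OF \<pi>, of e] map_rB[OF \<pi>, of e] loopsD[OF e] by auto
  then show "rA D e *\<^sub>v x = defect_A D D' e \<cdot>\<^sub>v x" "rB D e *\<^sub>v x = defect_B D D' e \<cdot>\<^sub>v x"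
    unfolding defect_A_def defect_B_def
    using kernel_eigenvalue[OF map_carrier[OF \<pi> v] dim_v map_onto[OF v] _ _ _ x]
      loop_carrier[OF D0 e] loop_carrier[OF D0' e] by auto
qed

text \<open>
  An arrow that is not a loop at \<open>v\<close> has trivial kernel of \<open>\<pi>\<close> at one of its ends, \<open>j\<close> factors through
  \<open>\<pi>\<close>, and on the loops the scalar has been subtracted.
\<close>

lemma untwist_vanishes: "vanishes_on_kernel Q d f (untwist D D' D) \<pi>"
proof -
  note D0 = nak_repsD(1)[OF D] and D0' = nak_repsD(1)[OF D']
  have ker: "x \<in> carrier_vec (d w)" "\<pi> w *\<^sub>v x = 0\<^sub>v (d' w)" if "w \<in> verts Q" "x \<in> mat_kernel (\<pi> w)" for w x
    using that map_carrier[OF \<pi> that(1)] by (auto simp: mat_kernel_def)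
  have arrow: "M *\<^sub>v x = 0\<^sub>v (d u)"
    if "w \<in> verts Q" "u \<in> verts Q" "M \<in> carrier_mat (d u) (d w)" "M' \<in> carrier_mat (d' u) (d' w)"
      "\<pi> u * M = M' * \<pi> w" "x \<in> mat_kernel (\<pi> w)" "\<not> (w = v \<and> u = v)" for u w M M' x
  proof (cases "w = v")
    case False
    then have "x = 0\<^sub>v (d w)" using kernel_trivial[OF that(1) _ ker[OF that(1,6)]] by simp
    then show ?thesis using mult_mat_zero_vec[OF that(3)] by simp
  next
    case True
    then have u: "u \<noteq> v" using that by simp
    have "\<pi> u *\<^sub>v (M *\<^sub>v x) = M' *\<^sub>v (\<pi> w *\<^sub>v x)"
      using assoc_mult_mat_vec[OF map_carrier[OF \<pi> that(2)] that(3) ker(1)[OF that(1,6)]]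
        assoc_mult_mat_vec[OF that(4) map_carrier[OF \<pi> that(1)] ker(1)[OF that(1,6)]] that(5) by simp
    also have "\<dots> = 0\<^sub>v (d' u)" using ker(2)[OF that(1,6)] mult_mat_zero_vec[OF that(4)] by simp
    finally show ?thesis
      using kernel_trivial[OF that(2) u] mult_mat_vec_carrier[OF that(3) ker(1)[OF that(1,6)]] by simp
  qed
  have loop: "shift_arrow e (- c) M *\<^sub>v x = 0\<^sub>v (d v)"
    if "e \<in> loops" "M \<in> carrier_mat (d v) (d v)" "x \<in> carrier_vec (d v)" "M *\<^sub>v x = c \<cdot>\<^sub>v x" for e c M x
    unfolding shift_arrow_mult_vec[OF that(2,3,1)] that(4) using that(3) by (intro eq_vecI) auto
  show ?thesis
    unfolding vanishes_on_kernel_def untwist_def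
  proof (intro conjI ballI)
    fix e x assume e: "e \<in> arcs Q" and x: "x \<in> mat_kernel (\<pi> (tail Q e))"
    show "rA (shift (\<lambda>e. - defect_A D D' e) (\<lambda>e. - defect_B D D' e) D) e *\<^sub>v x = 0\<^sub>v (d (head Q e))"
    proof (cases "e \<in> loops")
      case True
      note l = loopsD[OF True]
      have k: "x \<in> carrier_vec (d v)" "\<pi> v *\<^sub>v x = 0\<^sub>v (d' v)" using ker[OF v, of x] x l by auto
      show ?thesis
        using loop[OF True loop_carrier(1)[OF D0 True] k(1) loop_on_kernel(1)[OF True k]] l by simp
    next
      case False
      then have "rA D e *\<^sub>v x = 0\<^sub>v (d (head Q e))"
        by (intro arrow[OF _ _ rA_carrier[OF D0 e] rA_carrier[OF D0' e] map_rA[OF \<pi> e] x])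
          (use e in \<open>auto simp: arcs_between_def\<close>)
      then show ?thesis using e False by (simp add: shift_arrow_def)
    qed
  next
    fix e x assume e: "e \<in> arcs Q" and x: "x \<in> mat_kernel (\<pi> (head Q e))"
    show "rB (shift (\<lambda>e. - defect_A D D' e) (\<lambda>e. - defect_B D D' e) D) e *\<^sub>v x = 0\<^sub>v (d (tail Q e))"
    proof (cases "e \<in> loops")
      case True
      note l = loopsD[OF True]
      have k: "x \<in> carrier_vec (d v)" "\<pi> v *\<^sub>v x = 0\<^sub>v (d' v)" using ker[OF v, of x] x l by auto
      show ?thesis
        using loop[OF True loop_carrier(2)[OF D0 True] k(1) loop_on_kernel(2)[OF True k]] l by simp
    next
      case False
      then have "rB D e *\<^sub>v x = 0\<^sub>v (d (tail Q e))"
        by (intro arrow[OF _ _ rB_carrier[OF D0 e] rB_carrier[OF D0' e] map_rB[OF \<pi> e] x])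
          (use e in \<open>auto simp: arcs_between_def\<close>)
      then show ?thesis using e False by (simp add: shift_arrow_def)
    qed
  next
    fix w x assume w: "w \<in> verts Q" and x: "x \<in> mat_kernel (\<pi> w)"
    note k = ker[OF w x]
    have "rj D w *\<^sub>v x = rj D' w *\<^sub>v (\<pi> w *\<^sub>v x)"
      using assoc_mult_mat_vec[OF rj_carrier[OF D0' w] map_carrier[OF \<pi> w] k(1)] map_rj[OF \<pi> w] by simp
    then show "rj (shift (\<lambda>e. - defect_A D D' e) (\<lambda>e. - defect_B D D' e) D) w *\<^sub>v x = 0\<^sub>v (f w)"
      using k(2) mult_mat_zero_vec[OF rj_carrier[OF D0' w]] by simp
  qed
qed

lemma untwist_split: "(untwist D D' D, untwist D D' D', \<pi>) \<in> split_triples Q d d' f"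
  using untwist_vanishes shift_nak[OF D] shift_nak[OF D'] shift_map[OF nak_repsD(1)[OF D] nak_repsD(1)[OF D'] \<pi>]
  by (simp add: split_triples_def untwist_def)

lemma defect_zero:
  assumes van: "vanishes_on_kernel Q d f D \<pi>" and e: "e \<in> loops"
  shows "defect_A D D' e = 0" "defect_B D D' e = 0"
proof -
  note D0 = nak_repsD(1)[OF D] and D0' = nak_repsD(1)[OF D'] and l = loopsD[OF e]
  have ker: "x \<in> mat_kernel (\<pi> v)" if "x \<in> carrier_vec (d v)" "\<pi> v *\<^sub>v x = 0\<^sub>v (d' v)" for x
    using that map_carrier[OF \<pi> v] by (auto simp: mat_kernel_def)
  have "\<pi> v * rA D e = rA D' e * \<pi> v" "\<pi> v * rB D e = rB D' e * \<pi> v"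
    using map_rA[OF \<pi>, of e] map_rB[OF \<pi>, of e] l by auto
  moreover have "rA D e *\<^sub>v x = 0\<^sub>v (d v)" "rB D e *\<^sub>v x = 0\<^sub>v (d v)"
    if "x \<in> carrier_vec (d v)" "\<pi> v *\<^sub>v x = 0\<^sub>v (d' v)" for x
    using van ker[OF that] l unfolding vanishes_on_kernel_def by force+
  ultimately show "defect_A D D' e = 0" "defect_B D D' e = 0"
    unfolding defect_A_def defect_B_def
    using trace_eq_if_vanishes_on_kernel[OF map_carrier[OF \<pi> v] map_onto[OF v]]
      loop_carrier[OF D0 e] loop_carrier[OF D0' e] by auto
qed

end

lemma defect_shift:
  assumes D: "D \<in> qreps Q d f" and D': "D' \<in> qreps Q d' f" and e: "e \<in> loops"
  shows "defect_A (shift a b D) (shift a b D') e = defect_A D D' e + a e"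
    "defect_B (shift a b D) (shift a b D') e = defect_B D D' e + b e"
  using loopsD[OF e] loop_carrier[OF D e] loop_carrier[OF D' e] e dim_v
  by (simp_all add: defect_A_def defect_B_def shift_arrow_def mat_trace_shift algebra_simps)

lemma trace_iso:
  assumes D: "D \<in> qreps Q c f" and E: "E \<in> qreps Q c f" and iso: "qrep_iso c D E" and e: "e \<in> loops"
  shows "mat_trace (rA E e) = mat_trace (rA D e)" "mat_trace (rB E e) = mat_trace (rB D e)"
proof -
  obtain g where g: "g \<in> qrep_maps Q c c D E" "\<And>w. w \<in> verts Q \<Longrightarrow> det (g w) \<noteq> 0"
    using iso unfolding qrep_iso_def by blast
  show "mat_trace (rA E e) = mat_trace (rA D e)" "mat_trace (rB E e) = mat_trace (rB D e)"
    using mat_trace_conj[OF loop_carrier(1)[OF D e] loop_carrier(1)[OF E e] map_carrier[OF g(1) v] g(2)[OF v]]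
      mat_trace_conj[OF loop_carrier(2)[OF D e] loop_carrier(2)[OF E e] map_carrier[OF g(1) v] g(2)[OF v]]
      map_rA[OF g(1), of e] map_rB[OF g(1), of e] loopsD[OF e] by auto
qed

lemma defect_iso:
  assumes "D \<in> qreps Q d f" "E \<in> qreps Q d f" "qrep_iso d D E"
    and "D' \<in> qreps Q d' f" "E' \<in> qreps Q d' f" "qrep_iso d' D' E'" and "e \<in> loops"
  shows "defect_A E E' e = defect_A D D' e" "defect_B E E' e = defect_B D D' e"
  using trace_iso[OF assms(1-3,7)] trace_iso[OF assms(4-7)] by (simp_all add: defect_A_def defect_B_def)


section \<open>Orbits of split triples\<close>

abbreviation triple_orbit :: "('v, 'e) qtriple \<Rightarrow> ('v, 'e) qtriple set" where
  "triple_orbit \<equiv> Group_Action.orbit (gauge_group Q d \<times>\<times> gauge_group Q d') (split_act Q d d')"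

lemma transported_map:
  assumes D: "D \<in> qreps Q d f" and D': "D' \<in> qreps Q d' f" and \<pi>: "\<pi> \<in> qrep_maps Q d d' D D'"
    and E: "E \<in> qreps Q d f" and E': "E' \<in> qreps Q d' f"
    and g: "g \<in> qrep_maps Q d d D E" "\<And>w. w \<in> verts Q \<Longrightarrow> det (g w) \<noteq> 0"
    and h: "h \<in> qrep_maps Q d' d' D' E'"
  shows "(\<lambda>w\<in>verts Q. h w * \<pi> w * inv\<^bsub>GL (d w)\<^esub> (g w)) \<in> qrep_maps Q d d' E E'"
proof -
  have "(\<lambda>w\<in>verts Q. (\<lambda>w\<in>verts Q. h w * \<pi> w) w * (\<lambda>w\<in>verts Q. mat_inv (g w)) w) \<in> qrep_maps Q d d' E E'"
    by (rule map_comp[OF E D E' map_inverse[OF D E g] map_comp[OF D D' E' \<pi> h]])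
  also have "(\<lambda>w\<in>verts Q. (\<lambda>w\<in>verts Q. h w * \<pi> w) w * (\<lambda>w\<in>verts Q. mat_inv (g w)) w)
      = (\<lambda>w\<in>verts Q. h w * \<pi> w * inv\<^bsub>GL (d w)\<^esub> (g w))"
    using GL_inv[OF map_carrier[OF g(1)] g(2)] by (intro restrict_ext) simp
  finally show ?thesis .
qed

text \<open>
  The map contributes nothing to the orbit of a triple: transporting \<open>\<pi>\<close> along isomorphisms of its
  source and target gives a map \<open>E \<rightarrow> E'\<close>, and there is only one.
\<close>

lemma triple_orbit_iff:
  assumes D: "D \<in> nak_reps Q d f" and D': "D' \<in> nak_reps Q d' f" and \<pi>: "\<pi> \<in> qrep_maps Q d d' D D'"
  shows "(E, E', \<rho>) \<in> triple_orbit (D, D', \<pi>) \<longleftrightarrow>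
    E \<in> qreps Q d f \<and> E' \<in> qreps Q d' f \<and> \<rho> \<in> qrep_maps Q d d' E E' \<and> qrep_iso d D E \<and> qrep_iso d' D' E'"
    (is "?L \<longleftrightarrow> ?R")
proof
  note D0 = nak_repsD(1)[OF D] and D0' = nak_repsD(1)[OF D']
  {
    assume ?L
    then obtain g h where g: "g \<in> carrier (gauge_group Q d)" and h: "h \<in> carrier (gauge_group Q d')"
      and E: "E = gauge_act Q d g D" and E': "E' = gauge_act Q d' h D'"
      and \<rho>: "\<rho> = (\<lambda>w\<in>verts Q. h w * \<pi> w * inv\<^bsub>GL (d w)\<^esub> (g w))"
      unfolding Group_Action.orbit_def by (auto simp: DirProd_def split_act_def)
    note gm = gauge_act_map[OF D0 g, folded E] and hm = gauge_act_map[OF D0' h, folded E']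
    have gd: "det (g w) \<noteq> 0" "det (h w) \<noteq> 0" if "w \<in> verts Q" for w
      using g h that unfolding gauge_group_iff by auto
    have Eq: "E \<in> qreps Q d f" "E' \<in> qreps Q d' f"
      unfolding E E' using gauge_act_qreps[OF D0 g] gauge_act_qreps[OF D0' h] by auto
    show ?R
      using Eq transported_map[OF D0 D0' \<pi> Eq gm gd(1) hm] gm hm gd unfolding \<rho> qrep_iso_def by blast
  }
  {
    assume R: ?R
    obtain g where g: "g \<in> qrep_maps Q d d D E" "\<And>w. w \<in> verts Q \<Longrightarrow> det (g w) \<noteq> 0"
      using R unfolding qrep_iso_def by blast
    obtain h where h: "h \<in> qrep_maps Q d' d' D' E'" "\<And>w. w \<in> verts Q \<Longrightarrow> det (h w) \<noteq> 0"
      using R unfolding qrep_iso_def by blast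
    have E: "E \<in> qreps Q d f" "E' \<in> qreps Q d' f" and \<rho>: "\<rho> \<in> qrep_maps Q d d' E E'" using R by auto
    have "stable Q d f E" using nak_reps_iso[OF D E(1)] R nak_repsD by blast
    then have "(\<lambda>w\<in>verts Q. h w * \<pi> w * inv\<^bsub>GL (d w)\<^esub> (g w)) = \<rho>"
      by (intro map_unique[OF E(1) _ E(2) transported_map[OF D0 D0' \<pi> E g h(1)] \<rho>])
    then have "split_act Q d d' (g, h) (D, D', \<pi>) = (E, E', \<rho>)"
      using map_gauge_act[OF D0 E(1) g] map_gauge_act[OF D0' E(2) h] by (simp add: split_act_def)
    then show ?L
      unfolding Group_Action.orbit_def using map_gauge[OF g] map_gauge[OF h]
      by (intro CollectI exI[of _ "(g, h)"]) (simp add: DirProd_def)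
  }
qed

lemma triple_orbit_eqI:
  assumes D: "D \<in> nak_reps Q d f" and D': "D' \<in> nak_reps Q d' f" and \<pi>: "\<pi> \<in> qrep_maps Q d d' D D'"
    and E: "E \<in> nak_reps Q d f" and E': "E' \<in> nak_reps Q d' f" and \<rho>: "\<rho> \<in> qrep_maps Q d d' E E'"
    and iso: "qrep_iso d D E" "qrep_iso d' D' E'"
  shows "triple_orbit (D, D', \<pi>) = triple_orbit (E, E', \<rho>)"
proof -
  note q = nak_repsD(1)[OF D] nak_repsD(1)[OF D'] nak_repsD(1)[OF E] nak_repsD(1)[OF E']
  have "qrep_iso d D X \<longleftrightarrow> qrep_iso d E X" if "X \<in> qreps Q d f" for X
    using qrep_iso_trans[OF q(1,3) that iso(1)] qrep_iso_trans[OF q(3,1) that qrep_iso_sym[OF q(1,3) iso(1)]] by blast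
  moreover have "qrep_iso d' D' X \<longleftrightarrow> qrep_iso d' E' X" if "X \<in> qreps Q d' f" for X
    using qrep_iso_trans[OF q(2,4) that iso(2)] qrep_iso_trans[OF q(4,2) that qrep_iso_sym[OF q(2,4) iso(2)]] by blast
  ultimately have "(X, X', \<tau>) \<in> triple_orbit (D, D', \<pi>) \<longleftrightarrow> (X, X', \<tau>) \<in> triple_orbit (E, E', \<rho>)" for X X' \<tau>
    unfolding triple_orbit_iff[OF D D' \<pi>] triple_orbit_iff[OF E E' \<rho>] by blast
  then show ?thesis by auto
qed

lemma triple_orbit_eqD:
  assumes D: "D \<in> nak_reps Q d f" and D': "D' \<in> nak_reps Q d' f" and \<pi>: "\<pi> \<in> qrep_maps Q d d' D D'"
    and E: "E \<in> nak_reps Q d f" and E': "E' \<in> nak_reps Q d' f" and \<rho>: "\<rho> \<in> qrep_maps Q d d' E E'"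
    and eq: "triple_orbit (D, D', \<pi>) = triple_orbit (E, E', \<rho>)"
  shows "qrep_iso d D E" "qrep_iso d' D' E'"
proof -
  have "(E, E', \<rho>) \<in> triple_orbit (E, E', \<rho>)"
    unfolding triple_orbit_iff[OF E E' \<rho>] using nak_repsD(1)[OF E] nak_repsD(1)[OF E'] \<rho> qrep_iso_refl by blast
  then show "qrep_iso d D E" "qrep_iso d' D' E'"
    unfolding eq[symmetric] triple_orbit_iff[OF D D' \<pi>] by blast+
qed

lemma split_triplesD:
  assumes "(D, D', \<pi>) \<in> split_triples Q d d' f"
  shows "D \<in> nak_reps Q d f" "D' \<in> nak_reps Q d' f" "\<pi> \<in> qrep_maps Q d d' D D'"
    "vanishes_on_kernel Q d f D \<pi>"
  using assms by (auto simp: split_triples_def)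

lemma untwist_iso:
  assumes D: "D \<in> nak_reps Q d f" and D': "D' \<in> nak_reps Q d' f" and \<pi>: "\<pi> \<in> qrep_maps Q d d' D D'"
    and E: "E \<in> nak_reps Q d f" and E': "E' \<in> nak_reps Q d' f" and \<rho>: "\<rho> \<in> qrep_maps Q d d' E E'"
    and iso: "qrep_iso d D E" "qrep_iso d' D' E'"
  shows "triple_orbit (untwist D D' D, untwist D D' D', \<pi>) = triple_orbit (untwist E E' E, untwist E E' E', \<rho>)"
proof -
  note q = nak_repsD(1)[OF D] nak_repsD(1)[OF E] nak_repsD(1)[OF D'] nak_repsD(1)[OF E']
  have eq: "untwist E E' = untwist D D'"
    unfolding untwist_def using defect_iso[OF q(1,2) iso(1) q(3,4) iso(2)] by (intro ext shift_cong) auto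
  show ?thesis
    by (rule triple_orbit_eqI[OF split_triplesD(1-3)[OF untwist_split[OF D D' \<pi>]]
          split_triplesD(1-3)[OF untwist_split[OF E E' \<rho>]]])
      (unfold eq, unfold untwist_def, use shift_iso[OF q(1,2) iso(1)] shift_iso[OF q(3,4) iso(2)] in auto)
qed

end


section \<open>Matrices of regular functions\<close>

context function_space
begin

definition reg_mat :: "'a set \<Rightarrow> nat \<Rightarrow> nat \<Rightarrow> ('a \<Rightarrow> complex mat) \<Rightarrow> bool" where
  "reg_mat U m n M \<longleftrightarrow> (\<forall>x\<in>U. M x \<in> carrier_mat m n) \<and> (\<forall>i<m. \<forall>j<n. reg X U (\<lambda>x. M x $$ (i, j)))"

lemma reg_matD:
  assumes "reg_mat U m n M"
  shows "x \<in> U \<Longrightarrow> M x \<in> carrier_mat m n" "i < m \<Longrightarrow> j < n \<Longrightarrow> reg X U (\<lambda>x. M x $$ (i, j))"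
  using assms by (auto simp: reg_mat_def)

context
  fixes U
  assumes U: "openin (fs_top X) U"
begin

lemma reg_mat_mult:
  assumes M: "reg_mat U m n M" and N: "reg_mat U n l N"
  shows "reg_mat U m l (\<lambda>x. M x * N x)"
  unfolding reg_mat_def
proof (intro conjI ballI allI impI)
  show "M x * N x \<in> carrier_mat m l" if "x \<in> U" for x
    using reg_matD(1)[OF M that] reg_matD(1)[OF N that] by (rule mult_carrier_mat)
  fix i j assume ij: "i < m" "j < l"
  have "reg X U (\<lambda>x. \<Sum>k<n. M x $$ (i, k) * N x $$ (k, j))"
    by (intro reg_sum[OF U] reg_mult reg_matD(2)[OF M] reg_matD(2)[OF N]) (use ij in auto)
  then show "reg X U (\<lambda>x. (M x * N x) $$ (i, j))"
  proof (rule reg_cong)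
    fix x assume "x \<in> U"
    then show "(\<Sum>k<n. M x $$ (i, k) * N x $$ (k, j)) = (M x * N x) $$ (i, j)"
      using reg_matD(1)[OF M, of x] reg_matD(1)[OF N, of x] ij by (simp add: scalar_prod_def atLeast0LessThan)
  qed
qed

lemma reg_det:
  assumes M: "reg_mat U n n M"
  shows "reg X U (\<lambda>x. det (M x))"
proof -
  have "reg X U (\<lambda>x. \<Sum>p\<in>{p. p permutes {0..<n}}. signof p * (\<Prod>i\<in>{0..<n}. M x $$ (i, p i)))"
  proof (intro reg_sum[OF U] reg_mult reg_const[OF U] reg_prod[OF U] reg_matD(2)[OF M])
    fix p i assume "p \<in> {p. p permutes {0..<n}}" "i \<in> {0..<n}"
    then show "i < n" "p i < n" using permutes_in_image[of p "{0..<n}" i] by auto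
  qed
  then show ?thesis
    by (rule reg_cong) (simp add: det_def'[OF reg_matD(1)[OF M]])
qed

lemma reg_mat_inv:
  assumes M: "reg_mat U n n M" and det: "\<And>x. x \<in> U \<Longrightarrow> det (M x) \<noteq> 0"
  shows "reg_mat U n n (\<lambda>x. mat_inv (M x))"
  unfolding reg_mat_def
proof (intro conjI ballI allI impI)
  show "mat_inv (M x) \<in> carrier_mat n n" if "x \<in> U" for x
    by (rule mat_inv_carrier[OF reg_matD(1)[OF M that] det[OF that]])
  fix i j assume ij: "i < n" "j < n"
  have "reg_mat U (n - 1) (n - 1) (\<lambda>x. mat_delete (M x) j i)"
    unfolding reg_mat_def
  proof (intro conjI ballI allI impI)
    show "mat_delete (M x) j i \<in> carrier_mat (n - 1) (n - 1)" if "x \<in> U" for x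
      by (rule mat_delete_carrier[OF reg_matD(1)[OF M that]])
    fix a b assume ab: "a < n - 1" "b < n - 1"
    have "reg X U (\<lambda>x. M x $$ (if a < j then a else Suc a, if b < i then b else Suc b))"
      by (rule reg_matD(2)[OF M]) (use ab in auto)
    then show "reg X U (\<lambda>x. mat_delete (M x) j i $$ (a, b))"
    proof (rule reg_cong)
      fix x assume "x \<in> U"
      then show "M x $$ (if a < j then a else Suc a, if b < i then b else Suc b) = mat_delete (M x) j i $$ (a, b)"
        using reg_matD(1)[OF M, of x] ab by (simp add: mat_delete_def)
    qed
  qed
  then have "reg X U (\<lambda>x. inverse (det (M x)) * ((-1) ^ (j + i) * det (mat_delete (M x) j i)))"
    by (intro reg_mult reg_const[OF U] reg_inverse[OF reg_det[OF M] det] reg_det)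
  then show "reg X U (\<lambda>x. mat_inv (M x) $$ (i, j))"
  proof (rule reg_cong)
    fix x assume "x \<in> U"
    then show "inverse (det (M x)) * ((-1) ^ (j + i) * det (mat_delete (M x) j i)) = mat_inv (M x) $$ (i, j)"
      using reg_matD(1)[OF M, of x] ij by (simp add: mat_inv_def adj_mat_def cofactor_def)
  qed
qed

lemma reg_mat_trace:
  assumes M: "reg_mat U n n M"
  shows "reg X U (\<lambda>x. mat_trace (M x))"
proof -
  have "reg X U (\<lambda>x. \<Sum>i<n. M x $$ (i, i))"
    by (intro reg_sum[OF U] reg_matD(2)[OF M]) auto
  then show ?thesis
  proof (rule reg_cong)
    fix x assume "x \<in> U"
    then show "(\<Sum>i<n. M x $$ (i, i)) = mat_trace (M x)"
      using reg_matD(1)[OF M, of x] by (simp add: mat_trace_def)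
  qed
qed

end

lemma reg_mat_cong:
  assumes "reg_mat U m n M" "\<And>x. x \<in> U \<Longrightarrow> M x = N x"
  shows "reg_mat U m n N"
  unfolding reg_mat_def
proof (intro conjI ballI allI impI)
  show "N x \<in> carrier_mat m n" if "x \<in> U" for x
    using reg_matD(1)[OF assms(1) that] assms(2)[OF that] by simp
  show "reg X U (\<lambda>x. N x $$ (i, j))" if "i < m" "j < n" for i j
    by (rule reg_cong[OF reg_matD(2)[OF assms(1) that]]) (simp add: assms(2))
qed

end


section \<open>Regular families of representations\<close>

locale quiver_family = quiver Q + function_space X
  for Q :: "('v, 'e) pre_digraph" and X :: "'x fspace"
begin

definition reg_rep :: "'x set \<Rightarrow> ('v \<Rightarrow> nat) \<Rightarrow> ('v \<Rightarrow> nat) \<Rightarrow> ('x \<Rightarrow> ('v, 'e) qrep) \<Rightarrow> bool" where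
  "reg_rep U d f F \<longleftrightarrow> openin (fs_top X) U \<and>
     (\<forall>e\<in>arcs Q. reg_mat U (d (head Q e)) (d (tail Q e)) (\<lambda>x. rA (F x) e)) \<and>
     (\<forall>e\<in>arcs Q. reg_mat U (d (tail Q e)) (d (head Q e)) (\<lambda>x. rB (F x) e)) \<and>
     (\<forall>w\<in>verts Q. reg_mat U (d w) (f w) (\<lambda>x. ri (F x) w)) \<and>
     (\<forall>w\<in>verts Q. reg_mat U (f w) (d w) (\<lambda>x. rj (F x) w))"

lemma reg_rep_openin: "reg_rep U d f F \<Longrightarrow> openin (fs_top X) U"
  by (simp add: reg_rep_def)

lemma reg_repI:
  assumes "openin (fs_top X) U" "\<And>x. x \<in> U \<Longrightarrow> F x \<in> qreps Q d f"
    and "\<And>c. c \<in> qrep_coords Q d f \<Longrightarrow> reg X U (c \<circ> F)"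
  shows "reg_rep U d f F"
  unfolding reg_rep_def reg_mat_def
proof (intro conjI ballI allI impI assms(1))
  fix e x assume "e \<in> arcs Q" "x \<in> U"
  then show "rA (F x) e \<in> carrier_mat (d (head Q e)) (d (tail Q e))"
    "rB (F x) e \<in> carrier_mat (d (tail Q e)) (d (head Q e))"
    using rA_carrier[OF assms(2)] rB_carrier[OF assms(2)] by auto
next
  fix w x assume "w \<in> verts Q" "x \<in> U"
  then show "ri (F x) w \<in> carrier_mat (d w) (f w)" "rj (F x) w \<in> carrier_mat (f w) (d w)"
    using ri_carrier[OF assms(2)] rj_carrier[OF assms(2)] by auto
next
  fix e i j assume e: "e \<in> arcs Q" and ij: "i < d (head Q e)" "j < d (tail Q e)"
  have "(\<lambda>D. rA D e $$ (i, j)) \<in> qrep_coords Q d f" unfolding qrep_coords_def using e ij by blast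
  from assms(3)[OF this] show "reg X U (\<lambda>x. rA (F x) e $$ (i, j))" by (simp add: o_def)
next
  fix e i j assume e: "e \<in> arcs Q" and ij: "i < d (tail Q e)" "j < d (head Q e)"
  have "(\<lambda>D. rB D e $$ (i, j)) \<in> qrep_coords Q d f" unfolding qrep_coords_def using e ij by blast
  from assms(3)[OF this] show "reg X U (\<lambda>x. rB (F x) e $$ (i, j))" by (simp add: o_def)
next
  fix w i j assume w: "w \<in> verts Q" and ij: "i < d w" "j < f w"
  have "(\<lambda>D. ri D w $$ (i, j)) \<in> qrep_coords Q d f" unfolding qrep_coords_def using w ij by blast
  from assms(3)[OF this] show "reg X U (\<lambda>x. ri (F x) w $$ (i, j))" by (simp add: o_def)
next
  fix w i j assume w: "w \<in> verts Q" and ij: "i < f w" "j < d w"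
  have "(\<lambda>D. rj D w $$ (i, j)) \<in> qrep_coords Q d f" unfolding qrep_coords_def using w ij by blast
  from assms(3)[OF this] show "reg X U (\<lambda>x. rj (F x) w $$ (i, j))" by (simp add: o_def)
qed

lemma reg_rep_coords:
  assumes F: "reg_rep U d f F" and c: "c \<in> qrep_coords Q d f"
  shows "reg X U (c \<circ> F)"
proof -
  have A: "reg X U (\<lambda>x. rA (F x) e $$ (i, j))" if "e \<in> arcs Q" "i < d (head Q e)" "j < d (tail Q e)" for e i j
    using F that unfolding reg_rep_def reg_mat_def by simp
  have B: "reg X U (\<lambda>x. rB (F x) e $$ (i, j))" if "e \<in> arcs Q" "i < d (tail Q e)" "j < d (head Q e)" for e i j
    using F that unfolding reg_rep_def reg_mat_def by simp
  have I: "reg X U (\<lambda>x. ri (F x) w $$ (i, j))" if "w \<in> verts Q" "i < d w" "j < f w" for w i j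
    using F that unfolding reg_rep_def reg_mat_def by simp
  have J: "reg X U (\<lambda>x. rj (F x) w $$ (i, j))" if "w \<in> verts Q" "i < f w" "j < d w" for w i j
    using F that unfolding reg_rep_def reg_mat_def by simp
  show ?thesis
    using c unfolding qrep_coords_def by (auto simp: o_def intro: A B I J)
qed

text \<open>
  A covariant is polynomial in the entries of the representation.
\<close>

lemma reg_covariant:
  fixes p :: "('v, 'e) qrep \<Rightarrow> complex vec"
  assumes p: "covariant f w p" and F: "reg_rep U d f F"
    and q: "\<And>x. x \<in> U \<Longrightarrow> F x \<in> qreps Q d f" and i: "i < d w"
  shows "reg X U (\<lambda>x. p (F x) $ i)"
proof -
  have mv: "reg X U (\<lambda>x. (M x *\<^sub>v y x) $ i)"
    if M: "reg_mat U m n M" and y: "\<And>x. x \<in> U \<Longrightarrow> y x \<in> carrier_vec n"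
      and r: "\<And>j. j < n \<Longrightarrow> reg X U (\<lambda>x. y x $ j)" and i: "i < m" for M and y :: "'x \<Rightarrow> complex vec" and m n i
  proof -
    have "reg X U (\<lambda>x. \<Sum>j<n. M x $$ (i, j) * y x $ j)"
      by (intro reg_sum[OF reg_rep_openin[OF F]] reg_mult reg_matD(2)[OF M i] r) auto
    then show ?thesis
    proof (rule reg_cong)
      fix x assume "x \<in> U"
      then show "(\<Sum>j<n. M x $$ (i, j) * y x $ j) = (M x *\<^sub>v y x) $ i"
        using reg_matD(1)[OF M, of x] y[of x] i by (simp add: scalar_prod_def atLeast0LessThan)
    qed
  qed
  show ?thesis using p i
  proof (induction arbitrary: i)
    case (framing w k)
    have R: "reg_mat U (d w) (f w) (\<lambda>x. ri (F x) w)" using F framing(1) unfolding reg_rep_def by blast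
    show ?case
    proof (rule reg_cong[OF reg_matD(2)[OF R framing(3,2)]])
      fix x assume "x \<in> U"
      then show "ri (F x) w $$ (i, k) = col (ri (F x) w) k $ i"
        using reg_matD(1)[OF R, of x] framing(2,3) by simp
    qed
  next
    case (forward e p)
    have R: "reg_mat U (d (head Q e)) (d (tail Q e)) (\<lambda>x. rA (F x) e)"
      using F forward(1) unfolding reg_rep_def by blast
    show ?case
      by (rule mv[OF R covariant_carrier[OF forward(2) q] forward.IH forward.prems])
  next
    case (backward e p)
    have R: "reg_mat U (d (tail Q e)) (d (head Q e)) (\<lambda>x. rB (F x) e)"
      using F backward(1) unfolding reg_rep_def by blast
    show ?case
      by (rule mv[OF R covariant_carrier[OF backward(2) q] backward.IH backward.prems])
  qed
qed

lemma reg_frame_mat: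
  assumes p: "frame f n p" and F: "reg_rep U d f F"
    and q: "\<And>x. x \<in> U \<Longrightarrow> F x \<in> qreps Q d f" and w: "w \<in> verts Q"
  shows "reg_mat U (d w) (n w) (\<lambda>x. frame_mat d n p w (F x))"
  unfolding reg_mat_def
proof (intro conjI ballI allI impI frame_mat_carrier)
  fix i j assume ij: "i < d w" "j < n w"
  have "reg X U (\<lambda>x. p w j (F x) $ i)"
    by (rule reg_covariant[OF _ F q ij(1)]) (use p w ij in \<open>auto simp: frame_def\<close>)
  then show "reg X U (\<lambda>x. frame_mat d n p w (F x) $$ (i, j))"
    using ij by (simp add: frame_mat_def)
qed

lemma morphism_into_reps:
  assumes F: "reg_rep (fs_points X) d f F" and nak: "\<And>x. x \<in> fs_points X \<Longrightarrow> F x \<in> nak_reps Q d f"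
  shows "fs_morphism X (quasi_affine (qrep_coords Q d f) (nak_reps Q d f)) F"
  by (rule morphism_into_quasi_affine[OF function_space_axioms nak reg_rep_coords[OF F]])

lemma reg_rep_morphism:
  assumes F: "fs_morphism X (quasi_affine (qrep_coords Q d f) (nak_reps Q d f)) F"
  shows "reg_rep (fs_points X) d f F"
proof (rule reg_repI)
  show "F x \<in> qreps Q d f" if "x \<in> fs_points X" for x
    using morphism_points[OF F that] by (simp add: nak_reps_def)
  fix c assume c: "c \<in> qrep_coords Q d f"
  have "reg (quasi_affine (qrep_coords Q d f) (nak_reps Q d f)) (fs_points (quasi_affine (qrep_coords Q d f) (nak_reps Q d f))) c"
    using reg_quasi_affine[OF polyfun.coord[OF c]] by simp
  then show "reg X (fs_points X) (c \<circ> F)" by (rule morphism_reg_points[OF F])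
qed simp

lemma morphism_into_triples:
  assumes F: "reg_rep (fs_points X) d f F" and F': "reg_rep (fs_points X) d' f F'"
    and \<pi>: "\<And>w. w \<in> verts Q \<Longrightarrow> reg_mat (fs_points X) (d' w) (d w) (\<lambda>x. \<pi> x w)"
    and split: "\<And>x. x \<in> fs_points X \<Longrightarrow> (F x, F' x, \<pi> x) \<in> split_triples Q d d' f"
  shows "fs_morphism X (quasi_affine (split_coords Q d d' f) (split_triples Q d d' f)) (\<lambda>x. (F x, F' x, \<pi> x))"
proof (rule morphism_into_quasi_affine[OF function_space_axioms split])
  have P: "reg X (fs_points X) (\<lambda>x. \<pi> x w $$ (a, b))" if "w \<in> verts Q" "a < d' w" "b < d w" for w a b
    by (rule reg_matD(2)[OF \<pi>[OF that(1)] that(2,3)])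
  fix c assume "c \<in> split_coords Q d d' f"
  then show "reg X (fs_points X) (c \<circ> (\<lambda>x. (F x, F' x, \<pi> x)))"
    unfolding split_coords_def using reg_rep_coords[OF F] reg_rep_coords[OF F'] P
    by (auto simp: o_def)
qed

end

lemma (in quiver) quiver_familyI: "function_space Z \<Longrightarrow> quiver_family Q Z"
  by (simp add: quiver_family_def quiver_axioms)


section \<open>Local sections of the quotient map\<close>

context quiver
begin

abbreviation rep_space :: "('v \<Rightarrow> nat) \<Rightarrow> ('v \<Rightarrow> nat) \<Rightarrow> ('v, 'e) qrep fspace" where
  "rep_space d f \<equiv> quasi_affine (qrep_coords Q d f) (nak_reps Q d f)"

lemma function_space_nakajima: "function_space (nakajima_variety Q d f)"
  unfolding nakajima_variety_def by (rule function_space_quotient[OF function_space_quasi_affine])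

lemma points_nakajima: "fs_points (nakajima_variety Q d f) = rep_orbit d ` nak_reps Q d f"
  unfolding nakajima_variety_def points_quotient by (auto simp: orbits_def)

lemma morphism_rep_orbit: "fs_morphism (rep_space d f) (nakajima_variety Q d f) (rep_orbit d)"
  unfolding nakajima_variety_def by (rule morphism_orbit)

text \<open>
  The representative of the orbit in which the chosen covariants are the standard basis vectors.
\<close>

definition normalize ::
    "('v \<Rightarrow> nat) \<Rightarrow> ('v \<Rightarrow> nat \<Rightarrow> ('v, 'e) qrep \<Rightarrow> complex vec) \<Rightarrow> ('v, 'e) qrep \<Rightarrow> ('v, 'e) qrep" where
  "normalize d p D = gauge_act Q d (\<lambda>w\<in>verts Q. mat_inv (frame_mat d d p w D)) D"

context
  fixes d f p
  assumes p: "frame f d p"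
begin

definition framed :: "('v, 'e) qrep set" where
  "framed = {D \<in> nak_reps Q d f. \<forall>w\<in>verts Q. det (frame_mat d d p w D) \<noteq> 0}"

lemma framedD:
  assumes "D \<in> framed"
  shows "D \<in> nak_reps Q d f" "D \<in> qreps Q d f" "w \<in> verts Q \<Longrightarrow> det (frame_mat d d p w D) \<noteq> 0"
  using assms by (auto simp: framed_def nak_reps_def)

lemma framed_iso:
  assumes D: "D \<in> framed" and E: "E \<in> qreps Q d f" and iso: "qrep_iso d D E"
  shows "E \<in> framed"
proof -
  obtain g where g: "g \<in> qrep_maps Q d d D E" "\<And>w. w \<in> verts Q \<Longrightarrow> det (g w) \<noteq> 0"
    using iso unfolding qrep_iso_def by blast
  have "det (frame_mat d d p w E) \<noteq> 0" if w: "w \<in> verts Q" for w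
    unfolding frame_mat_map[OF p w framedD(2)[OF D] E g(1), symmetric]
    using det_mult[OF map_carrier[OF g(1) w] frame_mat_carrier[of d d p w D]] g(2)[OF w] framedD(3)[OF D w] by simp
  then show ?thesis
    using nak_reps_iso[OF framedD(1)[OF D] E iso] by (simp add: framed_def)
qed

lemma
  assumes D: "D \<in> framed"
  shows normalize_qreps: "normalize d p D \<in> qreps Q d f"
    and normalize_iso: "qrep_iso d D (normalize d p D)"
    and frame_mat_normalize: "w \<in> verts Q \<Longrightarrow> frame_mat d d p w (normalize d p D) = 1\<^sub>m (d w)"
proof -
  note D' = framedD[OF D]
  let ?g = "\<lambda>w\<in>verts Q. mat_inv (frame_mat d d p w D)"
  have g: "?g \<in> carrier (gauge_group Q d)"
    unfolding gauge_group_iff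
    using mat_inv_carrier[OF frame_mat_carrier[of d d p _ D] D'(3)] det_mat_inv[OF frame_mat_carrier[of d d p _ D] D'(3)]
    by auto
  note m = gauge_act_map[OF D'(2) g] and q = gauge_act_qreps[OF D'(2) g]
  show "normalize d p D \<in> qreps Q d f" unfolding normalize_def by (rule q)
  show "qrep_iso d D (normalize d p D)"
    unfolding normalize_def qrep_iso_def using m g unfolding gauge_group_iff by blast
  show "frame_mat d d p w (normalize d p D) = 1\<^sub>m (d w)" if w: "w \<in> verts Q"
    unfolding normalize_def frame_mat_map[OF p w D'(2) q m, symmetric]
    using mat_inv_left[OF frame_mat_carrier[of d d p w D] D'(3)[OF w]] w by simp
qed

text \<open>
  An orbit has only one normalized representative, so normalization descends to the quotient.
\<close>

lemma normalize_cong: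
  assumes D: "D \<in> framed" and E: "E \<in> framed" and iso: "qrep_iso d D E"
  shows "normalize d p D = normalize d p E"
proof -
  note q = normalize_qreps[OF D] normalize_qreps[OF E] framedD(2)[OF D] framedD(2)[OF E]
  have "qrep_iso d (normalize d p D) (normalize d p E)"
    by (rule qrep_iso_trans[OF q(1,3,2) qrep_iso_sym[OF q(3,1) normalize_iso[OF D]]
          qrep_iso_trans[OF q(3,4,2) iso normalize_iso[OF E]]])
  then obtain g where g: "g \<in> qrep_maps Q d d (normalize d p D) (normalize d p E)"
    unfolding qrep_iso_def by blast
  \<comment> \<open>An isomorphism carries frame to frame; both frames being the identity, it is the identity.\<close>
  have one: "g w = 1\<^sub>m (d w)" if w: "w \<in> verts Q" for w
    using frame_mat_map[OF p w q(1,2) g] map_carrier[OF g w]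
    by (simp add: frame_mat_normalize[OF D w] frame_mat_normalize[OF E w])
  show ?thesis
  proof (rule qrep_eqI[OF q(1,2)])
    fix e assume e: "e \<in> arcs Q"
    show "rA (normalize d p D) e = rA (normalize d p E) e"
      using map_rA[OF g e] rA_carrier[OF q(1) e] rA_carrier[OF q(2) e]
      by (simp add: one[OF tail_verts[OF e]] one[OF head_verts[OF e]])
    show "rB (normalize d p D) e = rB (normalize d p E) e"
      using map_rB[OF g e] rB_carrier[OF q(1) e] rB_carrier[OF q(2) e]
      by (simp add: one[OF tail_verts[OF e]] one[OF head_verts[OF e]])
  next
    fix w assume w: "w \<in> verts Q"
    show "ri (normalize d p D) w = ri (normalize d p E) w"
      using map_ri[OF g w] ri_carrier[OF q(1) w] by (simp add: one[OF w])
    show "rj (normalize d p D) w = rj (normalize d p E) w"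
      using map_rj[OF g w] rj_carrier[OF q(2) w] by (simp add: one[OF w])
  qed
qed

lemma reg_rep_id:
  assumes "openin (fs_top (rep_space d f)) U"
  shows "quiver_family.reg_rep Q (rep_space d f) U d f (\<lambda>D. D)"
proof -
  interpret F: quiver_family Q "rep_space d f" by (rule quiver_familyI[OF function_space_quasi_affine])
  show ?thesis
  proof (rule F.reg_repI[OF assms])
    have "U \<subseteq> nak_reps Q d f" using openin_subset[OF assms] by simp
    then show "D \<in> qreps Q d f" if "D \<in> U" for D using that by (auto simp: nak_reps_def)
    show "reg (rep_space d f) U (c \<circ> (\<lambda>D. D))" if "c \<in> qrep_coords Q d f" for c
      using F.reg_subset[OF reg_quasi_affine[OF polyfun.coord[OF that]] assms] \<open>U \<subseteq> nak_reps Q d f\<close>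
      by (simp add: o_def)
  qed
qed

lemma openin_framed: "openin (fs_top (rep_space d f)) framed"
proof -
  interpret F: quiver_family Q "rep_space d f" by (rule quiver_familyI[OF function_space_quasi_affine])
  have o: "openin (fs_top (rep_space d f)) (nak_reps Q d f)"
    using openin_topspace[of "fs_top (rep_space d f)"] by simp
  have "reg (rep_space d f) (nak_reps Q d f) (\<lambda>D. \<Prod>w\<in>verts Q. det (frame_mat d d p w D))"
  proof (intro F.reg_prod[OF o] F.reg_det[OF o])
    fix w assume w: "w \<in> verts Q"
    show "F.reg_mat (nak_reps Q d f) (d w) (d w) (frame_mat d d p w)"
      by (rule F.reg_frame_mat[OF p reg_rep_id[OF o] _ w]) (simp add: nak_reps_def)
  qed
  then have "openin (fs_top (rep_space d f)) {D \<in> nak_reps Q d f. (\<Prod>w\<in>verts Q. det (frame_mat d d p w D)) \<noteq> 0}"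
    by (rule F.openin_nonzero)
  then show ?thesis by (simp add: framed_def)
qed

lemma reg_rep_normalize: "quiver_family.reg_rep Q (rep_space d f) framed d f (normalize d p)"
proof -
  interpret F: quiver_family Q "rep_space d f" by (rule quiver_familyI[OF function_space_quasi_affine])
  note o = openin_framed
  note id = reg_rep_id[OF o, unfolded F.reg_rep_def]
  have P: "F.reg_mat framed (d w) (d w) (\<lambda>D. frame_mat d d p w D)" if "w \<in> verts Q" for w
    by (rule F.reg_frame_mat[OF p reg_rep_id[OF o] framedD(2) that])
  have Pi: "F.reg_mat framed (d w) (d w) (\<lambda>D. mat_inv (frame_mat d d p w D))" if w: "w \<in> verts Q" for w
    by (rule F.reg_mat_inv[OF o P[OF w] framedD(3)[OF _ w]])
  have inv: "inv\<^bsub>GL (d w)\<^esub> (mat_inv (frame_mat d d p w D)) = frame_mat d d p w D"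
    if "w \<in> verts Q" "D \<in> framed" for w D
  proof -
    note c = frame_mat_carrier[of d d p w D] framedD(3)[OF that(2,1)]
    have "mat_inv (mat_inv (frame_mat d d p w D)) = frame_mat d d p w D"
    proof (rule mat_right_cancel[OF mat_inv_carrier[OF mat_inv_carrier[OF c] det_mat_inv[OF c]] c(1) mat_inv_carrier[OF c] det_mat_inv[OF c]])
      show "mat_inv (mat_inv (frame_mat d d p w D)) * mat_inv (frame_mat d d p w D) = frame_mat d d p w D * mat_inv (frame_mat d d p w D)"
        using mat_inv_left[OF mat_inv_carrier[OF c] det_mat_inv[OF c]] mat_inv_right[OF c] by simp
    qed
    then show ?thesis using GL_inv[OF mat_inv_carrier[OF c] det_mat_inv[OF c]] by simp
  qed
  show ?thesis
    unfolding F.reg_rep_def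
  proof (intro conjI ballI o)
    fix e assume e: "e \<in> arcs Q"
    note t = tail_verts[OF e] and h = head_verts[OF e]
    have "F.reg_mat framed (d (head Q e)) (d (tail Q e))
        (\<lambda>D. mat_inv (frame_mat d d p (head Q e) D) * rA D e * frame_mat d d p (tail Q e) D)"
      using id e by (intro F.reg_mat_mult[OF o F.reg_mat_mult[OF o Pi[OF h]] P[OF t]]) blast
    then show "F.reg_mat framed (d (head Q e)) (d (tail Q e)) (\<lambda>D. rA (normalize d p D) e)"
      by (rule F.reg_mat_cong) (use e inv[OF t] in \<open>simp add: normalize_def gauge_act_def\<close>)
    have "F.reg_mat framed (d (tail Q e)) (d (head Q e))
        (\<lambda>D. mat_inv (frame_mat d d p (tail Q e) D) * rB D e * frame_mat d d p (head Q e) D)"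
      using id e by (intro F.reg_mat_mult[OF o F.reg_mat_mult[OF o Pi[OF t]] P[OF h]]) blast
    then show "F.reg_mat framed (d (tail Q e)) (d (head Q e)) (\<lambda>D. rB (normalize d p D) e)"
      by (rule F.reg_mat_cong) (use e inv[OF h] in \<open>simp add: normalize_def gauge_act_def\<close>)
  next
    fix w assume w: "w \<in> verts Q"
    have "F.reg_mat framed (d w) (f w) (\<lambda>D. mat_inv (frame_mat d d p w D) * ri D w)"
      using id w by (intro F.reg_mat_mult[OF o Pi[OF w]]) blast
    then show "F.reg_mat framed (d w) (f w) (\<lambda>D. ri (normalize d p D) w)"
      by (rule F.reg_mat_cong) (use w in \<open>simp add: normalize_def gauge_act_def\<close>)
    have "F.reg_mat framed (f w) (d w) (\<lambda>D. rj D w * frame_mat d d p w D)"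
      using id w by (intro F.reg_mat_mult[OF o _ P[OF w]]) blast
    then show "F.reg_mat framed (f w) (d w) (\<lambda>D. rj (normalize d p D) w)"
      by (rule F.reg_mat_cong) (use w inv[OF w] in \<open>simp add: normalize_def gauge_act_def\<close>)
  qed
qed

text \<open>
  Regularity on the quotient means regularity of the invariant function upstairs, and the entries of
  the normalized representative are rational with the determinants of the frame as denominators.
\<close>

lemma frame_section:
  obtains \<sigma> where "openin (fs_top (nakajima_variety Q d f)) (rep_orbit d ` framed)"
    "fs_morphism (fs_sub (nakajima_variety Q d f) (rep_orbit d ` framed)) (rep_space d f) \<sigma>"
    "\<forall>D\<in>framed. \<sigma> (rep_orbit d D) = normalize d p D"
proof -
  interpret F: quiver_family Q "rep_space d f" by (rule quiver_familyI[OF function_space_quasi_affine])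
  let ?M = "nakajima_variety Q d f" and ?U = "rep_orbit d ` framed"
  define \<sigma> where "\<sigma> y = normalize d p (SOME D. D \<in> framed \<and> rep_orbit d D = y)" for y
  have \<sigma>: "\<sigma> (rep_orbit d D) = normalize d p D" if D: "D \<in> framed" for D
  proof -
    let ?E = "SOME E. E \<in> framed \<and> rep_orbit d E = rep_orbit d D"
    have E: "?E \<in> framed \<and> rep_orbit d ?E = rep_orbit d D"
      by (rule someI[of _ D]) (use D in simp)
    then show ?thesis
      unfolding \<sigma>_def using normalize_cong[of ?E D] D rep_orbit_eq_iff[of ?E d f D] framedD(2) by blast
  qed
  have pre: "{D \<in> fs_points (rep_space d f). rep_orbit d D \<in> ?U} = framed"
  proof -
    have "D \<in> framed" if "D \<in> nak_reps Q d f" "E \<in> framed" "rep_orbit d D = rep_orbit d E" for D E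
      using that framed_iso[of E D] rep_orbit_eq_iff[of E d f D] framedD(2)[of E] by (auto simp: nak_reps_def)
    then show ?thesis using framedD(1) by auto
  qed
  have U: "openin (fs_top ?M) ?U"
    unfolding nakajima_variety_def fs_top_quotient openin_quotient_top pre
    using openin_framed framedD(1) by (auto simp: orbits_def)
  have points: "fs_points (fs_sub ?M ?U) = ?U" using openin_subset[OF U] by auto
  have m: "fs_morphism (fs_sub ?M ?U) (rep_space d f) \<sigma>"
  proof (rule morphism_into_quasi_affine[OF function_space_sub[OF function_space_nakajima]])
    fix y assume "y \<in> fs_points (fs_sub ?M ?U)"
    then obtain D where D: "D \<in> framed" "y = rep_orbit d D" unfolding points by blast
    then show "\<sigma> y \<in> nak_reps Q d f"
      using \<sigma>[OF D(1)] nak_reps_iso[OF framedD(1)[OF D(1)] normalize_qreps[OF D(1)] normalize_iso[OF D(1)]] by simp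
  next
    fix c assume c: "c \<in> qrep_coords Q d f"
    have "reg (rep_space d f) framed (\<lambda>D. c (\<sigma> (rep_orbit d D)))"
      by (rule F.reg_cong[OF F.reg_rep_coords[OF reg_rep_normalize c]]) (simp add: \<sigma>)
    then show "reg (fs_sub ?M ?U) (fs_points (fs_sub ?M ?U)) (c \<circ> \<sigma>)"
      unfolding points reg_sub_open_iff[OF function_space_nakajima U]
      using U unfolding nakajima_variety_def reg_quotient_iff fs_top_quotient pre by simp
  qed
  show thesis by (rule that[OF U m], intro ballI, rule \<sigma>)
qed

end

text \<open>
  The orbits for which a given frame consists of bases form an open set, and by \<open>stable_frame\<close> these
  sets cover the quotient.
\<close>

lemma local_section:
  assumes D: "D \<in> nak_reps Q d f"
  obtains U \<sigma> p where "openin (fs_top (nakajima_variety Q d f)) U" "rep_orbit d D \<in> U"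
    "fs_morphism (fs_sub (nakajima_variety Q d f) U) (rep_space d f) \<sigma>"
    "frame f d p" "\<forall>y\<in>U. \<forall>w\<in>verts Q. frame_mat d d p w (\<sigma> y) = 1\<^sub>m (d w)"
    "\<forall>y\<in>U. \<sigma> y \<in> nak_reps Q d f" "\<forall>y\<in>U. rep_orbit d (\<sigma> y) = y"
proof -
  have q: "D \<in> qreps Q d f" "stable Q d f D" using D by (simp_all add: nak_reps_def)
  obtain p where p: "frame f d p" "\<forall>w\<in>verts Q. det (frame_mat d d p w D) \<noteq> 0"
    using stable_frame[OF q] by blast
  obtain \<sigma> where \<sigma>: "openin (fs_top (nakajima_variety Q d f)) (rep_orbit d ` framed d f p)"
    "fs_morphism (fs_sub (nakajima_variety Q d f) (rep_orbit d ` framed d f p)) (rep_space d f) \<sigma>"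
    "\<forall>D\<in>framed d f p. \<sigma> (rep_orbit d D) = normalize d p D"
    by (rule frame_section[OF p(1)])
  show thesis
  proof (rule that[OF \<sigma>(1) _ \<sigma>(2) p(1)])
    show "rep_orbit d D \<in> rep_orbit d ` framed d f p" using D p by (simp add: framed_def[OF p(1)])
    have sect: "(\<forall>w\<in>verts Q. frame_mat d d p w (\<sigma> y) = 1\<^sub>m (d w)) \<and> \<sigma> y \<in> nak_reps Q d f \<and> rep_orbit d (\<sigma> y) = y"
      if y: "y \<in> rep_orbit d ` framed d f p" for y
    proof -
      obtain E where E: "E \<in> framed d f p" "y = rep_orbit d E" using y by blast
      note n = normalize_qreps[OF p(1) E(1)] normalize_iso[OF p(1) E(1)]
      have \<sigma>y: "\<sigma> y = normalize d p E" using \<sigma>(3) E by simp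
      show ?thesis
        unfolding \<sigma>y
        using frame_mat_normalize[OF p(1) E(1)] nak_reps_iso[OF framedD(1)[OF p(1) E(1)] n]
          rep_orbit_eq_iff[OF framedD(2)[OF p(1) E(1)] n(1)] n(2) E(2) by simp
    qed
    then show "\<forall>y\<in>rep_orbit d ` framed d f p. \<forall>w\<in>verts Q. frame_mat d d p w (\<sigma> y) = 1\<^sub>m (d w)"
      "\<forall>y\<in>rep_orbit d ` framed d f p. \<sigma> y \<in> nak_reps Q d f"
      "\<forall>y\<in>rep_orbit d ` framed d f p. rep_orbit d (\<sigma> y) = y" by blast+
  qed
qed

end


section \<open>The isomorphism\<close>

lemma function_space_affine: "function_space (affine_space n)"
  unfolding affine_space_def by (rule function_space_quasi_affine)

lemma points_affine [simp]: "fs_points (affine_space n) = {..<n} \<rightarrow>\<^sub>E UNIV"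
  by (simp add: affine_space_def)

lemma morphism_into_affine:
  assumes Z: "function_space Z" and "\<And>z. z \<in> fs_points Z \<Longrightarrow> x z \<in> {..<n} \<rightarrow>\<^sub>E UNIV"
    and "\<And>i. i < n \<Longrightarrow> reg Z (fs_points Z) (\<lambda>z. x z i)"
  shows "fs_morphism Z (affine_space n) x"
  unfolding affine_space_def
  by (rule morphism_into_quasi_affine[OF Z]) (use assms in \<open>auto simp: o_def\<close>)

lemma reg_affine_coord:
  assumes "fs_morphism Z (affine_space n) x" "i < n"
  shows "reg Z (fs_points Z) (\<lambda>z. x z i)"
proof -
  have "reg (affine_space n) (fs_points (affine_space n)) (\<lambda>x. x i)"
    unfolding points_affine unfolding affine_space_def
    by (rule reg_quasi_affine[OF polyfun.coord]) (use assms(2) in auto)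
  from morphism_reg_points[OF assms(1) this] show ?thesis by (simp add: o_def)
qed

lemma (in function_space) reg_mat_shift:
  assumes M: "reg_mat U n n M" and c: "reg X U c"
  shows "reg_mat U n n (\<lambda>x. M x + c x \<cdot>\<^sub>m 1\<^sub>m (dim_row (M x)))"
  unfolding reg_mat_def
proof (intro conjI ballI allI impI)
  show "M x + c x \<cdot>\<^sub>m 1\<^sub>m (dim_row (M x)) \<in> carrier_mat n n" if "x \<in> U" for x
    using reg_matD(1)[OF M that] by simp
  fix i j assume ij: "i < n" "j < n"
  have "reg X U (\<lambda>x. M x $$ (i, j) + c x * (if i = j then 1 else 0))"
    by (intro reg_add reg_mult reg_matD(2)[OF M ij] c reg_const[OF reg_openin[OF c]])
  then show "reg X U (\<lambda>x. (M x + c x \<cdot>\<^sub>m 1\<^sub>m (dim_row (M x))) $$ (i, j))"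
  proof (rule reg_cong)
    fix x assume "x \<in> U"
    then show "M x $$ (i, j) + c x * (if i = j then 1 else 0) = (M x + c x \<cdot>\<^sub>m 1\<^sub>m (dim_row (M x))) $$ (i, j)"
      using reg_matD(1)[OF M, of x] ij by simp
  qed
qed

text \<open>
  An enumeration of the loops at \<open>v\<close> identifies the affine space of the statement with the space of
  pairs of scalars \<open>(a, b)\<close> per loop: the first half of the coordinates is added to the matrices \<open>A\<close>,
  the second half to the matrices \<open>B\<close>.
\<close>

locale loop_enumeration = quiver_vertex Q v for Q :: "('v, 'e) pre_digraph" and v :: 'v +
  fixes loop_at :: "nat \<Rightarrow> 'e" and index :: "'e \<Rightarrow> nat"
  assumes loop_at: "k < card loops \<Longrightarrow> loop_at k \<in> loops \<and> index (loop_at k) = k"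
    and index: "e \<in> loops \<Longrightarrow> index e < card loops \<and> loop_at (index e) = e"
begin

abbreviation N_loops :: nat where "N_loops \<equiv> card loops"

definition twist :: "(nat \<Rightarrow> complex) \<Rightarrow> ('v, 'e) qrep \<Rightarrow> ('v, 'e) qrep" where
  "twist x = shift (\<lambda>e. x (index e)) (\<lambda>e. x (N_loops + index e))"

lemma reg_rep_shift:
  assumes Z: "function_space Z" and F: "quiver_family.reg_rep Q Z U d f F"
    and a: "\<And>e. e \<in> loops \<Longrightarrow> reg Z U (\<lambda>z. a z e)" and b: "\<And>e. e \<in> loops \<Longrightarrow> reg Z U (\<lambda>z. b z e)"
  shows "quiver_family.reg_rep Q Z U d f (\<lambda>z. shift (a z) (b z) (F z))"
proof -
  interpret Z: quiver_family Q Z by (rule quiver_familyI[OF Z])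
  note F' = F[unfolded Z.reg_rep_def]
  have *: "Z.reg_mat U m n (\<lambda>z. shift_arrow e (c z) (M z))"
    if M: "Z.reg_mat U m n M" and mn: "e \<in> loops \<Longrightarrow> m = n" and c: "e \<in> loops \<Longrightarrow> reg Z U c" for m n e M c
  proof (cases "e \<in> loops")
    case True
    then show ?thesis using Z.reg_mat_shift[of U n M c] M mn c by (simp add: shift_arrow_def)
  next
    case False
    then show ?thesis using M by (simp add: shift_arrow_def)
  qed
  show ?thesis
    unfolding Z.reg_rep_def
  proof (intro conjI ballI)
    fix e assume e: "e \<in> arcs Q"
    have "Z.reg_mat U (d (head Q e)) (d (tail Q e)) (\<lambda>z. shift_arrow e (a z e) (rA (F z) e))"
      by (rule *) (use F' e a loopsD in auto)
    then show "Z.reg_mat U (d (head Q e)) (d (tail Q e)) (\<lambda>z. rA (shift (a z) (b z) (F z)) e)"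
      using e by simp
    have "Z.reg_mat U (d (tail Q e)) (d (head Q e)) (\<lambda>z. shift_arrow e (b z e) (rB (F z) e))"
      by (rule *) (use F' e b loopsD in auto)
    then show "Z.reg_mat U (d (tail Q e)) (d (head Q e)) (\<lambda>z. rB (shift (a z) (b z) (F z)) e)"
      using e by simp
  qed (use F' in auto)
qed

lemma
  assumes Z: "function_space Z" and F: "quiver_family.reg_rep Q Z U c f F" and e: "e \<in> loops"
  shows reg_rep_loop: "function_space.reg_mat Z U (c v) (c v) (\<lambda>z. rA (F z) e)"
    "function_space.reg_mat Z U (c v) (c v) (\<lambda>z. rB (F z) e)"
proof -
  interpret Z: quiver_family Q Z by (rule quiver_familyI[OF Z])
  show "Z.reg_mat U (c v) (c v) (\<lambda>z. rA (F z) e)" "Z.reg_mat U (c v) (c v) (\<lambda>z. rB (F z) e)"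
    using F[unfolded Z.reg_rep_def] loopsD[OF e] by auto
qed

text \<open>
  Shifts commute with isomorphisms, so the chosen representative does not matter
  (\<open>twist_orbit_eq\<close>).
\<close>

definition twist_orbit :: "('v \<Rightarrow> nat) \<Rightarrow> ('v \<Rightarrow> nat) \<Rightarrow> ('v, 'e) qrep set \<times> (nat \<Rightarrow> complex) \<Rightarrow> ('v, 'e) qrep set" where
  "twist_orbit c f = (\<lambda>(y, x). rep_orbit c (twist x (SOME D. D \<in> nak_reps Q c f \<and> rep_orbit c D = y)))"

lemma twist_orbit_eq:
  assumes D: "D \<in> nak_reps Q c f"
  shows "twist_orbit c f (rep_orbit c D, x) = rep_orbit c (twist x D)"
proof -
  let ?E = "SOME E. E \<in> nak_reps Q c f \<and> rep_orbit c E = rep_orbit c D"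
  have E: "?E \<in> nak_reps Q c f \<and> rep_orbit c ?E = rep_orbit c D"
    by (rule someI[of _ D]) (use D in simp)
  have q: "?E \<in> qreps Q c f" "D \<in> qreps Q c f" using D E by (simp_all add: nak_reps_def)
  have "qrep_iso c ?E D" using E rep_orbit_eq_iff[OF q] by blast
  then have "rep_orbit c (twist x ?E) = rep_orbit c (twist x D)"
    unfolding twist_def using rep_orbit_eq_iff[OF shift_qreps[OF q(1)] shift_qreps[OF q(2)]] shift_iso[OF q] by blast
  then show ?thesis by (simp add: twist_orbit_def)
qed

text \<open>
  Over the domain of a local section the shift is a polynomial formula applied to the section,
  followed by the projection to orbits.
\<close>

lemma morphism_twist_orbit:
  "fs_morphism (fs_prod (nakajima_variety Q c f) (affine_space (2 * N_loops))) (nakajima_variety Q c f) (twist_orbit c f)"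
proof (rule morphism_local)
  let ?M = "nakajima_variety Q c f" and ?A = "affine_space (2 * N_loops)"
  note fM = function_space_nakajima[of c f] and fA = function_space_affine[of "2 * N_loops"]
  note fP = function_space_prod[OF fM fA]
  show "function_space (fs_prod ?M ?A)" by (rule fP)
  fix z assume z: "z \<in> fs_points (fs_prod ?M ?A)"
  have "fst z \<in> fs_points ?M" by (rule morphism_points[OF morphism_fst[OF fM fA] z])
  then obtain D where D: "D \<in> nak_reps Q c f" "fst z = rep_orbit c D" unfolding points_nakajima by blast
  obtain U \<sigma> p where U: "openin (fs_top ?M) U" "rep_orbit c D \<in> U"
    and \<sigma>: "fs_morphism (fs_sub ?M U) (rep_space c f) \<sigma>"
    and "frame f c p" "\<forall>y\<in>U. \<forall>w\<in>verts Q. frame_mat c c p w (\<sigma> y) = 1\<^sub>m (c w)"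
    and nak: "\<forall>y\<in>U. \<sigma> y \<in> nak_reps Q c f" and sec: "\<forall>y\<in>U. rep_orbit c (\<sigma> y) = y"
    by (rule local_section[OF D(1)])
  let ?V = "{z \<in> fs_points (fs_prod ?M ?A). fst z \<in> U}"
  let ?Z = "fs_sub (fs_prod ?M ?A) ?V"
  have V: "openin (fs_top (fs_prod ?M ?A)) ?V" by (rule morphism_openin[OF morphism_fst[OF fM fA] U(1)])
  have pV: "fs_points ?Z = ?V" by auto
  have fZ: "function_space ?Z" by (rule function_space_sub[OF fP])
  interpret Z: quiver_family Q ?Z by (rule quiver_familyI[OF fZ])
  have "fs_morphism ?Z (fs_sub ?M U) fst"
    by (rule morphism_into_sub[OF fZ morphism_restrict[OF fP morphism_fst[OF fM fA]]]) (simp only: pV, simp)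
  from morphism_comp[OF this \<sigma>] have F: "Z.reg_rep (fs_points ?Z) c f (\<sigma> \<circ> fst)"
    by (rule Z.reg_rep_morphism)
  have x: "reg ?Z (fs_points ?Z) (\<lambda>z. snd z i)" if "i < 2 * N_loops" for i
    by (rule reg_affine_coord[OF morphism_restrict[OF fP morphism_snd[OF fM fA]] that])
  have "Z.reg_rep (fs_points ?Z) c f (\<lambda>z. twist (snd z) ((\<sigma> \<circ> fst) z))"
    unfolding twist_def
    by (rule reg_rep_shift[OF fZ F]) (use x index in fastforce)+
  then have "fs_morphism ?Z (rep_space c f) (\<lambda>z. twist (snd z) ((\<sigma> \<circ> fst) z))"
  proof (rule Z.morphism_into_reps)
    fix z assume "z \<in> fs_points ?Z"
    then have "fst z \<in> U" unfolding pV by simp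
    then show "twist (snd z) ((\<sigma> \<circ> fst) z) \<in> nak_reps Q c f"
      unfolding twist_def using shift_nak[OF nak[rule_format]] by simp
  qed
  from morphism_comp[OF this morphism_rep_orbit]
  have "fs_morphism ?Z ?M (\<lambda>z. rep_orbit c (twist (snd z) (\<sigma> (fst z))))" by (simp add: o_def)
  moreover have "twist_orbit c f z = rep_orbit c (twist (snd z) (\<sigma> (fst z)))" if "z \<in> ?V" for z
    using twist_orbit_eq[OF nak[rule_format], of "fst z" "snd z"] sec that by simp
  ultimately show "\<exists>V \<psi>. openin (fs_top (fs_prod ?M ?A)) V \<and> z \<in> V \<and>
      fs_morphism (fs_sub (fs_prod ?M ?A) V) ?M \<psi> \<and> (\<forall>y\<in>V. twist_orbit c f y = \<psi> y)"
    using V z U(2) D(2)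
    by (intro exI[of _ ?V] exI[of _ "\<lambda>z. rep_orbit c (twist (snd z) (\<sigma> (fst z)))"]) simp
qed

end

locale nakajima_correspondence_setup =
  nakajima_pair Q v d d' f + loop_enumeration Q v loop_at index
  for Q :: "('v, 'e) pre_digraph" and v d d' f loop_at index
begin

abbreviation M0 where "M0 \<equiv> nakajima_variety Q d f"
abbreviation M1 where "M1 \<equiv> nakajima_variety Q d' f"
abbreviation A where "A \<equiv> affine_space (2 * N_loops)"
abbreviation T where "T \<equiv> quasi_affine (split_coords Q d d' f) (split_triples Q d d' f)"
abbreviation MS where "MS \<equiv> split_parabolic_variety Q d d' f"
abbreviation NC where "NC \<equiv> nakajima_correspondence Q d d' f"

definition related :: "('v, 'e) qrep \<Rightarrow> ('v, 'e) qrep \<Rightarrow> ('v \<Rightarrow> complex mat) \<Rightarrow> bool" where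
  "related D D' \<pi> \<longleftrightarrow> D \<in> nak_reps Q d f \<and> D' \<in> nak_reps Q d' f \<and> \<pi> \<in> qrep_maps Q d d' D D'"

definition NS where "NS = {(rep_orbit d D, rep_orbit d' D') |D D'. \<exists>\<pi>. related D D' \<pi>}"

lemma space_M0: "function_space M0" and space_M1: "function_space M1" and space_A: "function_space A"
  by (rule function_space_nakajima function_space_affine)+

lemma space_T: "function_space T"
  by (rule function_space_quasi_affine)

lemma space_MS: "function_space MS"
  unfolding split_parabolic_variety_def by (rule function_space_quotient[OF space_T])

text \<open>
  Maps to a stable representation are surjective, so the pairs in the correspondence are exactly the
  related ones.
\<close>

lemma NC_eq: "NC = fs_sub (fs_prod M0 M1) NS"
proof -
  have "{(rep_orbit d D, rep_orbit d' D') |D D'. D \<in> nak_reps Q d f \<and> D' \<in> nak_reps Q d' f \<and>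
          (\<exists>\<pi>\<in>qrep_maps Q d d' D D'. surjective_map Q d d' \<pi>)} = NS"
    unfolding NS_def related_def using map_surjective nak_repsD by blast
  then show ?thesis unfolding nakajima_correspondence_def by simp
qed

lemma points_NC: "fs_points NC = NS"
proof -
  have "NS \<subseteq> fs_points (fs_prod M0 M1)"
    unfolding NS_def related_def points_prod[OF space_M0 space_M1] points_nakajima by blast
  then show ?thesis unfolding NC_eq by auto
qed

lemma space_NC: "function_space NC"
  unfolding NC_eq by (rule function_space_sub[OF function_space_prod[OF space_M0 space_M1]])

lemma points_MS: "fs_points MS = triple_orbit ` split_triples Q d d' f"
  unfolding split_parabolic_variety_def points_quotient by (auto simp: orbits_def)

definition coords :: "('v, 'e) qrep \<Rightarrow> ('v, 'e) qrep \<Rightarrow> nat \<Rightarrow> complex" where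
  "coords D D' = (\<lambda>k\<in>{..<2 * N_loops}. if k < N_loops then defect_A D D' (loop_at k)
     else defect_B D D' (loop_at (k - N_loops)))"

text \<open>
  The choice of representatives and of the map is immaterial by \<open>Phi_eq\<close>: the defects are invariant,
  and isomorphic pairs have isomorphic untwisted triples.
\<close>

definition Phi :: "('v, 'e) qrep set \<times> ('v, 'e) qrep set \<Rightarrow> ('v, 'e) qtriple set \<times> (nat \<Rightarrow> complex)" where
  "Phi z = (let (D, D', \<pi>) = (SOME (D, D', \<pi>). related D D' \<pi> \<and> z = (rep_orbit d D, rep_orbit d' D'))
     in (triple_orbit (untwist D D' D, untwist D D' D', \<pi>), coords D D'))"

lemma Phi_eq:
  assumes r: "related D D' \<pi>"
  shows "Phi (rep_orbit d D, rep_orbit d' D') = (triple_orbit (untwist D D' D, untwist D D' D', \<pi>), coords D D')"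
proof -
  let ?P = "\<lambda>(E, E', \<rho>). related E E' \<rho> \<and> (rep_orbit d D, rep_orbit d' D') = (rep_orbit d E, rep_orbit d' E')"
  obtain E E' \<rho> where E: "(SOME t. ?P t) = (E, E', \<rho>)" by (rule prod_cases3[of "SOME t. ?P t"])
  have "?P (SOME t. ?P t)" by (rule someI[of ?P "(D, D', \<pi>)"]) (use r in simp)
  then have s: "related E E' \<rho>" and o: "rep_orbit d D = rep_orbit d E" "rep_orbit d' D' = rep_orbit d' E'"
    unfolding E by auto
  note r' = r[unfolded related_def] and s' = s[unfolded related_def]
  have q: "D \<in> qreps Q d f" "E \<in> qreps Q d f" "D' \<in> qreps Q d' f" "E' \<in> qreps Q d' f"
    using r' s' nak_repsD by blast+
  have iso: "qrep_iso d D E" "qrep_iso d' D' E'"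
    using o rep_orbit_eq_iff[OF q(1,2)] rep_orbit_eq_iff[OF q(3,4)] by blast+
  have "coords E E' = coords D D'"
    unfolding coords_def using defect_iso[OF q(1,2) iso(1) q(3,4) iso(2)] loop_at by (intro restrict_ext) auto
  moreover have "triple_orbit (untwist D D' D, untwist D D' D', \<pi>) = triple_orbit (untwist E E' E, untwist E E' E', \<rho>)"
    using r' s' by (intro untwist_iso iso) auto
  moreover have "Phi (rep_orbit d D, rep_orbit d' D') = (triple_orbit (untwist E E' E, untwist E E' E', \<rho>), coords E E')"
    unfolding Phi_def E by simp
  ultimately show ?thesis by simp
qed

definition orbit_fst where "orbit_fst y = rep_orbit d (fst (SOME t. t \<in> split_triples Q d d' f \<and> triple_orbit t = y))"
definition orbit_snd where "orbit_snd y = rep_orbit d' (fst (snd (SOME t. t \<in> split_triples Q d d' f \<and> triple_orbit t = y)))"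

lemma orbit_fst_snd_eq:
  assumes t: "(D, D', \<pi>) \<in> split_triples Q d d' f"
  shows "orbit_fst (triple_orbit (D, D', \<pi>)) = rep_orbit d D"
    and "orbit_snd (triple_orbit (D, D', \<pi>)) = rep_orbit d' D'"
proof -
  let ?P = "\<lambda>t. t \<in> split_triples Q d d' f \<and> triple_orbit t = triple_orbit (D, D', \<pi>)"
  obtain E E' \<rho> where E: "(SOME t. ?P t) = (E, E', \<rho>)" by (rule prod_cases3[of "SOME t. ?P t"])
  have "?P (SOME t. ?P t)" by (rule someI[of ?P "(D, D', \<pi>)"]) (use t in simp)
  then have s: "(E, E', \<rho>) \<in> split_triples Q d d' f" and o: "triple_orbit (E, E', \<rho>) = triple_orbit (D, D', \<pi>)"
    unfolding E by auto
  note t' = split_triplesD[OF t] and s' = split_triplesD[OF s]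
  have "qrep_iso d E D" "qrep_iso d' E' D'"
    using triple_orbit_eqD[OF s'(1-3) t'(1-3) o] by auto
  then show "orbit_fst (triple_orbit (D, D', \<pi>)) = rep_orbit d D" "orbit_snd (triple_orbit (D, D', \<pi>)) = rep_orbit d' D'"
    unfolding orbit_fst_def orbit_snd_def E
    using rep_orbit_eq_iff[OF nak_repsD(1)[OF s'(1)] nak_repsD(1)[OF t'(1)]]
      rep_orbit_eq_iff[OF nak_repsD(1)[OF s'(2)] nak_repsD(1)[OF t'(2)]] by simp_all
qed

definition Psi :: "('v, 'e) qtriple set \<times> (nat \<Rightarrow> complex) \<Rightarrow> ('v, 'e) qrep set \<times> ('v, 'e) qrep set" where
  "Psi z = (twist_orbit d f (orbit_fst (fst z), snd z), twist_orbit d' f (orbit_snd (fst z), snd z))"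

lemma Psi_eq:
  assumes t: "(D, D', \<pi>) \<in> split_triples Q d d' f"
  shows "Psi (triple_orbit (D, D', \<pi>), x) = (rep_orbit d (twist x D), rep_orbit d' (twist x D'))"
  unfolding Psi_def
  using twist_orbit_eq[OF split_triplesD(1)[OF t]] twist_orbit_eq[OF split_triplesD(2)[OF t]] orbit_fst_snd_eq[OF t] by simp

lemma related_twist:
  assumes t: "(D, D', \<pi>) \<in> split_triples Q d d' f"
  shows "related (twist x D) (twist x D') \<pi>"
  unfolding related_def twist_def
  using shift_nak[OF split_triplesD(1)[OF t]] shift_nak[OF split_triplesD(2)[OF t]]
    shift_map[OF nak_repsD(1)[OF split_triplesD(1)[OF t]] nak_repsD(1)[OF split_triplesD(2)[OF t]] split_triplesD(3)[OF t]]
  by blast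

lemma coords_index:
  assumes "e \<in> loops"
  shows "coords D D' (index e) = defect_A D D' e" "coords D D' (N_loops + index e) = defect_B D D' e"
  using index[OF assms] by (simp_all add: coords_def)

lemma twist_untwist:
  assumes E: "E \<in> qreps Q c f"
  shows "twist (coords D D') (untwist D D' E) = E"
proof -
  have "twist (coords D D') (untwist D D' E) = shift (\<lambda>_. 0) (\<lambda>_. 0) E"
    unfolding twist_def untwist_def shift_shift[OF E] by (rule shift_cong) (simp_all add: coords_index)
  then show ?thesis by (simp add: shift_zero[OF E])
qed

lemma defect_twist:
  assumes t: "(D, D', \<pi>) \<in> split_triples Q d d' f" and e: "e \<in> loops"
  shows "defect_A (twist x D) (twist x D') e = x (index e)"
    "defect_B (twist x D) (twist x D') e = x (N_loops + index e)"
  unfolding twist_def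
  using defect_shift[OF nak_repsD(1)[OF split_triplesD(1)[OF t]] nak_repsD(1)[OF split_triplesD(2)[OF t]] e]
    defect_zero[OF split_triplesD[OF t] e] by simp_all

text \<open>
  A split triple has defect zero, so the twisted triple has exactly the added scalars as defects.
\<close>

lemma coords_twist:
  assumes t: "(D, D', \<pi>) \<in> split_triples Q d d' f" and x: "x \<in> {..<2 * N_loops} \<rightarrow>\<^sub>E UNIV"
  shows "coords (twist x D) (twist x D') = x"
proof (rule extensionalityI[of _ "{..<2 * N_loops}"])
  fix k assume k: "k \<in> {..<2 * N_loops}"
  show "coords (twist x D) (twist x D') k = x k"
  proof (cases "k < N_loops")
    case True
    then show ?thesis
      using k loop_at[OF True] defect_twist(1)[OF t, of "loop_at k" x] by (simp add: coords_def)
  next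
    case False
    then have "k - N_loops < N_loops" using k by auto
    then show ?thesis
      using k False loop_at[of "k - N_loops"] defect_twist(2)[OF t, of "loop_at (k - N_loops)" x]
      by (simp add: coords_def)
  qed
qed (use x in \<open>auto simp: coords_def PiE_iff\<close>)

lemma untwist_twist:
  assumes t: "(D, D', \<pi>) \<in> split_triples Q d d' f" and E: "E \<in> qreps Q c f"
  shows "untwist (twist x D) (twist x D') (twist x E) = E"
proof -
  have *: "shift a b (twist x E) = shift (\<lambda>e. a e + x (index e)) (\<lambda>e. b e + x (N_loops + index e)) E" for a b
    by (simp add: twist_def shift_shift[OF E])
  have "untwist (twist x D) (twist x D') (twist x E) = shift (\<lambda>_. 0) (\<lambda>_. 0) E"
    unfolding untwist_def * by (rule shift_cong) (simp_all add: defect_twist[OF t])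
  then show ?thesis by (simp add: shift_zero[OF E])
qed

lemma Psi_Phi:
  assumes "z \<in> NS"
  shows "Psi (Phi z) = z"
proof -
  obtain D D' \<pi> where z: "z = (rep_orbit d D, rep_orbit d' D')" and r: "related D D' \<pi>"
    using assms unfolding NS_def by blast
  note r' = r[unfolded related_def]
  have t: "(untwist D D' D, untwist D D' D', \<pi>) \<in> split_triples Q d d' f"
    using r' by (intro untwist_split) auto
  have q: "D \<in> qreps Q d f" "D' \<in> qreps Q d' f" using r' nak_repsD(1) by blast+
  show ?thesis
    unfolding z Phi_eq[OF r] Psi_eq[OF t] twist_untwist[OF q(1)] twist_untwist[OF q(2)] ..
qed

lemma Phi_Psi:
  assumes y: "y \<in> fs_points MS" and x: "x \<in> {..<2 * N_loops} \<rightarrow>\<^sub>E UNIV"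
  shows "Phi (Psi (y, x)) = (y, x)"
proof -
  obtain D D' \<pi> where t: "(D, D', \<pi>) \<in> split_triples Q d d' f" and y: "y = triple_orbit (D, D', \<pi>)"
    using y unfolding points_MS by auto
  show ?thesis
    unfolding y Psi_eq[OF t] Phi_eq[OF related_twist[OF t]]
    using coords_twist[OF t x] untwist_twist[OF t nak_repsD(1)[OF split_triplesD(1)[OF t]]]
      untwist_twist[OF t nak_repsD(1)[OF split_triplesD(2)[OF t]]] by simp
qed

text \<open>
  A formal composition: the two components of a split triple descend to the quotient, and each is
  then twisted.
\<close>

lemma morphism_Psi: "fs_morphism (fs_prod MS A) NC Psi"
proof -
  note fP = function_space_prod[OF space_MS space_A]
  interpret T: quiver_family Q T by (rule quiver_familyI[OF space_T])
  have coordD: "reg T (split_triples Q d d' f) (\<lambda>t. c (fst t))" if "c \<in> qrep_coords Q d f" for c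
  proof (rule reg_quasi_affine[OF polyfun.coord])
    have "(\<lambda>t. c (fst t)) = (\<lambda>(D0, D1, \<pi>). c D0)" by auto
    then show "(\<lambda>t. c (fst t)) \<in> split_coords Q d d' f" unfolding split_coords_def using that by blast
  qed
  have coordD': "reg T (split_triples Q d d' f) (\<lambda>t. c (fst (snd t)))" if "c \<in> qrep_coords Q d' f" for c
  proof (rule reg_quasi_affine[OF polyfun.coord])
    have "(\<lambda>t. c (fst (snd t))) = (\<lambda>(D0, D1, \<pi>). c D1)" by auto
    then show "(\<lambda>t. c (fst (snd t))) \<in> split_coords Q d d' f" unfolding split_coords_def using that by blast
  qed
  have "fs_morphism T (rep_space d f) fst"
    by (rule morphism_into_quasi_affine[OF space_T]) (use coordD split_triplesD(1) in \<open>auto simp: o_def\<close>)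
  from morphism_comp[OF this morphism_rep_orbit]
  have m0: "fs_morphism MS M0 orbit_fst"
    unfolding split_parabolic_variety_def
    by (rule morphism_from_quotient[OF _ _ space_T]) (auto simp: orbit_fst_snd_eq)
  have "fs_morphism T (rep_space d' f) (\<lambda>t. fst (snd t))"
    by (rule morphism_into_quasi_affine[OF space_T]) (use coordD' split_triplesD(2) in \<open>auto simp: o_def\<close>)
  from morphism_comp[OF this morphism_rep_orbit]
  have m1: "fs_morphism MS M1 orbit_snd"
    unfolding split_parabolic_variety_def
    by (rule morphism_from_quotient[OF _ _ space_T]) (auto simp: orbit_fst_snd_eq)
  note f = morphism_fst[OF space_MS space_A] and s = morphism_snd[OF space_MS space_A]
  have "fs_morphism (fs_prod MS A) (fs_prod M0 M1) Psi"
    using morphism_pair[OF space_M0 space_M1 fP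
        morphism_comp[OF morphism_pair[OF space_M0 space_A fP morphism_comp[OF f m0] s] morphism_twist_orbit]
        morphism_comp[OF morphism_pair[OF space_M1 space_A fP morphism_comp[OF f m1] s] morphism_twist_orbit]]
    by (simp add: o_def Psi_def[abs_def])
  moreover have "Psi z \<in> NS" if "z \<in> fs_points (fs_prod MS A)" for z
  proof -
    obtain D D' \<pi> x where "(D, D', \<pi>) \<in> split_triples Q d d' f" "z = (triple_orbit (D, D', \<pi>), x)"
      using \<open>z \<in> _\<close> unfolding points_prod[OF space_MS space_A] points_MS by auto
    then show ?thesis unfolding NS_def using Psi_eq related_twist by blast
  qed
  ultimately show ?thesis unfolding NC_eq by (rule morphism_into_sub[OF fP])
qed

text \<open>
  Near a given pair, representatives of both orbits are chosen by local sections; then the map, the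
  defects and the untwisted triple are all given by regular formulas.
\<close>

lemma morphism_Phi: "fs_morphism NC (fs_prod MS A) Phi"
proof (rule morphism_local[OF space_NC])
  fix z assume "z \<in> fs_points NC"
  then have zN: "z \<in> NS" unfolding points_NC .
  then obtain D D' \<pi> where z: "z = (rep_orbit d D, rep_orbit d' D')" and r: "related D D' \<pi>"
    unfolding NS_def by blast
  have D: "D \<in> nak_reps Q d f" and D': "D' \<in> nak_reps Q d' f" using r unfolding related_def by auto
  obtain U \<sigma> p where U: "openin (fs_top M0) U" "rep_orbit d D \<in> U"
    and \<sigma>: "fs_morphism (fs_sub M0 U) (rep_space d f) \<sigma>"
    and p: "frame f d p" "\<forall>y\<in>U. \<forall>w\<in>verts Q. frame_mat d d p w (\<sigma> y) = 1\<^sub>m (d w)"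
    and nak: "\<forall>y\<in>U. \<sigma> y \<in> nak_reps Q d f" and sec: "\<forall>y\<in>U. rep_orbit d (\<sigma> y) = y"
    by (rule local_section[OF D])
  obtain U' \<sigma>' p' where U': "openin (fs_top M1) U'" "rep_orbit d' D' \<in> U'"
    and \<sigma>': "fs_morphism (fs_sub M1 U') (rep_space d' f) \<sigma>'"
    and "frame f d' p'" "\<forall>y\<in>U'. \<forall>w\<in>verts Q. frame_mat d' d' p' w (\<sigma>' y) = 1\<^sub>m (d' w)"
    and nak': "\<forall>y\<in>U'. \<sigma>' y \<in> nak_reps Q d' f" and sec': "\<forall>y\<in>U'. rep_orbit d' (\<sigma>' y) = y"
    by (rule local_section[OF D'])
  have fP: "function_space (fs_prod M0 M1)" by (rule function_space_prod[OF space_M0 space_M1])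
  have f: "fs_morphism NC M0 fst" and s: "fs_morphism NC M1 snd"
    unfolding NC_eq
    by (rule morphism_restrict[OF fP morphism_fst[OF space_M0 space_M1]], rule morphism_restrict[OF fP morphism_snd[OF space_M0 space_M1]])
  define V where "V = {z \<in> fs_points NC. fst z \<in> U} \<inter> {z \<in> fs_points NC. snd z \<in> U'}"
  have V: "openin (fs_top NC) V"
    unfolding V_def by (intro openin_Int morphism_openin[OF f U(1)] morphism_openin[OF s U'(1)])
  have VD: "fst y \<in> U" "snd y \<in> U'" "y \<in> NS" if "y \<in> V" for y
    using that unfolding V_def points_NC by auto
  let ?Z = "fs_sub NC V"
  have pV: "fs_points ?Z = V" using openin_subset[OF V] by auto
  have fZ: "function_space ?Z" by (rule function_space_sub[OF space_NC])
  interpret Z: quiver_family Q ?Z by (rule quiver_familyI[OF fZ])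
  have oZ: "openin (fs_top ?Z) (fs_points ?Z)" by (rule openin_topspace)
  let ?F = "\<sigma> \<circ> fst" and ?F' = "\<sigma>' \<circ> snd"
  have "fs_morphism ?Z (fs_sub M0 U) fst"
    by (rule morphism_into_sub[OF fZ morphism_restrict[OF space_NC f]]) (simp only: pV VD)
  from morphism_comp[OF this \<sigma>] have F: "Z.reg_rep (fs_points ?Z) d f ?F"
    by (rule Z.reg_rep_morphism)
  have "fs_morphism ?Z (fs_sub M1 U') snd"
    by (rule morphism_into_sub[OF fZ morphism_restrict[OF space_NC s]]) (simp only: pV VD)
  from morphism_comp[OF this \<sigma>'] have F': "Z.reg_rep (fs_points ?Z) d' f ?F'"
    by (rule Z.reg_rep_morphism)
  have Fn: "?F y \<in> nak_reps Q d f" "?F' y \<in> nak_reps Q d' f" if "y \<in> V" for y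
    using nak nak' VD[OF that] by auto
  note Fq = Fn[THEN nak_repsD(1)]
  \<comment> \<open>On normalized representatives the map is the matrix of frame vectors of the target.\<close>
  define P where "P y = (\<lambda>w\<in>verts Q. frame_mat d' d p w (?F' y))"
    for y :: "('v, 'e) qrep set \<times> ('v, 'e) qrep set"
  have rel: "related (?F y) (?F' y) (P y)" if y: "y \<in> V" for y
  proof -
    obtain E E' \<rho> where E: "y = (rep_orbit d E, rep_orbit d' E')" and rE: "related E E' \<rho>"
      using VD(3)[OF y] unfolding NS_def by blast
    note e = rE[unfolded related_def]
    have Eq: "E \<in> qreps Q d f" "E' \<in> qreps Q d' f" using e nak_repsD by blast+
    have "qrep_iso d E (?F y)" "qrep_iso d' E' (?F' y)"
      using bspec[OF sec VD(1)[OF y]] bspec[OF sec' VD(2)[OF y]] rep_orbit_eq_iff[OF Eq(1) Fq(1)[OF y]]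
        rep_orbit_eq_iff[OF Eq(2) Fq(2)[OF y]] E by auto
    then obtain g h where g: "g \<in> qrep_maps Q d d E (?F y)" "\<And>w. w \<in> verts Q \<Longrightarrow> det (g w) \<noteq> 0"
      and h: "h \<in> qrep_maps Q d' d' E' (?F' y)"
      unfolding qrep_iso_def by blast
    obtain \<tau> where \<tau>: "\<tau> \<in> qrep_maps Q d d' (?F y) (?F' y)"
      using transported_map[OF Eq _ Fq(1)[OF y] Fq(2)[OF y] g h] e by blast
    have "\<tau> = P y"
    proof (rule extensionalityI[of _ "verts Q"])
      show "\<tau> \<in> extensional (verts Q)" using \<tau> unfolding qrep_maps_def by (simp add: PiE_iff)
      show "P y \<in> extensional (verts Q)" by (simp add: P_def)
      fix w assume w: "w \<in> verts Q"
      have "\<tau> w * frame_mat d d p w (?F y) = frame_mat d' d p w (?F' y)"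
        by (rule frame_mat_map[OF p(1) w Fq(1)[OF y] Fq(2)[OF y] \<tau>])
      then show "\<tau> w = P y w"
        using p(2)[rule_format, OF VD(1)[OF y] w] map_carrier[OF \<tau> w] w by (simp add: P_def)
    qed
    then show ?thesis unfolding related_def using Fn[OF y] \<tau> by simp
  qed
  have P: "Z.reg_mat (fs_points ?Z) (d' w) (d w) (\<lambda>y. P y w)" if w: "w \<in> verts Q" for w
    using Z.reg_frame_mat[OF p(1) F' _ w] Fq(2) w unfolding pV P_def by simp
  have defA: "reg ?Z (fs_points ?Z) (\<lambda>y. defect_A (?F y) (?F' y) e)"
    and defB: "reg ?Z (fs_points ?Z) (\<lambda>y. defect_B (?F y) (?F' y) e)" if e: "e \<in> loops" for e
    unfolding defect_A_def defect_B_def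
    by (rule Z.reg_diff[OF Z.reg_mat_trace[OF oZ reg_rep_loop(1)[OF fZ F e]] Z.reg_mat_trace[OF oZ reg_rep_loop(1)[OF fZ F' e]]])
      (rule Z.reg_diff[OF Z.reg_mat_trace[OF oZ reg_rep_loop(2)[OF fZ F e]] Z.reg_mat_trace[OF oZ reg_rep_loop(2)[OF fZ F' e]]])
  have unt: "Z.reg_rep (fs_points ?Z) d f (\<lambda>y. untwist (?F y) (?F' y) (?F y))"
    "Z.reg_rep (fs_points ?Z) d' f (\<lambda>y. untwist (?F y) (?F' y) (?F' y))"
    unfolding untwist_def
    by (rule reg_rep_shift[OF fZ F]; intro Z.reg_uminus defA defB; assumption)
      (rule reg_rep_shift[OF fZ F']; intro Z.reg_uminus defA defB; assumption)
  have "fs_morphism ?Z T (\<lambda>y. (untwist (?F y) (?F' y) (?F y), untwist (?F y) (?F' y) (?F' y), P y))"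
  proof (rule Z.morphism_into_triples[OF unt P])
    fix y assume "y \<in> fs_points ?Z"
    then have "related (?F y) (?F' y) (P y)" unfolding pV by (rule rel)
    then show "(untwist (?F y) (?F' y) (?F y), untwist (?F y) (?F' y) (?F' y), P y) \<in> split_triples Q d d' f"
      unfolding related_def by (elim conjE) (rule untwist_split)
  qed
  from morphism_comp[OF this morphism_orbit]
  have "fs_morphism ?Z MS (\<lambda>y. triple_orbit (untwist (?F y) (?F' y) (?F y), untwist (?F y) (?F' y) (?F' y), P y))"
    unfolding split_parabolic_variety_def by (simp add: o_def)
  moreover have "fs_morphism ?Z A (\<lambda>y. coords (?F y) (?F' y))"
  proof (rule morphism_into_affine[OF fZ])
    show "coords (?F y) (?F' y) \<in> {..<2 * N_loops} \<rightarrow>\<^sub>E UNIV" for y by (simp add: coords_def)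
    fix k assume k: "k < 2 * N_loops"
    show "reg ?Z (fs_points ?Z) (\<lambda>y. coords (?F y) (?F' y) k)"
    proof (cases "k < N_loops")
      case True
      then show ?thesis using k defA[of "loop_at k"] loop_at[OF True] by (simp add: coords_def)
    next
      case False
      then have "k - N_loops < N_loops" using k by auto
      then show ?thesis using k False defB[of "loop_at (k - N_loops)"] loop_at by (simp add: coords_def)
    qed
  qed
  ultimately have "fs_morphism ?Z (fs_prod MS A)
      (\<lambda>y. (triple_orbit (untwist (?F y) (?F' y) (?F y), untwist (?F y) (?F' y) (?F' y), P y), coords (?F y) (?F' y)))"
    by (rule morphism_pair[OF space_MS space_A fZ])
  moreover have "Phi y = (triple_orbit (untwist (?F y) (?F' y) (?F y), untwist (?F y) (?F' y) (?F' y), P y), coords (?F y) (?F' y))"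
    if y: "y \<in> V" for y
  proof -
    have "y = (rep_orbit d (?F y), rep_orbit d' (?F' y))"
      using bspec[OF sec VD(1)[OF y]] bspec[OF sec' VD(2)[OF y]] by (simp add: prod_eq_iff)
    then show ?thesis using Phi_eq[OF rel[OF y]] by metis
  qed
  moreover have "z \<in> V" using zN z U(2) U'(2) by (simp add: V_def points_NC)
  ultimately show "\<exists>U \<psi>. openin (fs_top NC) U \<and> z \<in> U \<and> fs_morphism (fs_sub NC U) (fs_prod MS A) \<psi> \<and>
      (\<forall>y\<in>U. Phi y = \<psi> y)"
    using V by blast
qed

lemma correspondence_isomorphic: "fs_isomorphic NC (fs_prod MS A)"
  unfolding fs_isomorphic_def
proof (intro exI conjI ballI)
  show "fs_morphism NC (fs_prod MS A) Phi" by (rule morphism_Phi)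
  show "fs_morphism (fs_prod MS A) NC Psi" by (rule morphism_Psi)
  show "Psi (Phi z) = z" if "z \<in> fs_points NC" for z by (rule Psi_Phi[OF that[unfolded points_NC]])
  show "Phi (Psi z) = z" if "z \<in> fs_points (fs_prod MS A)" for z
  proof -
    have "fst z \<in> fs_points MS" "snd z \<in> {..<2 * N_loops} \<rightarrow>\<^sub>E UNIV"
      using that unfolding points_prod[OF space_MS space_A] points_affine by (simp_all only: mem_Times_iff)
    from Phi_Psi[OF this] show ?thesis by simp
  qed
qed

end

theorem proposition1p8:
  fixes Q :: "('v, 'e) pre_digraph" and v :: 'v and d f :: "'v \<Rightarrow> nat"
  assumes "fin_digraph Q"
    and "v \<in> verts Q"
    and "\<forall>w\<in>verts Q. delta v w \<le> d w"
  shows "fs_isomorphic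
           (nakajima_correspondence Q d (\<lambda>w. d w - delta v w) f)
           (fs_prod (split_parabolic_variety Q d (\<lambda>w. d w - delta v w) f)
                    (affine_space (2 * card (arcs_between Q v v))))"
proof -
  interpret fin_digraph Q by fact
  have "finite (arcs_between Q v v)" by (simp add: arcs_between_def)
  then obtain l where l: "bij_betw l {..<card (arcs_between Q v v)} (arcs_between Q v v)"
    using ex_bij_betw_nat_finite unfolding atLeast0LessThan by blast
  let ?i = "inv_into {..<card (arcs_between Q v v)} l"
  have "1 \<le> d v" using assms(2,3) by (force simp: delta_def)
  interpret nakajima_correspondence_setup Q v d "\<lambda>w. d w - delta v w" f l ?i
  proof unfold_locales
    show "v \<in> verts Q" by (rule assms(2))
    show "d v = Suc (d v - delta v v)" using \<open>1 \<le> d v\<close> by (simp add: delta_def)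
    show "d w - delta v w = d w" if "w \<in> verts Q" "w \<noteq> v" for w using that by (simp add: delta_def)
    show "l k \<in> arcs_between Q v v \<and> ?i (l k) = k" if "k < card (arcs_between Q v v)" for k
      using bij_betwE[OF l] bij_betw_inv_into_left[OF l, of k] that by simp
    show "?i e < card (arcs_between Q v v) \<and> l (?i e) = e" if "e \<in> arcs_between Q v v" for e
      using bij_betwE[OF bij_betw_inv_into[OF l]] bij_betw_inv_into_right[OF l that] that by simp
  qed
  show ?thesis by (rule correspondence_isomorphic)
qed

end
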